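(* Let $N\in\mathbb{N}$ be odd and let $p\in\{1,\dots,\nu\}$, $\nu=[2\sqrt2N]$, be fixed. Let $e^*=e^*_{N,p}\in\,]0,1[$ be the explicit constant defined in the context, and let $Z_e=Z^{N}_{e,p}$ be the associated family of even $2N\pi$-periodic solutions of the Sitnikov equation, also defined there. For $e\in[0,e^*]$ let $\Delta(e)$ be the discriminant function of the Hill equation $$\ddot y+q(t,e)y=0,\qquad q(t,e)=\frac{r(t,e)^2-2Z_{e}(t)^2}{(Z_{e}(t)^2+r(t,e)^2)^{5/2}},$$ let $\mathcal K=\sup_{e\in[0,e^*]}|\Delta'''(e)|$ (a positive constant), and put $$\mu=\frac{3|\Delta''(0)|}{\mathcal K},\qquad P(e)=\mathcal Ke^3-3\Delta''(0)e^2-24,\qquad I_1=\,]0,\min\{\mu,e^*\}[.$$ Then the periodic solution $Z^{N}_{e,p}$ is: 1. hyperbolic for all $e\in\,]0,\min\{\mu,e^*\}[$, if $\Delta''(0)>0$; 2. elliptic, i.e. $|\Delta(e)|<2$, for all $e\in I_2=\,]0,\min\{\mu,\mu_0,e^*\}[$ if $\Delta''(0)<0$ and $P(e^* )>0$ (respectively for all $e\in I_1$ if $\Delta''(0)<0$ and $P(e^* )\le0$), where $\mu_0$ is the unique positive root of $P(e)=0$.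
   Context: Sitnikov equation. For $e\in[0,1[$, $r(t,e)=\frac12(1-e\cos u)$, where $u=u(t,e)$ is defined by Kepler's equation $u-e\sin u=t$. $z(t;\xi,e)$ denotes the solution (defined for all $t\in\mathbb{R}$) of the Sitnikov equation $\ddot z=-z/(z^2+r(t,e)^2)^{3/2}$ with $z(0)=\xi$, $\dot z(0)=0$. Put $F_N(\xi,e)=\dot z(N\pi;\xi,e)$. $[x]$ denotes the integer part of $x$. The numbers $\xi_p$, $\xi_*$, $\Delta_*$. For $e=0$ (so $r\equiv 1/2$) the set of $\xi>0$ with $F_N(\xi,0)=0$ is $\{\xi_1,\dots,\xi_\nu\}$ with $\xi_1>\dots>\xi_\nu$, labelled so that $z(t;\xi_p,0)$ has $p$ zeros in $[0,N\pi]$. $\xi_*>0$ is a fixed a priori bound: every even $2N\pi$-periodic solution $z(t)$ of the Sitnikov equation satisfies $|z(t)|<\xi_*$ for all $t$. With $\xi_0:=\xi_*$ and $\xi_{\nu+1}:=0$, put $\Delta_*=\min\{\xi_j-\xi_{j+1}:0\le j\le\nu\}$. The constant $e^*_{N,p}$. For $\xi\in[0,\xi_*]$ let $R_0(\xi)$ be the maximum of the sup norms on $[0,N\pi]$ of $\phi_1,\dot\phi_1,\phi_2,\dot\phi_2$, where $\phi_1,\phi_2$ are the solutions of the variational equation at $e=0$, $$\ddot y+\frac{\frac14-2z^2}{(z^2+\frac14)^{5/2}}\,y=0,\qquad z=z(t;\xi,0),$$ with $\phi_1(0)=\dot\phi_2(0)=1$, $\dot\phi_1(0)=\phi_2(0)=0$;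 let $r_0=\sup_{\xi\in[0,\xi_*]}R_0(\xi)$. Put $$b_1(e)=\frac{9216(N\pi)^2e}{(1-e)^8},\quad b_2(e)=\frac{192N\pi e}{(1-e)^5},\quad R_m(e)^2=\frac{\sqrt{9b_2(e)^2+20b_1(e)}-3b_2(e)}{10b_1(e)},\ R_m(e)>0,$$ and let $E^*\in\,]0,1[$ be the root of $-2R_m(e)^3\big(2b_1(e)R_m(e)^2+b_2(e)\big)=-r_0$. Set $\mathcal R=R_m(E^* )$, $\sigma^*=16/(1-E^* )^3$, $$\Psi=\frac{12N\pi\sigma^*(1+3N\pi\sigma^*\mathcal R^2)\mathcal R^3}{(1-E^* )^2},\qquad E^{**}=\min\Big\{E^*,\frac{|\dot\phi_1(N\pi)|}{2\Psi}\Big\},$$ $$M=\frac{12N\pi(1+2N\pi\sigma^*\mathcal R^2)}{(1-E^* )^4\big(|\dot\phi_1(N\pi)|-\Psi E^{**}\big)},\qquad e^*=e^*_{N,p}=\min\Big\{E^{**},\frac{\Delta_*}{M}\Big\},$$ where in these last formulas $\phi_1$ is the function above for $\xi=\xi_p$. The family. There is a smooth function $\xi=\mathcal H_{N,p}(e)$, $e\in[0,e^*[$, with $\mathcal H_{N,p}(0)=\xi_p$, solving $\frac{d\xi}{de}=-\frac{\partial_eF_N(\xi,e)}{\partial_\xi F_N(\xi,e)}$, such that $Z^{N}_{e,p}(t)=z(t;\mathcal H_{N,p}(e),e)$ is an even $2N\pi$-periodic solution of the Sitnikov equation with $|Z^N_{e,p}|\le\xi_p+\gamma e$, where $\gamma=M\mathcal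 R+\frac{3N\pi\sigma^*\mathcal R^2}{2(1-e^* )}$. At the endpoint $e=e^*$ the family is understood as its limit. Discriminant. $\Delta(e)=y_1(2N\pi,e)+\dot y_2(2N\pi,e)$, where $y_1,y_2$ are the solutions of $\ddot y+q(t,e)y=0$ with $y_1(0,e)=\dot y_2(0,e)=1$, $\dot y_1(0,e)=y_2(0,e)=0$. Derivatives of $\Delta$ are with respect to $e$. The periodic solution $Z^N_{e,p}$ is called elliptic if $|\Delta(e)|<2$ and hyperbolic if $|\Delta(e)|>2$. *)

theory Defs
  imports "HOL-Analysis.Analysis"
begin

section \<open>Derivatives relative to an interval\<close>

text \<open>\<open>deriv_on S f\<close> is one-sided at endpoints belonging to \<open>S\<close>;
  the \<open>n\<close>-th derivative on \<open>S\<close> is \<open>(deriv_on S ^^ n) f\<close>.\<close>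

definition deriv_on :: "real set \<Rightarrow> (real \<Rightarrow> real) \<Rightarrow> real \<Rightarrow> real" where
  "deriv_on S f x = vector_derivative f (at x within S)"

definition smooth_on :: "real set \<Rightarrow> (real \<Rightarrow> real) \<Rightarrow> bool" where
  "smooth_on S f \<longleftrightarrow> (\<forall>n. \<forall>x\<in>S. (deriv_on S ^^ n) f differentiable (at x within S))"

section \<open>Scalar second order equations\<close>

definition solves2 :: "(real \<Rightarrow> real \<Rightarrow> real) \<Rightarrow> (real \<Rightarrow> real) \<Rightarrow> bool" where
  "solves2 g y \<longleftrightarrow> (\<exists>v. \<forall>t. (y has_real_derivative v t) (at t) \<and>
                               (v has_real_derivative g t (y t)) (at t))"

text \<open>The solution on the whole line of \<open>y'' = g(t,y)\<close>, \<open>y(0) = a\<close>, \<open>y'(0) = b\<close>.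
  It is only used for right-hand sides for which it exists and is unique.\<close>

definition ivp2 :: "(real \<Rightarrow> real \<Rightarrow> real) \<Rightarrow> real \<Rightarrow> real \<Rightarrow> real \<Rightarrow> real" where
  "ivp2 g a b = (THE y. solves2 g y \<and> y 0 = a \<and> deriv y 0 = b)"

section \<open>The Sitnikov equation\<close>

definition kepler :: "real \<Rightarrow> real \<Rightarrow> real" where
  "kepler t e = (THE u. u - e * sin u = t)"

definition rad :: "real \<Rightarrow> real \<Rightarrow> real" where
  "rad t e = (1 - e * cos (kepler t e)) / 2"

definition sitnikov :: "real \<Rightarrow> real \<Rightarrow> real \<Rightarrow> real" where
  "sitnikov e t z = - z / (z\<^sup>2 + (rad t e)\<^sup>2) powr (3/2)"

definition zsol :: "real \<Rightarrow> real \<Rightarrow> real \<Rightarrow> real" where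
  "zsol t \<xi> e = ivp2 (sitnikov e) \<xi> 0 t"

definition F :: "nat \<Rightarrow> real \<Rightarrow> real \<Rightarrow> real" where
  "F N \<xi> e = deriv (\<lambda>t. zsol t \<xi> e) (real N * pi)"

definition even_periodic_solution :: "nat \<Rightarrow> real \<Rightarrow> (real \<Rightarrow> real) \<Rightarrow> bool" where
  "even_periodic_solution N e z \<longleftrightarrow>
     solves2 (sitnikov e) z \<and> (\<forall>t. z (- t) = z t) \<and> (\<forall>t. z (t + 2 * real N * pi) = z t)"

section \<open>The circular case \<open>e = 0\<close>\<close>

definition nu :: "nat \<Rightarrow> nat" where
  "nu N = nat \<lfloor>2 * sqrt 2 * real N\<rfloor>"

definition xi :: "nat \<Rightarrow> nat \<Rightarrow> real" where
  "xi N p = (THE \<xi>. 0 < \<xi> \<and> F N \<xi> 0 = 0 \<and>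
                     card {t \<in> {0..real N * pi}. zsol t \<xi> 0 = 0} = p)"

definition apriori_bound :: "nat \<Rightarrow> real \<Rightarrow> bool" where
  "apriori_bound N xs \<longleftrightarrow> 0 < xs \<and>
     (\<forall>e\<in>{0..<1}. \<forall>z. even_periodic_solution N e z \<longrightarrow> (\<forall>t. \<bar>z t\<bar> < xs))"

definition xi_ext :: "nat \<Rightarrow> real \<Rightarrow> nat \<Rightarrow> real" where
  "xi_ext N xs j = (if j = 0 then xs else if j \<le> nu N then xi N j else 0)"

definition Delta_star :: "nat \<Rightarrow> real \<Rightarrow> real" where
  "Delta_star N xs = Min ((\<lambda>j. xi_ext N xs j - xi_ext N xs (j + 1)) ` {0..nu N})"

text \<open>Minus the derivative with respect to \<open>z\<close> of the right-hand side of the Sitnikov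
  equation, as a function of position \<open>z\<close> and radius \<open>r\<close>; the radius is \<open>1/2\<close> if \<open>e = 0\<close>.\<close>

definition hill_coeff :: "real \<Rightarrow> real \<Rightarrow> real" where
  "hill_coeff z r = (r\<^sup>2 - 2 * z\<^sup>2) / (z\<^sup>2 + r\<^sup>2) powr (5/2)"

definition phi1 :: "real \<Rightarrow> real \<Rightarrow> real" where
  "phi1 \<xi> = ivp2 (\<lambda>t y. - hill_coeff (zsol t \<xi> 0) (1/2) * y) 1 0"

definition phi2 :: "real \<Rightarrow> real \<Rightarrow> real" where
  "phi2 \<xi> = ivp2 (\<lambda>t y. - hill_coeff (zsol t \<xi> 0) (1/2) * y) 0 1"

definition sup_norm :: "nat \<Rightarrow> (real \<Rightarrow> real) \<Rightarrow> real" where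
  "sup_norm N f = (SUP t\<in>{0..real N * pi}. \<bar>f t\<bar>)"

definition R0 :: "nat \<Rightarrow> real \<Rightarrow> real" where
  "R0 N \<xi> = Max {sup_norm N (phi1 \<xi>), sup_norm N (deriv (phi1 \<xi>)),
                  sup_norm N (phi2 \<xi>), sup_norm N (deriv (phi2 \<xi>))}"

definition r0 :: "nat \<Rightarrow> real \<Rightarrow> real" where
  "r0 N xs = (SUP \<xi>\<in>{0..xs}. R0 N \<xi>)"

section \<open>The constant \<open>e\<^sup>*\<close>\<close>

definition b1 :: "nat \<Rightarrow> real \<Rightarrow> real" where
  "b1 N e = 9216 * (real N * pi)\<^sup>2 * e / (1 - e) ^ 8"

definition b2 :: "nat \<Rightarrow> real \<Rightarrow> real" where
  "b2 N e = 192 * real N * pi * e / (1 - e) ^ 5"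

definition Rm :: "nat \<Rightarrow> real \<Rightarrow> real" where
  "Rm N e = sqrt ((sqrt (9 * (b2 N e)\<^sup>2 + 20 * b1 N e) - 3 * b2 N e) / (10 * b1 N e))"

definition E1 :: "nat \<Rightarrow> real \<Rightarrow> real" where
  "E1 N xs = (THE e. 0 < e \<and> e < 1 \<and>
     - 2 * Rm N e ^ 3 * (2 * b1 N e * (Rm N e)\<^sup>2 + b2 N e) = - r0 N xs)"

definition Rcal :: "nat \<Rightarrow> real \<Rightarrow> real" where
  "Rcal N xs = Rm N (E1 N xs)"

definition sigma_star :: "nat \<Rightarrow> real \<Rightarrow> real" where
  "sigma_star N xs = 16 / (1 - E1 N xs) ^ 3"

definition Psi :: "nat \<Rightarrow> real \<Rightarrow> real" where
  "Psi N xs = 12 * real N * pi * sigma_star N xs *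
     (1 + 3 * real N * pi * sigma_star N xs * (Rcal N xs)\<^sup>2) * Rcal N xs ^ 3 / (1 - E1 N xs)\<^sup>2"

definition dphi1_end :: "nat \<Rightarrow> nat \<Rightarrow> real" where
  "dphi1_end N p = deriv (phi1 (xi N p)) (real N * pi)"

definition E2 :: "nat \<Rightarrow> nat \<Rightarrow> real \<Rightarrow> real" where
  "E2 N p xs = min (E1 N xs) (\<bar>dphi1_end N p\<bar> / (2 * Psi N xs))"

definition Mconst :: "nat \<Rightarrow> nat \<Rightarrow> real \<Rightarrow> real" where
  "Mconst N p xs = 12 * real N * pi * (1 + 2 * real N * pi * sigma_star N xs * (Rcal N xs)\<^sup>2) /
     ((1 - E1 N xs) ^ 4 * (\<bar>dphi1_end N p\<bar> - Psi N xs * E2 N p xs))"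

definition e_star :: "nat \<Rightarrow> nat \<Rightarrow> real \<Rightarrow> real" where
  "e_star N p xs = min (E2 N p xs) (Delta_star N xs / Mconst N p xs)"

definition gamma_const :: "nat \<Rightarrow> nat \<Rightarrow> real \<Rightarrow> real" where
  "gamma_const N p xs = Mconst N p xs * Rcal N xs +
     3 * real N * pi * sigma_star N xs * (Rcal N xs)\<^sup>2 / (2 * (1 - e_star N p xs))"

section \<open>The family of periodic solutions\<close>

definition dF_xi :: "nat \<Rightarrow> real \<Rightarrow> real \<Rightarrow> real" where
  "dF_xi N \<xi> e = deriv (\<lambda>x. F N x e) \<xi>"

definition dF_e :: "nat \<Rightarrow> real \<Rightarrow> real \<Rightarrow> real" where
  "dF_e N \<xi> e = deriv_on {0..<1} (F N \<xi>) e"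

definition Zfam :: "(real \<Rightarrow> real) \<Rightarrow> real \<Rightarrow> real \<Rightarrow> real" where
  "Zfam H e t = zsol t (H e) e"

text \<open>\<open>H\<close> is the function of initial positions on \<open>[0, e\<^sup>*[\<close>, extended to the endpoint
  by its limit. The denominator in the differential equation is required to be nonzero explicitly
  because division is total.\<close>

definition periodic_family :: "nat \<Rightarrow> nat \<Rightarrow> real \<Rightarrow> (real \<Rightarrow> real) \<Rightarrow> bool" where
  "periodic_family N p xs H \<longleftrightarrow>
     smooth_on {0..<e_star N p xs} H \<and>
     H 0 = xi N p \<and>
     (\<forall>e\<in>{0..<e_star N p xs}.
        dF_xi N (H e) e \<noteq> 0 \<and>
        (H has_real_derivative (- dF_e N (H e) e / dF_xi N (H e) e))
          (at e within {0..<e_star N p xs}) \<and>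
        even_periodic_solution N e (Zfam H e) \<and>
        (\<forall>t. \<bar>Zfam H e t\<bar> \<le> xi N p + gamma_const N p xs * e)) \<and>
     (H \<longlongrightarrow> H (e_star N p xs)) (at_left (e_star N p xs))"

section \<open>Discriminant, ellipticity and hyperbolicity\<close>

definition q :: "(real \<Rightarrow> real) \<Rightarrow> real \<Rightarrow> real \<Rightarrow> real" where
  "q Z t e = hill_coeff (Z t) (rad t e)"

definition discriminant :: "nat \<Rightarrow> (real \<Rightarrow> real) \<Rightarrow> real \<Rightarrow> real" where
  "discriminant N Z e =
     ivp2 (\<lambda>t y. - q Z t e * y) 1 0 (2 * real N * pi) +
     deriv (ivp2 (\<lambda>t y. - q Z t e * y) 0 1) (2 * real N * pi)"

definition elliptic :: "nat \<Rightarrow> (real \<Rightarrow> real) \<Rightarrow> real \<Rightarrow> bool" where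
  "elliptic N Z e \<longleftrightarrow> \<bar>discriminant N Z e\<bar> < 2"

definition hyperbolic :: "nat \<Rightarrow> (real \<Rightarrow> real) \<Rightarrow> real \<Rightarrow> bool" where
  "hyperbolic N Z e \<longleftrightarrow> \<bar>discriminant N Z e\<bar> > 2"

section \<open>The quantities in the stability criterion\<close>

definition Delta :: "nat \<Rightarrow> (real \<Rightarrow> real) \<Rightarrow> real \<Rightarrow> real" where
  "Delta N H e = discriminant N (Zfam H e) e"

definition Delta2 :: "nat \<Rightarrow> nat \<Rightarrow> real \<Rightarrow> (real \<Rightarrow> real) \<Rightarrow> real" where
  "Delta2 N p xs H = (deriv_on {0..e_star N p xs} ^^ 2) (Delta N H) 0"

text \<open>The supremum is taken in the extended reals, so that it is the genuine supremum whether
  or not the set is known to be bounded. In \<open>mu\<close>, a supremum \<open>0\<close> gives \<open>\<infinity>\<close>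
  if the numerator is nonzero, and a supremum \<open>\<infinity>\<close> gives \<open>0\<close>.\<close>

definition Ksup :: "nat \<Rightarrow> nat \<Rightarrow> real \<Rightarrow> (real \<Rightarrow> real) \<Rightarrow> ereal" where
  "Ksup N p xs H = (SUP e\<in>{0..e_star N p xs}.
     ereal \<bar>(deriv_on {0..e_star N p xs} ^^ 3) (Delta N H) e\<bar>)"

definition mu :: "nat \<Rightarrow> nat \<Rightarrow> real \<Rightarrow> (real \<Rightarrow> real) \<Rightarrow> ereal" where
  "mu N p xs H = ereal (3 * \<bar>Delta2 N p xs H\<bar>) / Ksup N p xs H"

definition P :: "nat \<Rightarrow> nat \<Rightarrow> real \<Rightarrow> (real \<Rightarrow> real) \<Rightarrow> real \<Rightarrow> ereal" where
  "P N p xs H e = Ksup N p xs H * ereal (e ^ 3) - ereal (3 * Delta2 N p xs H * e\<^sup>2) - 24"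

definition mu0 :: "nat \<Rightarrow> nat \<Rightarrow> real \<Rightarrow> (real \<Rightarrow> real) \<Rightarrow> real" where
  "mu0 N p xs H = (THE e. 0 < e \<and> P N p xs H e = 0)"

text \<open>The description in \<open>mu0\<close> is a proper one in the relevant case.\<close>

lemma mu0_unique:
  assumes K: "Ksup N p xs H = ereal K" "0 \<le> K" and D: "Delta2 N p xs H < 0"
  shows "\<exists>!e. 0 < e \<and> P N p xs H e = 0"
proof -
  define d where "d = - Delta2 N p xs H"
  define f where "f = (\<lambda>e::real. K * e ^ 3 + 3 * d * e\<^sup>2 - 24)"
  have d: "d > 0" using D by (simp add: d_def)
  have P: "P N p xs H e = ereal (f e)" for e
    unfolding P_def K(1) f_def d_def numeral_eq_ereal by simp
  have less: "f x < f y" if "0 \<le> x" "x < y" for x y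
  proof -
    have "x ^ 3 \<le> y ^ 3" and "x\<^sup>2 < y\<^sup>2"
      using that by (auto intro: power_mono power_strict_mono)
    then have "K * x ^ 3 \<le> K * y ^ 3" "3 * d * x\<^sup>2 < 3 * d * y\<^sup>2"
      using K(2) d by (auto intro: mult_left_mono)
    then show ?thesis by (simp add: f_def)
  qed
  define b where "b = sqrt (8 / d)"
  have b: "b > 0" "b\<^sup>2 = 8 / d" using d by (auto simp: b_def)
  have "f b \<ge> 0" using b d K(2) by (simp add: f_def)
  moreover have "f 0 \<le> 0" by (simp add: f_def)
  moreover have "continuous_on {0..b} f" unfolding f_def by (intro continuous_intros)
  ultimately obtain x where x: "0 \<le> x" "f x = 0"
    using IVT'[of f 0 0 b] b by auto
  have "x \<noteq> 0" using x by (auto simp: f_def)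
  then have "0 < x \<and> P N p xs H x = 0" using x by (simp add: P)
  moreover have "y = x" if "0 < y \<and> P N p xs H y = 0" for y
  proof (rule linorder_cases[of x y])
    assume "x < y" then show ?thesis using less[of x y] x that by (simp add: P)
  next
    assume "y < x" then show ?thesis using less[of y x] x that by (simp add: P)
  qed simp
  ultimately show ?thesis by blast
qed

end

theory Submission
  imports Defs
begin

text \<open>On \<open>[0, e\<^sup>*[\<close> the discriminant is three times differentiable with \<open>\<Delta>(0) = 2\<close> and \<open>\<Delta>'(0) = 0\<close>, so
  Taylor's formula with the bound \<open>\<K>\<close> on the third derivative decides the sign of \<open>\<Delta> - 2\<close> for
  \<open>e < \<mu>\<close> and gives \<open>\<Delta> > - 2\<close> as long as \<open>P < 0\<close>.

  Smoothness: with the eccentric anomaly as time the Sitnikov equation and its Hill equation form a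
  polynomial system. Its variational equation is again polynomial, so differentiability
  in a parameter can be iterated.

  \<open>\<Delta>(0) = 2\<close>: the time derivative of the nonconstant circular solution is a periodic solution of the
  Hill equation. \<open>\<Delta>'(0) = 0\<close>: for odd \<open>N\<close> the time shift by \<open>N \<pi>\<close> amounts to \<open>e \<mapsto> - e\<close>, which makes the
  first variation of the Hill coefficient antiperiodic.\<close>

section \<open>Ordinary differential equations\<close>

text \<open>The family is given for nonnegative eccentricities only, so the symmetry
  \<open>e\<close> to \<open>- e\<close> cannot be applied to it directly. What can be shown is that
  the defect from antisymmetry of the first variation of \<open>z\<close> solves the Hill equation
  at \<open>e = 0\<close> with zero velocity at the times 0 and \<open>2 N \<pi>\<close>. The defect
  is therefore a multiple of the first fundamental solution \<open>a\<close>, and it vanishes if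
  \<open>a' (2 N \<pi>)\<close> is nonzero. The remaining case is settled by the variation of the
  Wronskian, which writes the derivative of the discriminant at 0 as a product with
  \<open>a' (2 N \<pi>)\<close> as a factor. Regularity in \<open>e\<close> is proved only strictly
  below \<open>e\<^sup>*\<close>, since the family is smooth on a half-open interval. The supremum
  \<open>Ksup\<close> also takes in the endpoint. This is harmless: an additional value can only
  enlarge it, and it serves only as an upper bound for the third derivative.\<close>

lemma has_vector_derivative_norm2:
  fixes f :: "real \<Rightarrow> 'a::real_inner"
  assumes "(f has_vector_derivative d) (at t within S)"
  shows "((\<lambda>t. (norm (f t))\<^sup>2) has_real_derivative 2 * (f t \<bullet> d)) (at t within S)"
proof -
  have "((\<lambda>t. f t \<bullet> f t) has_derivative (\<lambda>h. f t \<bullet> (h *\<^sub>R d) + (h *\<^sub>R d) \<bullet> f t)) (at t within S)"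
    using assms unfolding has_vector_derivative_def by (intro derivative_intros)
  then show ?thesis
    unfolding has_field_derivative_def power2_norm_eq_inner
    by (rule has_derivative_eq_rhs) (auto simp: fun_eq_iff inner_commute)
qed

text \<open>The norm is not differentiable at zero, so the estimate is made for its square, which is
  why the space carries an inner product. The summand 1 in the rate \<open>2 * L + 1\<close> absorbs
  the forcing: twice the product of the norm and \<open>\<epsilon>\<close> is at most the sum of
  their squares.\<close>

lemma gronwall:
  fixes f :: "real \<Rightarrow> 'a::real_inner"
  assumes d: "\<And>t. t \<in> {0..T} \<Longrightarrow> (f has_vector_derivative f' t) (at t within {0..T})"
    and b: "\<And>t. t \<in> {0..T} \<Longrightarrow> norm (f' t) \<le> L * norm (f t) + \<epsilon>"
    and L: "0 \<le> L" and eps: "0 \<le> \<epsilon>" and t: "t \<in> {0..T}"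
  shows "(norm (f t))\<^sup>2 \<le> ((norm (f 0))\<^sup>2 + \<epsilon>\<^sup>2 * t) * exp ((2 * L + 1) * t)"
proof -
  define K where "K = 2 * L + 1"
  define g where "g = (\<lambda>t. (norm (f t))\<^sup>2 * exp (- K * t) - \<epsilon>\<^sup>2 * t)"
  define g' where "g' = (\<lambda>t. 2 * (f t \<bullet> f' t) * exp (- K * t)
    + (norm (f t))\<^sup>2 * (exp (- K * t) * (- K)) - \<epsilon>\<^sup>2)"
  have gd: "(g has_real_derivative g' s) (at s within {0..T})" if "s \<in> {0..T}" for s
    unfolding g_def g'_def
    by (rule derivative_eq_intros has_vector_derivative_norm2 d that refl | simp)+
  have "g' s \<le> 0" if s: "s \<in> {0..T}" for s
  proof -
    have "2 * (f s \<bullet> f' s) \<le> 2 * (norm (f s) * norm (f' s))"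
      using norm_cauchy_schwarz[of "f s" "f' s"] by simp
    also have "\<dots> \<le> 2 * (norm (f s) * (L * norm (f s) + \<epsilon>))"
      using b[OF s] by (intro mult_left_mono) auto
    also have "\<dots> \<le> K * (norm (f s))\<^sup>2 + \<epsilon>\<^sup>2"
      using zero_le_power2[of "norm (f s) - \<epsilon>"]
      by (simp add: K_def algebra_simps power2_eq_square)
    finally have "(2 * (f s \<bullet> f' s) - K * (norm (f s))\<^sup>2) * exp (- K * s) \<le> \<epsilon>\<^sup>2 * exp (- K * s)"
      by (intro mult_right_mono) auto
    also have "\<dots> \<le> \<epsilon>\<^sup>2"
    proof -
      have "0 \<le> K * s" using s L by (simp add: K_def)
      then show ?thesis by (intro mult_left_le) auto
    qed
    finally show ?thesis by (simp add: g'_def algebra_simps)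
  qed
  then have decr: "\<exists>y. DERIV g s :> y \<and> y \<le> 0" if "0 < s" "s < t" for s
    using gd[of s] that t by (intro exI[of _ "g' s"]) (simp add: at_within_Icc_at)
  have cont: "continuous_on {0..t} g"
  proof (rule continuous_on_subset)
    show "continuous_on {0..T} g" using gd by (rule DERIV_continuous_on)
    show "{0..t} \<subseteq> {0..T}" using t by auto
  qed
  have "g 0 \<ge> g t"
    using t by (intro DERIV_nonpos_imp_decreasing_open[OF _ decr cont]) auto
  then have "(norm (f t))\<^sup>2 * exp (- K * t) \<le> (norm (f 0))\<^sup>2 + \<epsilon>\<^sup>2 * t"
    by (simp add: g_def)
  then have "(norm (f t))\<^sup>2 * exp (- K * t) * exp (K * t) \<le> ((norm (f 0))\<^sup>2 + \<epsilon>\<^sup>2 * t) * exp (K * t)"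
    by (rule mult_right_mono) auto
  moreover have "exp (- K * t) * exp (K * t) = 1" by (simp flip: exp_add)
  ultimately show ?thesis by (simp only: K_def mult.assoc mult_1_right)
qed

lemma gronwall_linear:
  fixes f :: "real \<Rightarrow> 'a::real_inner"
  assumes d: "\<And>t. t \<in> {0..T} \<Longrightarrow> (f has_vector_derivative f' t) (at t within {0..T})"
    and b: "\<And>t. t \<in> {0..T} \<Longrightarrow> norm (f' t) \<le> L * norm (f t)"
    and L: "0 \<le> L" and t: "t \<in> {0..T}"
  shows "norm (f t) \<le> norm (f 0) * exp ((L + 1) * T)"
proof -
  have "(norm (f t))\<^sup>2 \<le> ((norm (f 0))\<^sup>2 + 0\<^sup>2 * t) * exp ((2 * L + 1) * t)"
    by (rule gronwall[OF d _ L _ t]) (use b in auto)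
  also have "\<dots> \<le> (norm (f 0))\<^sup>2 * exp (2 * ((L + 1) * T))"
  proof -
    have "(2 * L + 1) * t \<le> (2 * L + 2) * T"
      using t L by (intro mult_mono) auto
    then show ?thesis by (simp add: mult_left_mono algebra_simps)
  qed
  also have "\<dots> = (norm (f 0) * exp ((L + 1) * T))\<^sup>2"
    by (simp add: power_mult_distrib exp_double)
  finally show ?thesis by (rule power2_le_imp_le) simp
qed

lemma linear_ode_unique:
  fixes f g :: "real \<Rightarrow> 'a::real_inner"
  assumes "\<And>t. t \<in> {0..T} \<Longrightarrow> (f has_vector_derivative f' t) (at t within {0..T})"
    and "\<And>t. t \<in> {0..T} \<Longrightarrow> (g has_vector_derivative g' t) (at t within {0..T})"
    and "\<And>t. t \<in> {0..T} \<Longrightarrow> norm (f' t - g' t) \<le> L * norm (f t - g t)"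
    and "0 \<le> L" "f 0 = g 0" "t \<in> {0..T}"
  shows "f t = g t"
  using gronwall_linear[of T "\<lambda>t. f t - g t" "\<lambda>t. f' t - g' t" L t] assms
  by (auto intro: has_vector_derivative_diff)

section \<open>Global existence for Lipschitz vector fields\<close>

lemma continuous_antiderivative:
  fixes g :: "real \<Rightarrow> 'a::euclidean_space"
  assumes "continuous_on UNIV g"
  shows "\<exists>I. I 0 = 0 \<and> (\<forall>t. (I has_vector_derivative g t) (at t))"
proof (intro exI conjI allI)
  show "(LBINT y=0..ereal 0. g y) = 0"
    using interval_integral_endpoints_same[of 0 g] by (simp add: zero_ereal_def)
  fix t
  \<comment> \<open>The interval has 0 and \<open>t\<close> in its interior, so the derivative
    within it is the full derivative.\<close>
  have "((\<lambda>u. LBINT y=0..u. g y) has_vector_derivative g t) (at t within {- \<bar>t\<bar> - 1..\<bar>t\<bar> + 1})"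
    using interval_integral_FTC2[of "- \<bar>t\<bar> - 1" 0 "\<bar>t\<bar> + 1" g t] assms continuous_on_subset[of UNIV g]
    by (auto simp: zero_ereal_def)
  then show "((\<lambda>u. LBINT y=0..u. g y) has_vector_derivative g t) (at t)"
    by (subst (asm) at_within_Icc_at) auto
qed

text \<open>Integrating the exponential weight gains the factor \<open>1 / K\<close>, and this gain
  is what makes Picard iteration contract. Negative times are reduced to positive ones by
  reflection.\<close>

lemma exponential_bound:
  fixes f :: "real \<Rightarrow> 'a::real_normed_vector"
  assumes "f 0 = 0" and d: "\<And>t. (f has_vector_derivative g t) (at t)"
    and b: "\<And>t. norm (g t) \<le> A * exp (K * \<bar>t\<bar>)" and K: "0 < K" and A: "0 \<le> A"
  shows "norm (f t) \<le> A / K * exp (K * \<bar>t\<bar>)"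
proof -
  have pos: "norm (f t) \<le> A / K * exp (K * t)"
    if f0: "f 0 = 0" and d: "\<And>t. (f has_vector_derivative g t) (at t)"
      and b: "\<And>t. norm (g t) \<le> A * exp (K * \<bar>t\<bar>)" and t: "0 < t"
    for f g :: "real \<Rightarrow> 'a" and t
  proof -
    have "norm (f t - f 0) \<le> A / K * exp (K * t) - A / K * exp (K * 0)"
    proof (rule differentiable_bound_general[OF t])
      show "continuous_on {0..t} f"
        using d by (auto intro!: continuous_at_imp_continuous_on has_vector_derivative_continuous)
      show "continuous_on {0..t} (\<lambda>t. A / K * exp (K * t))"
        by (intro continuous_intros)
      show "((\<lambda>t. A / K * exp (K * t)) has_vector_derivative A * exp (K * x)) (at x)" for x
        unfolding has_real_derivative_iff_has_vector_derivative[symmetric]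
        using K by (auto intro!: derivative_eq_intros)
      show "norm (g x) \<le> A * exp (K * x)" if "0 < x" for x
        using b[of x] that by simp
    qed (use d in auto)
    moreover have "0 \<le> A / K" using K A by simp
    ultimately show ?thesis using f0 by simp
  qed
  consider "t = 0" | "t > 0" | "t < 0" by linarith
  then show ?thesis
  proof cases
    case 1 then show ?thesis using assms by simp
  next
    case 2 then show ?thesis using pos[of f g t] assms by simp
  next
    case 3
    have "norm (f (- (- t))) \<le> A / K * exp (K * (- t))"
    proof (rule pos[of "\<lambda>t. f (- t)" "\<lambda>t. - g (- t)"])
      show "((\<lambda>t. f (- t)) has_vector_derivative - g (- t)) (at t)" for t
      proof -
        have "(uminus has_vector_derivative (- 1 :: real)) (at t)"
          by (auto intro!: derivative_eq_intros)
        from vector_diff_chain_at[OF this d] show ?thesis by (simp add: o_def)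
      qed
      show "norm (- g (- t)) \<le> A * exp (K * \<bar>t\<bar>)" for t
        using b[of "- t"] by simp
    qed (use assms(1) 3 in auto)
    then show ?thesis using 3 by simp
  qed
qed

text \<open>Picard iteration converges on the whole line in the norm weighted by \<open>exp (- K \<bar>t\<bar>)\<close>
  as soon as \<open>K\<close> exceeds the Lipschitz constant.\<close>

lemma lipschitz_ode_exists:
  fixes G :: "real \<Rightarrow> 'a::euclidean_space \<Rightarrow> 'a"
  assumes cont: "continuous_on UNIV (\<lambda>(t, x). G t x)"
    and lip: "\<And>t x y. norm (G t x - G t y) \<le> L * norm (x - y)"
    and zero: "\<And>t. norm (G t 0) \<le> C" and L: "0 \<le> L"
  shows "\<exists>x. x 0 = x0 \<and> (\<forall>t. (x has_vector_derivative G t (x t)) (at t))"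
proof -
  \<comment> \<open>With this rate the contraction constant \<open>L / K\<close> is at most
    1/2.\<close>
  define K where "K = 2 * L + 1"
  have K: "K > 0" using L by (simp add: K_def)
  have C: "0 \<le> C" using zero[of 0] norm_ge_zero order_trans by blast
  \<comment> \<open>The bounded function \<open>w\<close> encodes a curve with its exponential
    growth removed; \<open>g w\<close> is the field along that curve.\<close>
  define g where "g w t = G t (exp (K * \<bar>t\<bar>) *\<^sub>R apply_bcontfun w t)" for w t
  have g_cont: "continuous_on UNIV (g w)" for w
  proof -
    have "continuous_on UNIV (\<lambda>t. (\<lambda>(t, x). G t x) (t, exp (K * \<bar>t\<bar>) *\<^sub>R apply_bcontfun w t))"
      by (rule continuous_on_compose2[OF cont]) (auto intro!: continuous_intros)
    then show ?thesis by (simp add: g_def[abs_def])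
  qed
  define I where "I w = (SOME I. I 0 = 0 \<and> (\<forall>t. (I has_vector_derivative g w t) (at t)))" for w
  have I: "I w 0 = 0" "\<And>t. (I w has_vector_derivative g w t) (at t)" for w
    using someI_ex[OF continuous_antiderivative[OF g_cont[of w]]] by (auto simp: I_def)
  have g_bound: "norm (g w t) \<le> (C + L * norm w) * exp (K * \<bar>t\<bar>)" for w t
  proof -
    have "norm (g w t) \<le> norm (G t 0) + norm (g w t - G t 0)"
      by (metis add.commute norm_triangle_sub)
    also have "\<dots> \<le> C + L * (exp (K * \<bar>t\<bar>) * norm (apply_bcontfun w t))"
      using zero[of t] lip[of t "exp (K * \<bar>t\<bar>) *\<^sub>R apply_bcontfun w t" 0]
      by (auto simp: g_def)
    also have "\<dots> \<le> C * exp (K * \<bar>t\<bar>) + L * (exp (K * \<bar>t\<bar>) * norm w)"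
      using C L K by (intro add_mono mult_left_mono norm_bounded mult_left_mono)
        (auto simp: mult_le_cancel_left1)
    finally show ?thesis by (simp add: algebra_simps)
  qed
  define T where "T w = Bcontfun (\<lambda>t. exp (- (K * \<bar>t\<bar>)) *\<^sub>R (x0 + I w t))" for w
  have T: "apply_bcontfun (T w) t = exp (- (K * \<bar>t\<bar>)) *\<^sub>R (x0 + I w t)" for w t
  proof -
    have "(\<lambda>t. exp (- (K * \<bar>t\<bar>)) *\<^sub>R (x0 + I w t)) \<in> bcontfun"
    proof (rule bcontfun_normI)
      have "continuous_on UNIV (I w)"
        using I(2) by (auto intro!: continuous_at_imp_continuous_on has_vector_derivative_continuous)
      then show "continuous_on UNIV (\<lambda>t. exp (- (K * \<bar>t\<bar>)) *\<^sub>R (x0 + I w t))"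
        by (intro continuous_intros)
      show "norm (exp (- (K * \<bar>t\<bar>)) *\<^sub>R (x0 + I w t)) \<le> norm x0 + (C + L * norm w) / K" for t
      proof -
        have "norm (I w t) \<le> (C + L * norm w) / K * exp (K * \<bar>t\<bar>)"
          by (rule exponential_bound[OF I g_bound K]) (use C L in auto)
        then have "exp (- (K * \<bar>t\<bar>)) * norm (I w t) \<le> (C + L * norm w) / K"
          by (simp add: exp_minus field_simps)
        moreover have "exp (- (K * \<bar>t\<bar>)) * norm x0 \<le> norm x0"
          using K by (intro mult_left_le_one_le) auto
        moreover have "norm (exp (- (K * \<bar>t\<bar>)) *\<^sub>R (x0 + I w t)) \<le>
            exp (- (K * \<bar>t\<bar>)) * norm x0 + exp (- (K * \<bar>t\<bar>)) * norm (I w t)"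
          by (simp add: norm_triangle_ineq flip: distrib_left)
        ultimately show ?thesis by linarith
      qed
    qed
    then show ?thesis by (simp add: T_def Bcontfun_inverse)
  qed
  have "dist (T v) (T w) \<le> 1 / 2 * dist v w" for v w
  proof (rule dist_bound)
    fix t
    have "norm (g v s - g w s) \<le> L * dist v w * exp (K * \<bar>s\<bar>)" for s
    proof -
      have "norm (g v s - g w s) \<le> L * (exp (K * \<bar>s\<bar>) * dist (apply_bcontfun v s) (apply_bcontfun w s))"
        using lip[of s "exp (K * \<bar>s\<bar>) *\<^sub>R apply_bcontfun v s" "exp (K * \<bar>s\<bar>) *\<^sub>R apply_bcontfun w s"]
        by (simp add: g_def dist_norm flip: scaleR_diff_right)
      also have "\<dots> \<le> L * (exp (K * \<bar>s\<bar>) * dist v w)"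
        using L by (intro mult_left_mono dist_bounded) auto
      finally show ?thesis by (simp add: algebra_simps)
    qed
    then have "norm (I v t - I w t) \<le> L * dist v w / K * exp (K * \<bar>t\<bar>)"
      using L K I by (intro exponential_bound[where g = "\<lambda>s. g v s - g w s"])
        (auto intro!: has_vector_derivative_diff)
    then have "exp (- (K * \<bar>t\<bar>)) * norm (I v t - I w t) \<le> L / K * dist v w"
      by (simp add: exp_minus field_simps)
    also have "\<dots> \<le> 1 / 2 * dist v w"
      using L by (intro mult_right_mono) (auto simp: K_def field_simps)
    finally show "dist (apply_bcontfun (T v) t) (apply_bcontfun (T w) t) \<le> 1 / 2 * dist v w"
      by (simp add: T dist_norm flip: scaleR_diff_right)
  qed
  then obtain w where w: "T w = w"
    using banach_fix_type[of "1/2" T] by auto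
  define x where "x = (\<lambda>t. x0 + I w t)"
  have x: "exp (K * \<bar>t\<bar>) *\<^sub>R apply_bcontfun w t = x t" for t
    by (subst w[symmetric]) (simp add: T x_def flip: exp_add)
  have "(x has_vector_derivative G t (x t)) (at t)" for t
    using I(2)[of w t] unfolding x_def g_def x
    by (auto intro!: derivative_eq_intros simp: x_def)
  then show ?thesis
    by (intro exI[of _ x]) (auto simp: x_def I)
qed

section \<open>Polynomial vector fields and smooth dependence on a parameter\<close>

text \<open>Polynomials are described without coordinates because each differentiation in the
  parameter doubles the space; moving a polynomial to the product space is then just composition
  with a projection.\<close>

inductive polyf :: "('a::real_normed_vector \<Rightarrow> real) \<Rightarrow> bool" where
  polyf_linear: "bounded_linear f \<Longrightarrow> polyf f"
| polyf_const: "polyf (\<lambda>x. c)"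
| polyf_add: "polyf f \<Longrightarrow> polyf g \<Longrightarrow> polyf (\<lambda>x. f x + g x)"
| polyf_mult: "polyf f \<Longrightarrow> polyf g \<Longrightarrow> polyf (\<lambda>x. f x * g x)"

lemma polyf_compose_linear:
  assumes "polyf f" "bounded_linear g"
  shows "polyf (\<lambda>x. f (g x))"
  using assms
  by induction (auto intro: polyf.intros bounded_linear_compose)

lemma polyf_uminus: "polyf f \<Longrightarrow> polyf (\<lambda>x. - f x)"
  using polyf_mult[OF polyf_const[of "- 1"], of f] by simp

lemma polyf_diff: "polyf f \<Longrightarrow> polyf g \<Longrightarrow> polyf (\<lambda>x. f x - g x)"
  using polyf_add[OF _ polyf_uminus, of f g] by simp

lemma polyf_power: "polyf f \<Longrightarrow> polyf (\<lambda>x. f x ^ n)"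
  by (induction n) (auto intro: polyf.intros)

lemma polyf_divide: "polyf f \<Longrightarrow> polyf (\<lambda>x. f x / c)"
  using polyf_mult[OF _ polyf_const[of "inverse c"], of f] by (simp add: field_simps)

lemma polyf_continuous: "polyf f \<Longrightarrow> continuous_on UNIV f"
  by (induction rule: polyf.induct)
    (auto intro!: continuous_intros intro: linear_continuous_on)

text \<open>Besides the value and the derivative, the Lipschitz and the Taylor remainder estimates are
  carried through the induction so that no compactness argument is needed.\<close>

definition quadratic_approx ::
  "('a::real_normed_vector \<Rightarrow> 'b::real_normed_vector) \<Rightarrow> ('a \<Rightarrow> 'a \<Rightarrow> 'b) \<Rightarrow> bool" where
  "quadratic_approx f f' \<longleftrightarrow> (\<forall>M. \<exists>L\<ge>0. \<forall>x y. norm x \<le> M \<longrightarrow> norm y \<le> M \<longrightarrow>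
     norm (f x) \<le> L \<and> norm (f y - f x) \<le> L * norm (y - x) \<and>
     (\<forall>h. norm (f' x h) \<le> L * norm h) \<and>
     norm (f y - f x - f' x (y - x)) \<le> L * (norm (y - x))\<^sup>2)"

lemma quadratic_approxE:
  assumes "quadratic_approx f f'"
  obtains L where "0 \<le> L"
    and "\<And>x. norm x \<le> M \<Longrightarrow> norm (f x) \<le> L"
    and "\<And>x y. norm x \<le> M \<Longrightarrow> norm y \<le> M \<Longrightarrow> norm (f y - f x) \<le> L * norm (y - x)"
    and "\<And>x h. norm x \<le> M \<Longrightarrow> norm (f' x h) \<le> L * norm h"
    and "\<And>x y. norm x \<le> M \<Longrightarrow> norm y \<le> M \<Longrightarrow>
      norm (f y - f x - f' x (y - x)) \<le> L * (norm (y - x))\<^sup>2"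
  using assms unfolding quadratic_approx_def by metis

lemma quadratic_approx_add:
  fixes f g :: "'a::real_normed_vector \<Rightarrow> 'b::real_normed_vector"
  assumes "quadratic_approx f f'" "quadratic_approx g g'"
  shows "quadratic_approx (\<lambda>x. f x + g x) (\<lambda>x h. f' x h + g' x h)"
  unfolding quadratic_approx_def
proof
  fix M
  obtain A where A: "0 \<le> A"
    "\<And>x. norm x \<le> M \<Longrightarrow> norm (f x) \<le> A"
    "\<And>x y. norm x \<le> M \<Longrightarrow> norm y \<le> M \<Longrightarrow> norm (f y - f x) \<le> A * norm (y - x)"
    "\<And>x h. norm x \<le> M \<Longrightarrow> norm (f' x h) \<le> A * norm h"
    "\<And>x y. norm x \<le> M \<Longrightarrow> norm y \<le> M \<Longrightarrow> norm (f y - f x - f' x (y - x)) \<le> A * (norm (y - x))\<^sup>2"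
    by (rule quadratic_approxE[OF assms(1), of M]) blast
  obtain B where B: "0 \<le> B"
    "\<And>x. norm x \<le> M \<Longrightarrow> norm (g x) \<le> B"
    "\<And>x y. norm x \<le> M \<Longrightarrow> norm y \<le> M \<Longrightarrow> norm (g y - g x) \<le> B * norm (y - x)"
    "\<And>x h. norm x \<le> M \<Longrightarrow> norm (g' x h) \<le> B * norm h"
    "\<And>x y. norm x \<le> M \<Longrightarrow> norm y \<le> M \<Longrightarrow> norm (g y - g x - g' x (y - x)) \<le> B * (norm (y - x))\<^sup>2"
    by (rule quadratic_approxE[OF assms(2), of M]) blast
  show "\<exists>L\<ge>0. \<forall>x y. norm x \<le> M \<longrightarrow> norm y \<le> M \<longrightarrow>
     norm (f x + g x) \<le> L \<and> norm (f y + g y - (f x + g x)) \<le> L * norm (y - x) \<and>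
     (\<forall>h. norm (f' x h + g' x h) \<le> L * norm h) \<and>
     norm (f y + g y - (f x + g x) - (f' x (y - x) + g' x (y - x))) \<le> L * (norm (y - x))\<^sup>2"
  proof (intro exI[of _ "A + B"] conjI allI impI)
    fix x y h :: 'a assume x: "norm x \<le> M" and y: "norm y \<le> M"
    show "norm (f x + g x) \<le> A + B"
      using A(2)[OF x] B(2)[OF x] by norm
    have "f y + g y - (f x + g x) = (f y - f x) + (g y - g x)" by simp
    also have "norm \<dots> \<le> A * norm (y - x) + B * norm (y - x)"
      by (intro norm_triangle_mono A B x y)
    finally show "norm (f y + g y - (f x + g x)) \<le> (A + B) * norm (y - x)"
      by (simp add: distrib_right)
    show "norm (f' x h + g' x h) \<le> (A + B) * norm h"
      unfolding distrib_right by (intro norm_triangle_mono A B x)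
    have "f y + g y - (f x + g x) - (f' x (y - x) + g' x (y - x))
        = (f y - f x - f' x (y - x)) + (g y - g x - g' x (y - x))" by simp
    also have "norm \<dots> \<le> A * (norm (y - x))\<^sup>2 + B * (norm (y - x))\<^sup>2"
      by (intro norm_triangle_mono A B x y)
    finally show "norm (f y + g y - (f x + g x) - (f' x (y - x) + g' x (y - x)))
        \<le> (A + B) * (norm (y - x))\<^sup>2"
      by (simp add: distrib_right)
  qed (use A(1) B(1) in simp)
qed

lemma quadratic_approx_mult:
  fixes f g :: "'a::real_normed_vector \<Rightarrow> real"
  assumes "quadratic_approx f f'" "quadratic_approx g g'"
  shows "quadratic_approx (\<lambda>x. f x * g x) (\<lambda>x h. f' x h * g x + f x * g' x h)"
  unfolding quadratic_approx_def
proof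
  fix M
  obtain A where A: "0 \<le> A"
    "\<And>x. norm x \<le> M \<Longrightarrow> norm (f x) \<le> A"
    "\<And>x y. norm x \<le> M \<Longrightarrow> norm y \<le> M \<Longrightarrow> norm (f y - f x) \<le> A * norm (y - x)"
    "\<And>x h. norm x \<le> M \<Longrightarrow> norm (f' x h) \<le> A * norm h"
    "\<And>x y. norm x \<le> M \<Longrightarrow> norm y \<le> M \<Longrightarrow> norm (f y - f x - f' x (y - x)) \<le> A * (norm (y - x))\<^sup>2"
    by (rule quadratic_approxE[OF assms(1), of M]) blast
  obtain B where B: "0 \<le> B"
    "\<And>x. norm x \<le> M \<Longrightarrow> norm (g x) \<le> B"
    "\<And>x y. norm x \<le> M \<Longrightarrow> norm y \<le> M \<Longrightarrow> norm (g y - g x) \<le> B * norm (y - x)"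
    "\<And>x h. norm x \<le> M \<Longrightarrow> norm (g' x h) \<le> B * norm h"
    "\<And>x y. norm x \<le> M \<Longrightarrow> norm y \<le> M \<Longrightarrow> norm (g y - g x - g' x (y - x)) \<le> B * (norm (y - x))\<^sup>2"
    by (rule quadratic_approxE[OF assms(2), of M]) blast
  have prod: "norm (a * b) \<le> c * d" if "norm a \<le> c" "norm b \<le> d" for a b c d :: real
    using mult_mono'[OF that] by (simp add: abs_mult)
  show "\<exists>L\<ge>0. \<forall>x y. norm x \<le> M \<longrightarrow> norm y \<le> M \<longrightarrow>
     norm (f x * g x) \<le> L \<and> norm (f y * g y - f x * g x) \<le> L * norm (y - x) \<and>
     (\<forall>h. norm (f' x h * g x + f x * g' x h) \<le> L * norm h) \<and>
     norm (f y * g y - f x * g x - (f' x (y - x) * g x + f x * g' x (y - x)))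
       \<le> L * (norm (y - x))\<^sup>2"
  proof (intro exI[of _ "3 * (A * B)"] conjI allI impI)
    fix x y h :: 'a assume x: "norm x \<le> M" and y: "norm y \<le> M"
    have AB: "0 \<le> A * B" using A(1) B(1) by simp
    have "norm (f x * g x) \<le> A * B" by (intro prod A B x)
    then show "norm (f x * g x) \<le> 3 * (A * B)" using AB by linarith
    have "f y * g y - f x * g x = (f y - f x) * g y + f x * (g y - g x)"
      by (simp add: algebra_simps)
    also have "norm \<dots> \<le> A * norm (y - x) * B + A * (B * norm (y - x))"
      by (intro norm_triangle_mono prod A B x y)
    also have "\<dots> \<le> 3 * (A * B) * norm (y - x)"
      using mult_nonneg_nonneg[OF AB norm_ge_zero[of "y - x"]] by (simp add: algebra_simps)
    finally show "norm (f y * g y - f x * g x) \<le> 3 * (A * B) * norm (y - x)" .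
    have "norm (f' x h * g x + f x * g' x h) \<le> A * norm h * B + A * (B * norm h)"
      by (intro norm_triangle_mono prod A B x y)
    also have "\<dots> \<le> 3 * (A * B) * norm h"
      using mult_nonneg_nonneg[OF AB norm_ge_zero[of h]] by (simp add: algebra_simps)
    finally show "norm (f' x h * g x + f x * g' x h) \<le> 3 * (A * B) * norm h" .
    \<comment> \<open>The remainder of a product contains the product of the two increments, so the
      Lipschitz estimates of the factors enter. The three summands account for the constant
      \<open>3 * (A * B)\<close>.\<close>
    have "f y * g y - f x * g x - (f' x (y - x) * g x + f x * g' x (y - x))
        = (f y - f x - f' x (y - x)) * g x + f x * (g y - g x - g' x (y - x))
          + (f y - f x) * (g y - g x)"
      by (simp add: algebra_simps)
    also have "norm \<dots> \<le> A * (norm (y - x))\<^sup>2 * B + A * (B * (norm (y - x))\<^sup>2)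
          + A * norm (y - x) * (B * norm (y - x))"
      by (intro norm_triangle_mono prod A B x y)
    also have "\<dots> = 3 * (A * B) * (norm (y - x))\<^sup>2"
      by (simp add: power2_eq_square)
    finally show "norm (f y * g y - f x * g x - (f' x (y - x) * g x + f x * g' x (y - x)))
       \<le> 3 * (A * B) * (norm (y - x))\<^sup>2" .
  qed (use A(1) B(1) in simp)
qed

lemma quadratic_approx_linear:
  fixes f :: "'a::real_normed_vector \<Rightarrow> 'b::real_normed_vector"
  assumes "bounded_linear f"
  shows "quadratic_approx f (\<lambda>x. f)"
  unfolding quadratic_approx_def
proof
  interpret bounded_linear f by fact
  obtain K where K: "0 < K" "\<And>x. norm (f x) \<le> norm x * K" using pos_bounded by blast
  fix M
  show "\<exists>L\<ge>0. \<forall>x y. norm x \<le> M \<longrightarrow> norm y \<le> M \<longrightarrow>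
     norm (f x) \<le> L \<and> norm (f y - f x) \<le> L * norm (y - x) \<and>
     (\<forall>h. norm (f h) \<le> L * norm h) \<and>
     norm (f y - f x - f (y - x)) \<le> L * (norm (y - x))\<^sup>2"
  \<comment> \<open>A single constant has to bound the values on the ball, at most
    \<open>K * M\<close>, and the operator norm, at most \<open>K\<close>.\<close>
  proof (intro exI[of _ "K * (1 + \<bar>M\<bar>)"] conjI allI impI)
    fix x y h :: 'a assume x: "norm x \<le> M"
    have le: "norm (f h) \<le> K * (1 + \<bar>M\<bar>) * norm h" for h
    proof -
      have "norm (f h) \<le> K * 1 * norm h" using K(2)[of h] by (simp add: mult.commute)
      also have "\<dots> \<le> K * (1 + \<bar>M\<bar>) * norm h"
        using K(1) by (intro mult_right_mono mult_left_mono) auto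
      finally show ?thesis .
    qed
    then show "norm (f h) \<le> K * (1 + \<bar>M\<bar>) * norm h" .
    show "norm (f y - f x) \<le> K * (1 + \<bar>M\<bar>) * norm (y - x)"
      using le[of "y - x"] by (simp add: diff)
    have "norm (f x) \<le> K * norm x" using K(2)[of x] by (simp add: mult.commute)
    also have "\<dots> \<le> K * (1 + \<bar>M\<bar>)" using K(1) x by (intro mult_left_mono) auto
    finally show "norm (f x) \<le> K * (1 + \<bar>M\<bar>)" .
  qed (use K(1) in \<open>auto simp: diff\<close>)
qed

text \<open>By the sum and product rules the derivative is polynomial jointly in point and
  direction. Differentiation thus stays inside the class and can be repeated.\<close>

lemma polyf_tangent:
  assumes "polyf f"
  shows "\<exists>f'. (\<forall>x. bounded_linear (f' x)) \<and> polyf (\<lambda>p. f' (fst p) (snd p)) \<and> quadratic_approx f f'"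
  using assms
proof induction
  case (polyf_linear f)
  then show ?case
    by (intro exI[of _ "\<lambda>x. f"] conjI allI quadratic_approx_linear polyf.polyf_linear
        bounded_linear_compose[OF _ bounded_linear_snd]) auto
next
  case (polyf_const c)
  have "quadratic_approx (\<lambda>x. c) (\<lambda>x h. 0)"
    unfolding quadratic_approx_def by (intro allI exI[of _ "\<bar>c\<bar>"]) simp
  then show ?case by (intro exI[of _ "\<lambda>x h. 0"]) (auto intro: polyf.intros)
next
  case (polyf_add f g)
  then obtain f' g' where "(\<forall>x. bounded_linear (f' x)) \<and> polyf (\<lambda>p. f' (fst p) (snd p)) \<and> quadratic_approx f f'"
    "(\<forall>x. bounded_linear (g' x)) \<and> polyf (\<lambda>p. g' (fst p) (snd p)) \<and> quadratic_approx g g'" by blast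
  then show ?case
    by (intro exI[of _ "\<lambda>x h. f' x h + g' x h"])
      (auto intro: polyf.intros quadratic_approx_add bounded_linear_add)
next
  case (polyf_mult f g)
  then obtain f' g' where *: "(\<forall>x. bounded_linear (f' x)) \<and> polyf (\<lambda>p. f' (fst p) (snd p)) \<and> quadratic_approx f f'"
    "(\<forall>x. bounded_linear (g' x)) \<and> polyf (\<lambda>p. g' (fst p) (snd p)) \<and> quadratic_approx g g'" by blast
  have "polyf (\<lambda>p. f (fst p) :: real)" "polyf (\<lambda>p. g (fst p) :: real)"
    using polyf_mult.hyps by (auto intro: polyf_compose_linear bounded_linear_fst)
  with * show ?case
    by (intro exI[of _ "\<lambda>x h. f' x h * g x + f x * g' x h"])
      (auto intro!: polyf.polyf_add polyf.polyf_mult quadratic_approx_mult bounded_linear_add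
         bounded_linear_mult_const bounded_linear_const_mult)
qed

section \<open>Polynomial vector fields and their variational equations\<close>

definition vpoly :: "('a::real_normed_vector \<Rightarrow> 'b::euclidean_space) \<Rightarrow> bool" where
  "vpoly G \<longleftrightarrow> (\<forall>b\<in>Basis. polyf (\<lambda>x. G x \<bullet> b))"

lemma vpoly_real: "polyf f \<Longrightarrow> vpoly f"
  by (simp add: vpoly_def)

lemma vpoly_Pair: "vpoly f \<Longrightarrow> vpoly g \<Longrightarrow> vpoly (\<lambda>x. (f x, g x))"
  by (auto simp: vpoly_def Basis_prod_def)

lemma vpoly_continuous: "vpoly G \<Longrightarrow> continuous_on UNIV G"
  by (rule continuous_on_componentwise[THEN iffD2]) (auto simp: vpoly_def polyf_continuous)

lemma quadratic_approx_has_derivative: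
  assumes "quadratic_approx f f'" "bounded_linear (f' x)"
  shows "(f has_derivative f' x) (at x)"
  unfolding has_derivative_within_alt2
proof (intro conjI allI impI assms)
  fix \<epsilon> :: real assume eps: "\<epsilon> > 0"
  obtain L where L: "0 \<le> L" "\<And>y. norm y \<le> norm x + 1 \<Longrightarrow>
      norm (f y - f x - f' x (y - x)) \<le> L * (norm (y - x))\<^sup>2"
    by (rule quadratic_approxE[OF assms(1), of "norm x + 1"]) auto
  have "eventually (\<lambda>y. dist y x < min 1 (\<epsilon> / (L + 1))) (at x)"
    unfolding eventually_at using eps L(1)
    by (intro exI[of _ "min 1 (\<epsilon> / (L + 1))"]) auto
  then show "eventually (\<lambda>y. norm (f y - f x - f' x (y - x)) \<le> \<epsilon> * norm (y - x)) (at x)"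
  proof eventually_elim
    case (elim y)
    then have y: "norm (y - x) \<le> 1" "norm (y - x) \<le> \<epsilon> / (L + 1)" by (auto simp: dist_norm)
    then have "norm y \<le> norm x + 1" using norm_triangle_sub[of y x] by linarith
    then have "norm (f y - f x - f' x (y - x)) \<le> L * norm (y - x) * norm (y - x)"
      using L(2)[of y] by (simp add: power2_eq_square mult.assoc)
    also have "L * norm (y - x) \<le> (L + 1) * norm (y - x)"
      by (intro mult_right_mono) auto
    also have "\<dots> \<le> \<epsilon>" using y(2) L(1) by (simp add: pos_le_divide_eq mult.commute)
    finally show ?case by (simp add: mult_right_mono)
  qed
qed

text \<open>Solutions of this field are pairs of a solution of \<open>G\<close> and a solution of
  the variational equation along it. It is again a field on one space, so the construction can be
  iterated.\<close>

definition tangent :: "('a::real_normed_vector \<Rightarrow> 'a) \<Rightarrow> 'a \<times> 'a \<Rightarrow> 'a \<times> 'a" where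
  "tangent G p = (G (fst p), frechet_derivative G (at (fst p)) (snd p))"

text \<open>The derivatives of the components are reassembled over the basis. Uniqueness of Frechet
  derivatives identifies the result with \<open>frechet_derivative\<close>, so no chosen derivative
  has to be carried along.\<close>

lemma vpoly_tangent:
  fixes G :: "'a::euclidean_space \<Rightarrow> 'a"
  assumes "vpoly G"
  shows "vpoly (tangent G)"
    and "quadratic_approx G (\<lambda>x. frechet_derivative G (at x))"
    and "bounded_linear (frechet_derivative G (at x))"
proof -
  have "\<forall>b\<in>Basis. \<exists>f'. (\<forall>x. bounded_linear (f' x)) \<and> polyf (\<lambda>p. f' (fst p) (snd p))
      \<and> quadratic_approx (\<lambda>x. G x \<bullet> b) f'"
    using assms polyf_tangent unfolding vpoly_def by blast
  then obtain f' where f': "\<And>b x. b \<in> Basis \<Longrightarrow> bounded_linear (f' b x)"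
    "\<And>b. b \<in> Basis \<Longrightarrow> polyf (\<lambda>p. f' b (fst p) (snd p))"
    "\<And>b. b \<in> Basis \<Longrightarrow> quadratic_approx (\<lambda>x. G x \<bullet> b) (f' b)"
    by metis
  define G' where "G' x h = (\<Sum>b\<in>Basis. f' b x h *\<^sub>R b)" for x h
  have comp: "G' x h \<bullet> b = f' b x h" if "b \<in> Basis" for x h b
    using that by (simp add: G'_def inner_sum_left inner_Basis if_distrib sum.delta cong: if_cong)
  have lin: "bounded_linear (G' x)" for x
    unfolding G'_def[abs_def] using f'(1)
    by (intro bounded_linear_sum bounded_linear_scaleR_const) auto
  have approx: "quadratic_approx G G'"
    unfolding quadratic_approx_def
  proof
    fix M
    have "\<forall>b\<in>Basis. \<exists>L\<ge>0. \<forall>x y. norm x \<le> M \<longrightarrow> norm y \<le> M \<longrightarrow>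
     norm (G x \<bullet> b) \<le> L \<and> norm (G y \<bullet> b - G x \<bullet> b) \<le> L * norm (y - x) \<and>
     (\<forall>h. norm (f' b x h) \<le> L * norm h) \<and>
     norm (G y \<bullet> b - G x \<bullet> b - f' b x (y - x)) \<le> L * (norm (y - x))\<^sup>2"
      using f'(3) unfolding quadratic_approx_def by blast
    then obtain L where L: "\<And>b. b \<in> Basis \<Longrightarrow> L b \<ge> 0"
      "\<And>b x y. b \<in> Basis \<Longrightarrow> norm x \<le> M \<Longrightarrow> norm y \<le> M \<Longrightarrow>
     norm (G x \<bullet> b) \<le> L b \<and> norm (G y \<bullet> b - G x \<bullet> b) \<le> L b * norm (y - x) \<and>
     (\<forall>h. norm (f' b x h) \<le> L b * norm h) \<and>
     norm (G y \<bullet> b - G x \<bullet> b - f' b x (y - x)) \<le> L b * (norm (y - x))\<^sup>2"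
      by metis
    have sum: "norm v \<le> (\<Sum>b\<in>Basis. L b) * k" if "\<And>b. b \<in> Basis \<Longrightarrow> norm (v \<bullet> b) \<le> L b * k"
      for v :: 'a and k
      using order_trans[OF norm_le_l1 sum_mono[of Basis "\<lambda>b. \<bar>v \<bullet> b\<bar>" "\<lambda>b. L b * k"]] that
      by (simp add: sum_distrib_right)
    show "\<exists>L\<ge>0. \<forall>x y. norm x \<le> M \<longrightarrow> norm y \<le> M \<longrightarrow>
     norm (G x) \<le> L \<and> norm (G y - G x) \<le> L * norm (y - x) \<and>
     (\<forall>h. norm (G' x h) \<le> L * norm h) \<and>
     norm (G y - G x - G' x (y - x)) \<le> L * (norm (y - x))\<^sup>2"
    proof (intro exI[of _ "\<Sum>b\<in>Basis. L b"] conjI allI impI)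
      fix x y h :: 'a assume xy: "norm x \<le> M" "norm y \<le> M"
      show "norm (G x) \<le> (\<Sum>b\<in>Basis. L b)"
        using sum[of "G x" 1] L(2)[OF _ xy] by simp
      show "norm (G y - G x) \<le> (\<Sum>b\<in>Basis. L b) * norm (y - x)"
        using sum[of "G y - G x"] L(2)[OF _ xy] by (simp add: inner_diff_left)
      show "norm (G' x h) \<le> (\<Sum>b\<in>Basis. L b) * norm h"
        using sum[of "G' x h"] L(2)[OF _ xy] by (simp add: comp)
      show "norm (G y - G x - G' x (y - x)) \<le> (\<Sum>b\<in>Basis. L b) * (norm (y - x))\<^sup>2"
        using sum[of "G y - G x - G' x (y - x)"] L(2)[OF _ xy] by (simp add: inner_diff_left comp)
    qed (use L(1) in \<open>auto intro: sum_nonneg\<close>)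
  qed
  have eq: "frechet_derivative G (at x) = G' x" for x
    using frechet_derivative_at[OF quadratic_approx_has_derivative[OF approx lin]] by simp
  show "quadratic_approx G (\<lambda>x. frechet_derivative G (at x))"
    using approx by (simp add: eq)
  show "bounded_linear (frechet_derivative G (at x))"
    using lin by (simp add: eq)
  have "vpoly (\<lambda>p. G (fst p))"
    using assms polyf_compose_linear[OF _ bounded_linear_fst] by (auto simp: vpoly_def)
  moreover have "vpoly (\<lambda>p. G' (fst p) (snd p))"
    using f'(2) by (simp add: vpoly_def comp)
  ultimately show "vpoly (tangent G)"
    unfolding tangent_def[abs_def] eq by (rule vpoly_Pair)
qed

text \<open>The common bound confines all solutions to one ball, on which the constants of
  \<open>quadratic_approx\<close> hold for all parameters at once.\<close>

definition flow_family ::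
  "('a::real_normed_vector \<Rightarrow> 'a) \<Rightarrow> real \<Rightarrow> real set \<Rightarrow> (real \<Rightarrow> real \<Rightarrow> 'a) \<Rightarrow> bool" where
  "flow_family G T J X \<longleftrightarrow>
     (\<forall>e\<in>J. \<forall>t\<in>{0..T}. ((\<lambda>t. X t e) has_vector_derivative G (X t e)) (at t within {0..T})) \<and>
     (\<exists>M. \<forall>e\<in>J. \<forall>t\<in>{0..T}. norm (X t e) \<le> M)"

lemma variational_solution_exists:
  fixes G :: "'a::euclidean_space \<Rightarrow> 'a"
  assumes G: "vpoly G" and x: "continuous_on {0..T} x" and T: "0 \<le> T"
  shows "\<exists>y. y 0 = y0 \<and> (\<forall>t\<in>{0..T}.
    (y has_vector_derivative frechet_derivative G (at (x t)) (y t)) (at t within {0..T}))"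
proof -
  define G' where "G' x = frechet_derivative G (at x)" for x
  \<comment> \<open>Freezing the path outside \<open>{0..T}\<close> gives a linear equation on the
    whole line with uniformly bounded coefficients, so that global existence applies.\<close>
  define \<tau> where "\<tau> t = max 0 (min T t)" for t
  have \<tau>: "\<tau> t \<in> {0..T}" for t using T by (auto simp: \<tau>_def)
  have lin: "bounded_linear (G' x)" for x using vpoly_tangent(3)[OF G] by (simp add: G'_def)
  have xc: "continuous_on UNIV (\<lambda>t. x (\<tau> t))"
    by (rule continuous_on_compose2[OF x]) (auto simp: \<tau>_def intro!: continuous_intros T)
  have "bounded (x ` {0..T})"
    using x by (intro compact_imp_bounded compact_continuous_image) auto
  then obtain M where "\<forall>v\<in>x ` {0..T}. norm v \<le> M"
    unfolding bounded_iff by blast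
  then have M: "norm (x t) \<le> M" if "t \<in> {0..T}" for t using that by blast
  obtain L where L: "0 \<le> L" "\<And>x h. norm x \<le> M \<Longrightarrow> norm (G' x h) \<le> L * norm h"
    by (rule quadratic_approxE[OF vpoly_tangent(2)[OF G], of M]) (auto simp: G'_def)
  have "continuous_on UNIV (\<lambda>p. snd (tangent G p))"
    by (intro continuous_on_snd vpoly_continuous vpoly_tangent(1) G)
  then have G'c: "continuous_on UNIV (\<lambda>p. G' (fst p) (snd p))"
    by (simp add: tangent_def G'_def)
  have "\<exists>y. y 0 = y0 \<and> (\<forall>t. (y has_vector_derivative G' (x (\<tau> t)) (y t)) (at t))"
  proof (rule lipschitz_ode_exists[where C = 0 and L = L])
    have "continuous_on UNIV (\<lambda>p. (\<lambda>p. G' (fst p) (snd p)) (x (\<tau> (fst p)), snd p))"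
      by (rule continuous_on_compose2[OF G'c])
        (auto intro!: continuous_intros continuous_on_compose2[OF xc])
    then show "continuous_on UNIV (\<lambda>(t, h). G' (x (\<tau> t)) h)"
      by (simp add: case_prod_unfold)
    show "norm (G' (x (\<tau> t)) h - G' (x (\<tau> t)) k) \<le> L * norm (h - k)" for t h k
      using L(2)[OF M[OF \<tau>[of t]], of "h - k"] by (simp add: linear_diff bounded_linear.linear[OF lin])
    show "norm (G' (x (\<tau> t)) 0) \<le> 0" for t
      using lin by (simp add: linear_0 bounded_linear.linear)
  qed fact
  then obtain y where y: "y 0 = y0" "\<And>t. (y has_vector_derivative G' (x (\<tau> t)) (y t)) (at t)"
    by blast
  have "\<tau> t = t" if "t \<in> {0..T}" for t using that by (auto simp: \<tau>_def)
  with y show ?thesis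
    unfolding G'_def by (metis has_vector_derivative_at_within)
qed

text \<open>The error of the linear prediction for a nearby parameter obeys the variational equation
  up to a forcing quadratic in the parameter increment. Gronwall's inequality then carries
  differentiability from the initial values to every time \<open>t\<close>.\<close>

lemma flow_family_tangent:
  fixes G :: "'a::euclidean_space \<Rightarrow> 'a" and X :: "real \<Rightarrow> real \<Rightarrow> 'a"
  assumes G: "vpoly G" and X: "flow_family G T J X" and J: "convex J" and T: "0 \<le> T"
    and Y0: "\<And>e. e \<in> J \<Longrightarrow> (X 0 has_vector_derivative Y0 e) (at e within J)"
    and M0: "\<And>e. e \<in> J \<Longrightarrow> norm (Y0 e) \<le> M0"
  shows "\<exists>Y. flow_family (tangent G) T J (\<lambda>t e. (X t e, Y t e)) \<and> (\<forall>e\<in>J. Y 0 e = Y0 e) \<and>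
    (\<forall>e\<in>J. \<forall>t\<in>{0..T}. (X t has_vector_derivative Y t e) (at e within J))"
proof -
  define G' where "G' x = frechet_derivative G (at x)" for x
  have lin: "linear (G' x)" for x
    using vpoly_tangent(3)[OF G] by (simp add: G'_def bounded_linear.linear)
  have dX: "((\<lambda>t. X t e) has_vector_derivative G (X t e)) (at t within {0..T})"
    if "e \<in> J" "t \<in> {0..T}" for e t
    using X that by (simp add: flow_family_def)
  obtain M where M: "norm (X t e) \<le> M" if "e \<in> J" "t \<in> {0..T}" for e t
    using X unfolding flow_family_def by blast
  have "\<exists>y. y 0 = Y0 e \<and> (\<forall>t\<in>{0..T}. (y has_vector_derivative G' (X t e) (y t)) (at t within {0..T}))"
    if e: "e \<in> J" for e
  proof -
    have "continuous_on {0..T} (\<lambda>t. X t e)"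
      using dX[OF e] by (meson continuous_on_vector_derivative)
    then show ?thesis
      unfolding G'_def by (rule variational_solution_exists[OF G _ T])
  qed
  then obtain y where y: "\<And>e. e \<in> J \<Longrightarrow> y e 0 = Y0 e"
    "\<And>e t. e \<in> J \<Longrightarrow> t \<in> {0..T} \<Longrightarrow>
      (y e has_vector_derivative G' (X t e) (y e t)) (at t within {0..T})" by metis
  define Y where "Y t e = y e t" for t e
  obtain L where L: "0 \<le> L"
    "\<And>x y. norm x \<le> M \<Longrightarrow> norm y \<le> M \<Longrightarrow> norm (G y - G x) \<le> L * norm (y - x)"
    "\<And>x h. norm x \<le> M \<Longrightarrow> norm (G' x h) \<le> L * norm h"
    "\<And>x y. norm x \<le> M \<Longrightarrow> norm y \<le> M \<Longrightarrow> norm (G y - G x - G' x (y - x)) \<le> L * (norm (y - x))\<^sup>2"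
    by (rule quadratic_approxE[OF vpoly_tangent(2)[OF G], of M]) (simp add: G'_def)
  define C where "C = exp ((L + 1) * T)"
  have C: "C > 0" by (simp add: C_def)
  have Y_bound: "norm (Y t e) \<le> M0 * C" if e: "e \<in> J" and t: "t \<in> {0..T}" for e t
  proof -
    have "norm (y e t) \<le> norm (y e 0) * C"
      unfolding C_def using L(3)[OF M[OF e]] by (intro gronwall_linear[OF y(2)[OF e] _ L(1) t]) auto
    also have "\<dots> \<le> M0 * C" using M0[OF e] C by (simp add: y(1)[OF e])
    finally show ?thesis by (simp add: Y_def)
  qed
  have flow: "flow_family (tangent G) T J (\<lambda>t e. (X t e, Y t e))"
    unfolding flow_family_def tangent_def fst_conv snd_conv
  proof (intro conjI ballI exI)
    fix e t assume "e \<in> J" "t \<in> {0..T}"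
    then show "((\<lambda>t. (X t e, Y t e)) has_vector_derivative
        (G (X t e), frechet_derivative G (at (X t e)) (Y t e))) (at t within {0..T})"
      using dX y(2) by (auto simp: Y_def G'_def intro: has_vector_derivative_Pair)
    show "norm (X t e, Y t e) \<le> M + M0 * C"
      using norm_Pair_le[of "X t e" "Y t e"] M Y_bound \<open>e \<in> J\<close> \<open>t \<in> {0..T}\<close> by fastforce
  qed
  have deriv: "(X t has_vector_derivative Y t e) (at e within J)"
    if e: "e \<in> J" and t: "t \<in> {0..T}" for e t
  proof -
    define A where "A = L * (M0 * C)\<^sup>2"
    \<comment> \<open>\<open>B\<close> amplifies squared norms, with the elapsed time included;
      hence \<open>sqrt B\<close> in the estimate.\<close>
    define B where "B = (1 + T) * C\<^sup>2"
    have M0_nonneg: "0 \<le> M0" using M0[OF e] norm_ge_zero order_trans by blast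
    have A: "0 \<le> A" using L(1) by (simp add: A_def)
    have B: "0 < B" using T C by (simp add: B_def add_pos_nonneg)
    have est: "norm (X t e' - X t e - (e' - e) *\<^sub>R Y t e) \<le>
      (norm (X 0 e' - X 0 e - (e' - e) *\<^sub>R Y 0 e) + A * (e' - e)\<^sup>2) * sqrt B" if e': "e' \<in> J" for e'
    proof -
      define h where "h = e' - e"
      define D where "D s = X s e' - X s e" for s
      define E where "E s = D s - h *\<^sub>R Y s e" for s
      have D: "norm (D s) \<le> M0 * C * \<bar>h\<bar>" if s: "s \<in> {0..T}" for s
      proof -
        \<comment> \<open>Convexity of \<open>J\<close> enters here: the mean value inequality makes
          the initial values Lipschitz in the parameter.\<close>
        have "norm (X 0 e' - X 0 e) \<le> M0 * norm (e' - e)"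
        proof (rule differentiable_bound[OF J _ _ e' e])
          fix a assume a: "a \<in> J"
          show "(X 0 has_derivative (\<lambda>h. h *\<^sub>R Y0 a)) (at a within J)"
            using Y0[OF a] by (simp add: has_vector_derivative_def)
          show "onorm (\<lambda>h. h *\<^sub>R Y0 a) \<le> M0"
            using mult_left_mono[OF M0[OF a] abs_ge_zero]
            by (intro onorm_bound) (auto simp: mult.commute M0_nonneg)
        qed
        then have D0: "norm (D 0) \<le> M0 * \<bar>h\<bar>" by (simp add: D_def h_def)
        have "norm (D s) \<le> norm (D 0) * C"
          unfolding C_def D_def using L(2)[OF M[OF e] M[OF e']]
          by (intro gronwall_linear[OF has_vector_derivative_diff[OF dX[OF e'] dX[OF e]] _ L(1) s]) auto
        also have "\<dots> \<le> M0 * \<bar>h\<bar> * C" using D0 C by simp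
        finally show ?thesis by (simp add: mult_ac)
      qed
      define E' where "E' s = G (X s e') - G (X s e) - h *\<^sub>R G' (X s e) (Y s e)" for s
      have "(norm (E t))\<^sup>2 \<le> ((norm (E 0))\<^sup>2 + (A * h\<^sup>2)\<^sup>2 * t) * exp ((2 * L + 1) * t)"
      proof (rule gronwall[OF _ _ L(1) _ t])
        fix s assume s: "s \<in> {0..T}"
        show "(E has_vector_derivative E' s) (at s within {0..T})"
          unfolding E_def D_def E'_def
          by (intro derivative_intros dX e e' s
              bounded_linear.has_vector_derivative[OF bounded_linear_scaleR_right, of "\<lambda>s. Y s e"])
            (use y(2)[OF e s] in \<open>simp add: Y_def\<close>)
        have "E' s = (G (X s e') - G (X s e) - G' (X s e) (X s e' - X s e)) + G' (X s e) (E s)"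
          by (simp add: E'_def E_def D_def linear_diff[OF lin] linear_cmul[OF lin])
        also have "norm \<dots> \<le> L * (norm (D s))\<^sup>2 + L * norm (E s)"
          unfolding D_def by (intro norm_triangle_mono L M e e' s)
        also have "L * (norm (D s))\<^sup>2 \<le> L * (M0 * C * \<bar>h\<bar>)\<^sup>2"
          using L(1) D[OF s] by (intro mult_left_mono power_mono) auto
        also have "L * (M0 * C * \<bar>h\<bar>)\<^sup>2 = A * h\<^sup>2"
          by (simp add: A_def power_mult_distrib)
        finally show "norm (E' s) \<le> L * norm (E s) + A * h\<^sup>2" by linarith
      qed (use A in auto)
      also have "\<dots> \<le> ((norm (E 0) + A * h\<^sup>2)\<^sup>2 * (1 + T)) * C\<^sup>2"
      proof (intro mult_mono)
        have "(norm (E 0))\<^sup>2 + (A * h\<^sup>2)\<^sup>2 * t \<le> (norm (E 0) + A * h\<^sup>2)\<^sup>2 * 1 + (norm (E 0) + A * h\<^sup>2)\<^sup>2 * T"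
          using A t by (intro add_mono mult_mono) (auto simp: power_mono)
        then show "(norm (E 0))\<^sup>2 + (A * h\<^sup>2)\<^sup>2 * t \<le> (norm (E 0) + A * h\<^sup>2)\<^sup>2 * (1 + T)"
          by (simp add: distrib_left)
        have "(2 * L + 1) * t \<le> (2 * L + 2) * T"
          using t L(1) by (intro mult_mono) auto
        then have "(2 * L + 1) * t \<le> 2 * ((L + 1) * T)"
          by (simp add: algebra_simps)
        then show "exp ((2 * L + 1) * t) \<le> C\<^sup>2"
          by (simp add: C_def exp_double[symmetric])
      qed (use T in auto)
      also have "\<dots> = ((norm (E 0) + A * h\<^sup>2) * sqrt B)\<^sup>2"
        using B by (simp add: power_mult_distrib B_def mult.assoc)
      finally have "norm (E t) \<le> (norm (E 0) + A * h\<^sup>2) * sqrt B"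
        by (rule power2_le_imp_le) (use A B in auto)
      then show ?thesis by (simp add: E_def D_def h_def)
    qed
    show ?thesis
      unfolding has_vector_derivative_def has_derivative_within_alt2
    proof (intro conjI allI impI bounded_linear_scaleR_left)
      fix \<epsilon> :: real assume eps: "0 < \<epsilon>"
      \<comment> \<open>Half of the tolerance is for the error of the initial values, half for the
        quadratic term.\<close>
      define \<delta> where "\<delta> = \<epsilon> / (2 * sqrt B)"
      have \<delta>: "\<delta> > 0" using eps B by (simp add: \<delta>_def)
      have "(X 0 has_vector_derivative Y 0 e) (at e within J)"
        using Y0[OF e] y(1)[OF e] by (simp add: Y_def)
      then have "eventually (\<lambda>e'. norm (X 0 e' - X 0 e - (e' - e) *\<^sub>R Y 0 e) \<le> \<delta> * norm (e' - e)) (at e within J)"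
        using \<delta> unfolding has_vector_derivative_def has_derivative_within_alt2 by blast
      moreover have "eventually (\<lambda>e'. dist e' e < \<delta> / (A + 1)) (at e within J)"
        unfolding eventually_at using \<delta> A by (intro exI[of _ "\<delta> / (A + 1)"]) auto
      moreover have "eventually (\<lambda>e'. e' \<in> J) (at e within J)"
        by (auto simp: eventually_at_filter)
      ultimately show "eventually (\<lambda>e'. norm (X t e' - X t e - (e' - e) *\<^sub>R Y t e) \<le> \<epsilon> * norm (e' - e)) (at e within J)"
      proof eventually_elim
        case (elim e')
        have "A * \<bar>e' - e\<bar> \<le> (A + 1) * \<bar>e' - e\<bar>" by (simp add: distrib_right)
        also have "\<dots> \<le> \<delta>" using elim(2) A by (simp add: dist_real_def pos_less_divide_eq mult.commute)
        finally have "A * \<bar>e' - e\<bar> * \<bar>e' - e\<bar> \<le> \<delta> * \<bar>e' - e\<bar>" by (intro mult_right_mono) auto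
        then have "A * (e' - e)\<^sup>2 \<le> \<delta> * \<bar>e' - e\<bar>" by (simp add: power2_eq_square mult.assoc)
        then have "norm (X t e' - X t e - (e' - e) *\<^sub>R Y t e) \<le> (\<delta> * \<bar>e' - e\<bar> + \<delta> * \<bar>e' - e\<bar>) * sqrt B"
          using elim(1) B by (intro order_trans[OF est[OF elim(3)]] mult_right_mono) auto
        also have "\<dots> = \<epsilon> * norm (e' - e)"
          using B by (simp add: \<delta>_def field_simps)
        finally show ?case .
      qed
    qed
  qed
  have "\<forall>e\<in>J. Y 0 e = Y0 e" using y(1) by (simp add: Y_def)
  with flow deriv show ?thesis by blast
qed

text \<open>Nothing is required for \<open>n = 0\<close>, not even continuity.\<close>

primrec cdiff :: "nat \<Rightarrow> real set \<Rightarrow> (real \<Rightarrow> 'a::real_normed_vector) \<Rightarrow> bool" where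
  "cdiff 0 J f \<longleftrightarrow> True"
| "cdiff (Suc n) J f \<longleftrightarrow>
    (\<exists>f'. (\<forall>e\<in>J. (f has_vector_derivative f' e) (at e within J)) \<and> cdiff n J f')"

lemma cdiff_Suc: "cdiff (Suc n) J f \<Longrightarrow> cdiff n J f"
proof (induction n arbitrary: f)
  case (Suc n)
  then obtain f' where "\<forall>e\<in>J. (f has_vector_derivative f' e) (at e within J)" "cdiff (Suc n) J f'"
    unfolding cdiff.simps(2)[of "Suc n"] by blast
  with Suc.IH show ?case unfolding cdiff.simps(2)[of n] by blast
qed simp

lemma cdiff_continuous: "cdiff (Suc n) J f \<Longrightarrow> continuous_on J f"
  unfolding cdiff.simps by (blast intro: continuous_on_vector_derivative)

lemma cdiff_cong:
  assumes "\<And>e. e \<in> J \<Longrightarrow> f e = g e" and "cdiff n J f"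
  shows "cdiff n J g"
proof (cases n)
  case (Suc m)
  then obtain f' where f': "\<forall>e\<in>J. (f has_vector_derivative f' e) (at e within J)" "cdiff m J f'"
    using assms(2) by auto
  have "(g has_vector_derivative f' e) (at e within J)" if "e \<in> J" for e
    using that assms(1) f'(1) by (metis has_vector_derivative_transform)
  with f'(2) show ?thesis by (auto simp: Suc)
qed simp

lemma cdiff_subset: "cdiff n J f \<Longrightarrow> I \<subseteq> J \<Longrightarrow> cdiff n I f"
proof (induction n arbitrary: f)
  case (Suc n)
  then obtain f' where "\<forall>e\<in>J. (f has_vector_derivative f' e) (at e within J)" "cdiff n J f'"
    by auto
  with Suc show ?case
    unfolding cdiff.simps by (blast intro: has_vector_derivative_within_subset)
qed simp

lemma cdiff_bounded_linear:
  "bounded_linear l \<Longrightarrow> cdiff n J f \<Longrightarrow> cdiff n J (\<lambda>e. l (f e))"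
proof (induction n arbitrary: f)
  case (Suc n)
  then obtain f' where "\<forall>e\<in>J. (f has_vector_derivative f' e) (at e within J)" "cdiff n J f'" by auto
  with Suc show ?case
    unfolding cdiff.simps
    by (intro exI[of _ "\<lambda>e. l (f' e)"] conjI ballI bounded_linear.has_vector_derivative[of l]) blast+
qed simp

lemma cdiff_const: "cdiff n J (\<lambda>e. c)"
proof (induction n arbitrary: c)
  case (Suc n) then show ?case by (auto intro!: exI[of _ "\<lambda>e. 0"])
qed simp

lemma cdiff_ident: "cdiff n J (\<lambda>e. e)"
  by (cases n) (auto intro!: exI[of _ "\<lambda>e. 1"] cdiff_const)

lemma cdiff_Pair:
  "cdiff n J f \<Longrightarrow> cdiff n J g \<Longrightarrow> cdiff n J (\<lambda>e. (f e, g e))"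
proof (induction n arbitrary: f g)
  case (Suc n)
  then obtain f' g' where "\<forall>e\<in>J. (f has_vector_derivative f' e) (at e within J)" "cdiff n J f'"
    "\<forall>e\<in>J. (g has_vector_derivative g' e) (at e within J)" "cdiff n J g'" by auto
  with Suc.IH show ?case
    by (auto intro!: exI[of _ "\<lambda>e. (f' e, g' e)"] has_vector_derivative_Pair)
qed simp

lemma cdiff_add:
  assumes "cdiff n J f" "cdiff n J g"
  shows "cdiff n J (\<lambda>e. f e + g e)"
proof -
  have "bounded_linear (\<lambda>p :: 'a \<times> 'a. fst p + snd p)"
    by (intro bounded_linear_add bounded_linear_fst bounded_linear_snd)
  from cdiff_bounded_linear[OF this cdiff_Pair[OF assms]] show ?thesis by simp
qed

lemma cdiff_mult:
  fixes f g :: "real \<Rightarrow> real"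
  shows "cdiff n J f \<Longrightarrow> cdiff n J g \<Longrightarrow> cdiff n J (\<lambda>e. f e * g e)"
proof (induction n arbitrary: f g)
  case (Suc n)
  then obtain f' g' where *: "\<forall>e\<in>J. (f has_vector_derivative f' e) (at e within J)" "cdiff n J f'"
    "\<forall>e\<in>J. (g has_vector_derivative g' e) (at e within J)" "cdiff n J g'" by auto
  moreover have "cdiff n J f" "cdiff n J g" using Suc.prems cdiff_Suc by blast+
  ultimately show ?case using Suc.IH[of f g'] Suc.IH[of f' g]
    unfolding cdiff.simps
    by (intro exI[of _ "\<lambda>e. f e * g' e + f' e * g e"] conjI ballI has_vector_derivative_mult cdiff_add)
      blast+
qed simp

text \<open>One differentiation costs one derivative of the initial values: their derivative starts
  the variation and has to be continuous, hence bounded on the compact \<open>J\<close>.\<close>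

lemma flow_family_cdiff_step:
  fixes G :: "'a::euclidean_space \<Rightarrow> 'a"
  assumes G: "vpoly G" and X: "flow_family G T J X" and J: "convex J" "compact J" and T: "0 \<le> T"
    and X0: "cdiff (Suc (Suc n)) J (X 0)"
  shows "\<exists>Y. flow_family (tangent G) T J (\<lambda>t e. (X t e, Y t e)) \<and>
    cdiff (Suc n) J (\<lambda>e. (X 0 e, Y 0 e)) \<and>
    (\<forall>e\<in>J. \<forall>t\<in>{0..T}. (X t has_vector_derivative Y t e) (at e within J))"
proof -
  obtain Y0 where Y0: "\<And>e. e \<in> J \<Longrightarrow> (X 0 has_vector_derivative Y0 e) (at e within J)"
    "cdiff (Suc n) J Y0"
    using X0 by (subst (asm) cdiff.simps(2)) blast
  have "bounded (Y0 ` J)"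
    using cdiff_continuous[OF Y0(2)] J by (intro compact_imp_bounded compact_continuous_image)
  then obtain M0 where "\<forall>v\<in>Y0 ` J. norm v \<le> M0" unfolding bounded_iff by blast
  then have M0: "\<And>e. e \<in> J \<Longrightarrow> norm (Y0 e) \<le> M0" by blast
  obtain Y where Y: "flow_family (tangent G) T J (\<lambda>t e. (X t e, Y t e))" "\<forall>e\<in>J. Y 0 e = Y0 e"
    "\<forall>e\<in>J. \<forall>t\<in>{0..T}. (X t has_vector_derivative Y t e) (at e within J)"
    using flow_family_tangent[OF G X J(1) T Y0(1) M0] by blast
  moreover have "cdiff (Suc n) J (\<lambda>e. (X 0 e, Y 0 e))"
    by (rule cdiff_cong[OF _ cdiff_Pair[OF cdiff_Suc[OF X0] Y0(2)]]) (use Y(2) in auto)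
  ultimately show ?thesis by blast
qed

lemma has_vector_derivative_snd:
  "((\<lambda>e. (f e, g e)) has_vector_derivative d) Fl \<Longrightarrow> (g has_vector_derivative snd d) Fl"
  using bounded_linear.has_vector_derivative[OF bounded_linear_snd, of "\<lambda>e. (f e, g e)" d Fl] by simp

text \<open>The three prolongations are written out because each one doubles the state type, so an
  induction on the order would change types. The fourth derivative of the initial values pays for
  the bound in the last prolongation.\<close>

theorem flow_family_cdiff3:
  fixes G :: "'a::euclidean_space \<Rightarrow> 'a"
  assumes G: "vpoly G" and X: "flow_family G T J X" and J: "convex J" "compact J"
    and X0: "cdiff 4 J (X 0)" and t: "t \<in> {0..T}"
  shows "cdiff 3 J (X t)"
proof -
  have T: "0 \<le> T" using t by simp
  obtain Y where Y: "flow_family (tangent G) T J (\<lambda>t e. (X t e, Y t e))"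
    "cdiff (Suc (Suc (Suc 0))) J (\<lambda>e. (X 0 e, Y 0 e))"
    "\<forall>e\<in>J. \<forall>t\<in>{0..T}. (X t has_vector_derivative Y t e) (at e within J)"
    using flow_family_cdiff_step[OF G X J T, of "Suc (Suc 0)"] X0 by (auto simp: numeral_eq_Suc)
  obtain Z where Z: "flow_family (tangent (tangent G)) T J (\<lambda>t e. ((X t e, Y t e), Z t e))"
    "cdiff (Suc (Suc 0)) J (\<lambda>e. ((X 0 e, Y 0 e), Z 0 e))"
    "\<forall>e\<in>J. \<forall>t\<in>{0..T}. ((\<lambda>e. (X t e, Y t e)) has_vector_derivative Z t e) (at e within J)"
    using flow_family_cdiff_step[OF vpoly_tangent(1)[OF G] Y(1) J T Y(2)] by blast
  obtain W where W:
    "\<forall>e\<in>J. \<forall>t\<in>{0..T}. ((\<lambda>e. ((X t e, Y t e), Z t e)) has_vector_derivative W t e) (at e within J)"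
    using flow_family_cdiff_step[OF vpoly_tangent(1)[OF vpoly_tangent(1)[OF G]] Z(1) J T Z(2)] by blast
  have "\<forall>e\<in>J. (Y t has_vector_derivative snd (Z t e)) (at e within J)"
    using Z(3) t by (blast intro: has_vector_derivative_snd)
  moreover have "\<forall>e\<in>J. ((\<lambda>e. snd (Z t e)) has_vector_derivative snd (snd (W t e))) (at e within J)"
  proof
    fix e assume "e \<in> J"
    then have "(Z t has_vector_derivative snd (W t e)) (at e within J)"
      using W t by (intro has_vector_derivative_snd[of "\<lambda>e. (X t e, Y t e)" "Z t"]) blast
    then show "((\<lambda>e. snd (Z t e)) has_vector_derivative snd (snd (W t e))) (at e within J)"
      by (rule bounded_linear.has_vector_derivative[OF bounded_linear_snd])
  qed
  moreover have "\<forall>e\<in>J. (X t has_vector_derivative Y t e) (at e within J)"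
    using Y(3) t by blast
  ultimately have "cdiff (Suc (Suc (Suc 0))) J (X t)"
    unfolding cdiff.simps
    by (intro exI[of _ "Y t"] exI[of _ "\<lambda>e. snd (Z t e)"] exI[of _ "\<lambda>e. snd (snd (W t e))"] conjI)
      simp_all
  then show ?thesis by (simp only: numeral_3_eq_3)
qed

section \<open>Second order initial value problems\<close>

text \<open>Under this condition initial value problems are uniquely solvable on the whole line,
  which gives the definite description \<open>ivp2\<close> its meaning.\<close>

definition lipschitz_rhs :: "(real \<Rightarrow> real \<Rightarrow> real) \<Rightarrow> bool" where
  "lipschitz_rhs g \<longleftrightarrow> continuous_on UNIV (\<lambda>p. g (fst p) (snd p)) \<and>
     (\<exists>L\<ge>0. \<forall>t x y. \<bar>g t x - g t y\<bar> \<le> L * \<bar>x - y\<bar>) \<and> (\<exists>C. \<forall>t. \<bar>g t 0\<bar> \<le> C)"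

lemma ode_unique:
  fixes x y :: "real \<Rightarrow> 'a::real_inner"
  assumes x: "\<And>t. (x has_vector_derivative G t (x t)) (at t)"
    and y: "\<And>t. (y has_vector_derivative G t (y t)) (at t)"
    and lip: "\<And>t a b. norm (G t a - G t b) \<le> L * norm (a - b)" and L: "0 \<le> L"
    and init: "x 0 = y 0"
  shows "x t = y t"
proof (cases "0 \<le> t")
  case True
  show ?thesis
    by (rule linear_ode_unique[OF has_vector_derivative_at_within[OF x] has_vector_derivative_at_within[OF y]
          lip L init, of t t]) (use True in auto)
next
  case False
  have refl: "((\<lambda>t. z (- t)) has_vector_derivative - d) (at t)"
    if "(z has_vector_derivative d) (at (- t))" for z :: "real \<Rightarrow> 'a" and d t
  proof -
    have "(uminus has_vector_derivative (- 1 :: real)) (at t)"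
      by (auto intro!: derivative_eq_intros)
    from vector_diff_chain_at[OF this that] show ?thesis by (simp add: o_def)
  qed
  have "x (- (- t)) = y (- (- t))"
  proof (rule linear_ode_unique[where f = "\<lambda>t. x (- t)" and g = "\<lambda>t. y (- t)" and T = "- t" and L = L])
    show "((\<lambda>t. x (- t)) has_vector_derivative - G (- s) (x (- s))) (at s within {0..- t})" for s
      by (rule has_vector_derivative_at_within[OF refl[OF x]])
    show "((\<lambda>t. y (- t)) has_vector_derivative - G (- s) (y (- s))) (at s within {0..- t})" for s
      by (rule has_vector_derivative_at_within[OF refl[OF y]])
    show "norm (- G (- s) (x (- s)) - - G (- s) (y (- s))) \<le> L * norm (x (- s) - y (- s))" for s
      using lip[of "- s" "x (- s)" "y (- s)"] by (simp add: norm_minus_commute)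
  qed (use False L init in auto)
  then show ?thesis by simp
qed

lemma has_vector_derivative_Pair_iff:
  "((\<lambda>t. (f t, g t)) has_vector_derivative (a, b)) (at x within S) \<longleftrightarrow>
    (f has_vector_derivative a) (at x within S) \<and> (g has_vector_derivative b) (at x within S)"
proof
  assume h: "((\<lambda>t. (f t, g t)) has_vector_derivative (a, b)) (at x within S)"
  show "(f has_vector_derivative a) (at x within S) \<and> (g has_vector_derivative b) (at x within S)"
    using bounded_linear.has_vector_derivative[OF bounded_linear_fst h]
      bounded_linear.has_vector_derivative[OF bounded_linear_snd h] by simp
next
  assume "(f has_vector_derivative a) (at x within S) \<and> (g has_vector_derivative b) (at x within S)"
  then show "((\<lambda>t. (f t, g t)) has_vector_derivative (a, b)) (at x within S)"
    by (elim conjE) (rule has_vector_derivative_Pair)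
qed

lemma has_vector_derivative_Pair_real_iff:
  fixes y v :: "real \<Rightarrow> real"
  shows "((\<lambda>t. (y t, v t)) has_vector_derivative (a, b)) (at x within S) \<longleftrightarrow>
    (y has_real_derivative a) (at x within S) \<and> (v has_real_derivative b) (at x within S)"
  by (simp add: has_vector_derivative_Pair_iff has_real_derivative_iff_has_vector_derivative)

lemma solves2_deriv:
  assumes "solves2 g y"
  shows "(y has_real_derivative deriv y t) (at t)"
    and "(deriv y has_real_derivative g t (y t)) (at t)"
proof -
  obtain v where v: "\<And>t. (y has_real_derivative v t) (at t)"
    "\<And>t. (v has_real_derivative g t (y t)) (at t)"
    using assms unfolding solves2_def by blast
  have "deriv y = v" using v(1) by (auto intro: DERIV_imp_deriv)
  then show "(y has_real_derivative deriv y t) (at t)"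
    "(deriv y has_real_derivative g t (y t)) (at t)" using v by auto
qed

lemma lipschitz_rhs_first_order:
  assumes "lipschitz_rhs g"
  obtains L where "0 \<le> L"
    "\<And>t (p :: real \<times> real) r. norm ((snd p, g t (fst p)) - (snd r, g t (fst r))) \<le> L * norm (p - r)"
proof -
  obtain L where L: "0 \<le> L" "\<And>t x y. \<bar>g t x - g t y\<bar> \<le> L * \<bar>x - y\<bar>"
    using assms by (auto simp: lipschitz_rhs_def)
  have "norm ((snd p, g t (fst p)) - (snd r, g t (fst r))) \<le> (1 + L) * norm (p - r)"
    for t and p r :: "real \<times> real"
  proof -
    obtain p1 p2 r1 r2 where [simp]: "p = (p1, p2)" "r = (r1, r2)" by (metis surj_pair)
    have "norm ((snd p, g t (fst p)) - (snd r, g t (fst r)))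
        \<le> norm (p2 - r2) + norm (g t p1 - g t r1)"
      using norm_Pair_le[of "p2 - r2" "g t p1 - g t r1"] by simp
    also have "\<dots> \<le> norm (p - r) + L * norm (p1 - r1)"
      using L(2)[of t p1 r1] norm_snd_le[of "p2 - r2" "p1 - r1"] by simp
    also have "\<dots> \<le> norm (p - r) + L * norm (p - r)"
      using norm_fst_le[of "p1 - r1" "p2 - r2"] L(1)
      by (intro add_left_mono mult_left_mono) auto
    finally show ?thesis by (simp add: algebra_simps)
  qed
  then show ?thesis using that[of "1 + L"] L(1) by simp
qed

lemma solves2_unique:
  assumes g: "lipschitz_rhs g" and "solves2 g y" "solves2 g z" "y 0 = z 0" "deriv y 0 = deriv z 0"
  shows "y = z"
proof
  fix t
  obtain L where L: "0 \<le> L"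
    "\<And>t (p :: real \<times> real) r. norm ((snd p, g t (fst p)) - (snd r, g t (fst r))) \<le> L * norm (p - r)"
    by (rule lipschitz_rhs_first_order[OF g]) blast
  have "(y t, deriv y t) = (z t, deriv z t)"
    by (rule ode_unique[where G = "\<lambda>t p. (snd p, g t (fst p))" and x = "\<lambda>t. (y t, deriv y t)"
          and y = "\<lambda>t. (z t, deriv z t)", OF _ _ L(2) L(1)])
      (use assms solves2_deriv in \<open>simp_all add: has_vector_derivative_Pair_real_iff\<close>)
  then show "y t = z t" by simp
qed

lemma ivp2:
  assumes g: "lipschitz_rhs g"
  shows "solves2 g (ivp2 g a b)" "ivp2 g a b 0 = a" "deriv (ivp2 g a b) 0 = b"
proof -
  obtain L where L: "0 \<le> L"
    "\<And>t (p :: real \<times> real) r. norm ((snd p, g t (fst p)) - (snd r, g t (fst r))) \<le> L * norm (p - r)"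
    by (rule lipschitz_rhs_first_order[OF g]) blast
  obtain C where C: "\<And>t. \<bar>g t 0\<bar> \<le> C" using g by (auto simp: lipschitz_rhs_def)
  have gc: "continuous_on UNIV (\<lambda>p. g (fst p) (snd p))" using g by (simp add: lipschitz_rhs_def)
  have "\<exists>x. x 0 = (a, b) \<and> (\<forall>t. (x has_vector_derivative (snd (x t), g t (fst (x t)))) (at t))"
  proof (rule lipschitz_ode_exists[OF _ L(2) _ L(1)])
    have "continuous_on UNIV (\<lambda>p::real \<times> real \<times> real. (\<lambda>p. g (fst p) (snd p)) (fst p, fst (snd p)))"
      by (rule continuous_on_compose2[OF gc]) (auto intro!: continuous_intros)
    then show "continuous_on UNIV (\<lambda>(t, p :: real \<times> real). (snd p, g t (fst p)))"
      by (auto simp: case_prod_unfold intro!: continuous_intros)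
    show "norm (snd 0 :: real, g t (fst 0)) \<le> C" for t
      using C[of t] by (simp add: norm_Pair)
  qed
  then obtain x where x: "x 0 = (a, b)"
    "\<And>t. (x has_vector_derivative (snd (x t), g t (fst (x t)))) (at t)" by blast
  define y where "y t = fst (x t)" for t
  define v where "v t = snd (x t)" for t
  have d: "(y has_real_derivative v t) (at t)" "(v has_real_derivative g t (y t)) (at t)" for t
    using x(2)[of t] has_vector_derivative_Pair_real_iff[of y v "v t" "g t (y t)" t UNIV]
    by (auto simp: y_def v_def)
  have y: "solves2 g y \<and> y 0 = a \<and> deriv y 0 = b"
    unfolding solves2_def
    using d x(1) DERIV_imp_deriv[OF d(1), of 0] by (intro conjI exI[of _ v]) (auto simp: y_def v_def)
  have "solves2 g (ivp2 g a b) \<and> ivp2 g a b 0 = a \<and> deriv (ivp2 g a b) 0 = b"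
    unfolding ivp2_def
    by (rule theI[of "\<lambda>y. solves2 g y \<and> y 0 = a \<and> deriv y 0 = b", OF y])
      (metis y solves2_unique[OF g])
  then show "solves2 g (ivp2 g a b)" "ivp2 g a b 0 = a" "deriv (ivp2 g a b) 0 = b" by auto
qed

lemma continuous_on_DERIV: "(\<And>t. (y has_real_derivative d t) (at t)) \<Longrightarrow> continuous_on S y"
  by (meson DERIV_isCont continuous_at_imp_continuous_on)

section \<open>Kepler's equation and the force field\<close>

lemma abs_sin_diff_le: "\<bar>sin x - sin y\<bar> \<le> \<bar>x - y\<bar>" for x y :: real
  using field_differentiable_bound[of UNIV sin cos 1 x y] by simp

context
  fixes e :: real
  assumes e: "0 \<le> e" "e < 1"
begin

text \<open>The sine is 1-Lipschitz, so the perturbation costs at most the share \<open>e\<close>.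
  Both the injectivity of Kepler's map and the Lipschitz continuity of its inverse follow.\<close>

lemma kepler_expansion: "(1 - e) * \<bar>u - v\<bar> \<le> \<bar>(u - e * sin u) - (v - e * sin v)\<bar>"
proof -
  have "e * \<bar>sin u - sin v\<bar> \<le> e * \<bar>u - v\<bar>"
    using e abs_sin_diff_le by (intro mult_left_mono) auto
  then have "\<bar>e * sin u - e * sin v\<bar> \<le> e * \<bar>u - v\<bar>"
    using e(1) by (simp add: abs_mult flip: right_diff_distrib)
  moreover have "(u - e * sin u) - (v - e * sin v) = (u - v) - (e * sin u - e * sin v)" by simp
  ultimately show ?thesis by (simp add: algebra_simps)
qed

lemma kepler_inj: "u - e * sin u = v - e * sin v \<Longrightarrow> u = v"
  using kepler_expansion[of u v] e by (simp add: mult_le_0_iff)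

lemma kepler_eq: "kepler (u - e * sin u) e = u"
  unfolding kepler_def by (rule the_equality) (auto intro: kepler_inj)

lemma kepler: "kepler t e - e * sin (kepler t e) = t"
proof -
  have "\<bar>e * sin u\<bar> \<le> 1" for u
    using e abs_sin_le_one[of u] mult_mono[of e 1 "\<bar>sin u\<bar>" 1] by (simp add: abs_mult)
  \<comment> \<open>As the perturbation has size at most 1, a root lies within distance 1 of
    \<open>t\<close>.\<close>
  then have "(t - 1) - e * sin (t - 1) \<le> t" "t \<le> (t + 1) - e * sin (t + 1)"
    by (smt (verit))+
  moreover have "continuous_on {t - 1..t + 1} (\<lambda>u. u - e * sin u)"
    by (intro continuous_intros)
  ultimately obtain u where "u - e * sin u = t"
    using IVT'[of "\<lambda>u. u - e * sin u" "t - 1" t "t + 1"] by auto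
  then show ?thesis using kepler_eq[of u] by simp
qed

lemma continuous_on_kepler: "continuous_on S (\<lambda>t. kepler t e)"
proof (rule lipschitz_on_continuous_on[of "1 / (1 - e)"], rule lipschitz_onI)
  fix s t
  have "(1 - e) * \<bar>kepler s e - kepler t e\<bar> \<le> \<bar>s - t\<bar>"
    using kepler_expansion[of "kepler s e" "kepler t e"] by (simp add: kepler)
  then show "dist (kepler s e) (kepler t e) \<le> 1 / (1 - e) * dist s t"
    using e by (simp add: dist_real_def pos_le_divide_eq mult.commute)
qed (use e in simp)

lemma continuous_on_rad: "continuous_on S (\<lambda>t. rad t e)"
  unfolding rad_def by (intro continuous_intros continuous_on_kepler) auto

lemma rad_kepler: "rad (u - e * sin u) e = (1 - e * cos u) / 2"
  by (simp add: rad_def kepler_eq)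

lemma rad_lower: "(1 - e) / 2 \<le> rad t e"
  using e mult_left_mono[OF cos_le_one[of "kepler t e"] e(1)] by (simp add: rad_def)

end

lemma rad_0 [simp]: "rad t 0 = 1 / 2"
  by (simp add: rad_def)

text \<open>The numerator is at most twice \<open>z\<^sup>2 + r\<^sup>2\<close>, which leaves the
  power 3/2 of a quantity that is at least \<open>\<rho>\<^sup>2\<close>. In the circular case
  \<open>\<rho> = 1/2\<close> the bound is 16.\<close>

lemma hill_coeff_bound:
  assumes "0 < \<rho>" "\<rho> \<le> r"
  shows "\<bar>hill_coeff z r\<bar> \<le> 2 / \<rho> ^ 3"
proof -
  define A where "A = z\<^sup>2 + r\<^sup>2"
  have A: "0 < A" "\<rho>\<^sup>2 \<le> A"
    using assms power_mono[of \<rho> r 2] by (auto simp: A_def add_nonneg_pos intro: add_increasing)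
  have "\<rho> ^ 3 = (\<rho>\<^sup>2) powr (3/2)"
    using assms by (simp add: powr_powr flip: powr_numeral)
  also have "\<dots> \<le> A powr (3/2)" using A by (intro powr_mono2) auto
  finally have 1: "\<rho> ^ 3 \<le> A powr (3/2)" .
  have "\<bar>hill_coeff z r\<bar> = \<bar>r\<^sup>2 - 2 * z\<^sup>2\<bar> / A powr (5/2)"
    by (simp add: hill_coeff_def A_def abs_divide)
  also have "\<dots> \<le> 2 * A / A powr (5/2)"
  proof (rule divide_right_mono)
    show "\<bar>r\<^sup>2 - 2 * z\<^sup>2\<bar> \<le> 2 * A"
      using zero_le_power2[of r] zero_le_power2[of z] by (simp add: A_def abs_le_iff)
  qed simp
  also have "A powr (5/2) = A * A powr (3/2)"
    using A powr_add[of A 1 "3/2"] by simp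
  also have "2 * A / (A * A powr (3/2)) = 2 / A powr (3/2)" using A by simp
  also have "\<dots> \<le> 2 / \<rho> ^ 3"
    using 1 assms A(1) by (intro divide_left_mono) auto
  finally show ?thesis .
qed

lemma force_has_derivative:
  assumes "0 < r"
  shows "((\<lambda>z. - z / (z\<^sup>2 + r\<^sup>2) powr (3/2)) has_real_derivative - hill_coeff z r) (at z)"
proof -
  have A: "0 < z\<^sup>2 + r\<^sup>2" using assms by (simp add: add_nonneg_pos)
  define C where "C = (z\<^sup>2 + r\<^sup>2) powr (1/2)"
  have C: "C > 0" using A assms by (simp add: C_def)
  have 1: "(z\<^sup>2 + r\<^sup>2) powr (3/2) = C * (z\<^sup>2 + r\<^sup>2)"
    using A powr_add[of "z\<^sup>2 + r\<^sup>2" "1/2" 1] by (simp add: C_def)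
  have 2: "(z\<^sup>2 + r\<^sup>2) powr (5/2) = C * (z\<^sup>2 + r\<^sup>2) * (z\<^sup>2 + r\<^sup>2)"
    using A powr_add[of "z\<^sup>2 + r\<^sup>2" "3/2" 1] by (simp add: 1)
  have "((\<lambda>z. (z\<^sup>2 + r\<^sup>2) powr (3/2)) has_real_derivative 3/2 * C * (2 * z)) (at z)"
    using DERIV_fun_powr[of "\<lambda>z. z\<^sup>2 + r\<^sup>2" "2 * z" z "3/2"] A
    by (auto simp: C_def intro!: derivative_eq_intros)
  from DERIV_divide[OF DERIV_minus[OF DERIV_ident] this]
  have "((\<lambda>z. - z / (z\<^sup>2 + r\<^sup>2) powr (3/2)) has_real_derivative
      (- 1 * (C * (z\<^sup>2 + r\<^sup>2)) - - z * (3/2 * C * (2 * z))) / (C * (z\<^sup>2 + r\<^sup>2) * (C * (z\<^sup>2 + r\<^sup>2)))) (at z)"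
    using A C assms by (simp add: 1)
  also have "(- 1 * (C * (z\<^sup>2 + r\<^sup>2)) - - z * (3/2 * C * (2 * z))) / (C * (z\<^sup>2 + r\<^sup>2) * (C * (z\<^sup>2 + r\<^sup>2)))
      = - hill_coeff z r"
  proof -
    have "- 1 * (C * (z\<^sup>2 + r\<^sup>2)) - - z * (3/2 * C * (2 * z)) = - (r\<^sup>2 - 2 * z\<^sup>2) * C"
      by (simp add: algebra_simps power2_eq_square)
    moreover have "(- n * C) / (C * a * (C * a)) = - (n / (C * a * a))" for n a
      using C by (cases "a = 0") (simp_all add: field_simps)
    ultimately show ?thesis unfolding hill_coeff_def 2 by presburger
  qed
  finally show ?thesis .
qed

lemma lipschitz_rhs_sitnikov:
  assumes e: "0 \<le> e" "e < 1"
  shows "lipschitz_rhs (sitnikov e)"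
proof -
  define \<rho> where "\<rho> = (1 - e) / 2"
  have \<rho>: "0 < \<rho>" "\<rho> \<le> rad t e" for t using e rad_lower[OF e] by (auto simp: \<rho>_def)
  have r: "0 < rad t e" for t using \<rho>(1) \<rho>(2)[of t] by linarith
  have "continuous_on UNIV (\<lambda>p. sitnikov e (fst p) (snd p))"
    unfolding sitnikov_def
    by (intro continuous_intros continuous_on_compose2[OF continuous_on_rad[OF e, of UNIV]])
      (auto simp: r add_nonneg_pos less_imp_neq[symmetric] sum_power2_eq_zero_iff)
  moreover have "\<bar>sitnikov e t x - sitnikov e t y\<bar> \<le> 2 / \<rho> ^ 3 * \<bar>x - y\<bar>" for t x y
    using field_differentiable_bound[of UNIV "sitnikov e t" "\<lambda>z. - hill_coeff z (rad t e)" "2 / \<rho> ^ 3" x y]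
      force_has_derivative[OF r] hill_coeff_bound[OF \<rho>]
    by (simp add: sitnikov_def[abs_def])
  moreover have "\<bar>sitnikov e t 0\<bar> \<le> 0" for t by (simp add: sitnikov_def)
  ultimately show ?thesis
    unfolding lipschitz_rhs_def using \<rho>(1) by (intro conjI exI[of _ "2 / \<rho> ^ 3"] exI[of _ 0]) auto
qed

lemma lipschitz_rhs_hill:
  assumes z: "continuous_on UNIV z" and r: "continuous_on UNIV r" and \<rho>: "0 < \<rho>" "\<And>t. \<rho> \<le> r t"
  shows "lipschitz_rhs (\<lambda>t y. - hill_coeff (z t) (r t) * y)"
proof -
  have pos: "0 < r t" for t using \<rho>(1) \<rho>(2)[of t] by linarith
  have "continuous_on UNIV (\<lambda>p. - hill_coeff (z (fst p)) (r (fst p)) * snd p)"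
    unfolding hill_coeff_def
    by (intro continuous_intros continuous_on_compose2[OF z] continuous_on_compose2[OF r])
      (auto simp: pos add_nonneg_pos less_imp_neq[symmetric] sum_power2_eq_zero_iff)
  moreover have "\<bar>- hill_coeff (z t) (r t) * x - - hill_coeff (z t) (r t) * y\<bar> \<le> 2 / \<rho> ^ 3 * \<bar>x - y\<bar>" for t x y
  proof -
    have "\<bar>- hill_coeff (z t) (r t) * x - - hill_coeff (z t) (r t) * y\<bar> = \<bar>hill_coeff (z t) (r t)\<bar> * \<bar>x - y\<bar>"
      by (simp add: abs_mult[symmetric] algebra_simps abs_minus_commute)
    also have "\<dots> \<le> 2 / \<rho> ^ 3 * \<bar>x - y\<bar>"
      by (intro mult_right_mono hill_coeff_bound \<rho>) auto
    finally show ?thesis .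
  qed
  ultimately show ?thesis
    unfolding lipschitz_rhs_def using \<rho>(1) by (intro conjI exI[of _ "2 / \<rho> ^ 3"] exI[of _ 0]) auto
qed

lemma zsol:
  assumes "0 \<le> e" "e < 1"
  shows "solves2 (sitnikov e) (\<lambda>t. zsol t \<xi> e)" "zsol 0 \<xi> e = \<xi>" "deriv (\<lambda>t. zsol t \<xi> e) 0 = 0"
  using ivp2[OF lipschitz_rhs_sitnikov[OF assms], of \<xi> 0] by (auto simp: zsol_def[abs_def])

section \<open>The constant \<open>e\<^sup>*\<close>\<close>

text \<open>The equivalent first order system has norm at most \<open>K + 1\<close>, and Gronwall's
  inequality adds another 1 to the rate.\<close>

lemma hill_solution_bound:
  assumes y: "solves2 (\<lambda>t y. - \<kappa> t * y) y" and K: "\<And>t. \<bar>\<kappa> t\<bar> \<le> K" and t: "t \<in> {0..T}"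
  shows "norm (y t, deriv y t) \<le> norm (y 0, deriv y 0) * exp ((K + 2) * T)"
proof -
  have K0: "0 \<le> K" using K[of 0] by linarith
  have "norm (y t, deriv y t) \<le> norm (y 0, deriv y 0) * exp (((K + 1) + 1) * T)"
  proof (rule gronwall_linear[where f = "\<lambda>t. (y t, deriv y t)" and f' = "\<lambda>t. (deriv y t, - \<kappa> t * y t)"])
    fix s
    show "((\<lambda>t. (y t, deriv y t)) has_vector_derivative (deriv y s, - \<kappa> s * y s)) (at s within {0..T})"
      by (rule has_vector_derivative_at_within)
        (use solves2_deriv[OF y, of s] in \<open>simp add: has_vector_derivative_Pair_real_iff\<close>)
    have "norm (deriv y s, - \<kappa> s * y s) \<le> norm (deriv y s) + \<bar>\<kappa> s\<bar> * norm (y s)"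
      using norm_Pair_le[of "deriv y s" "- \<kappa> s * y s"] by (simp add: abs_mult)
    also have "\<dots> \<le> norm (y s, deriv y s) + K * norm (y s, deriv y s)"
      using norm_fst_le[of "y s" "deriv y s"] norm_snd_le[of "deriv y s" "y s"] K[of s] K0
      by (intro add_mono mult_mono) auto
    finally show "norm (deriv y s, - \<kappa> s * y s) \<le> (K + 1) * norm (y s, deriv y s)"
      by (simp add: algebra_simps)
  qed (use K0 t in auto)
  then show ?thesis by (simp add: add.assoc)
qed

lemma lipschitz_rhs_circular: "lipschitz_rhs (\<lambda>t y. - hill_coeff (zsol t \<xi> 0) (1/2) * y)"
  by (rule lipschitz_rhs_hill[OF continuous_on_DERIV[OF solves2_deriv(1)[OF zsol(1)]] continuous_on_const,
        of 0 "1/2"]) auto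

lemma sup_norm_bounds:
  assumes "\<And>t. t \<in> {0..real N * pi} \<Longrightarrow> \<bar>f t\<bar> \<le> B"
  shows "\<bar>f 0\<bar> \<le> sup_norm N f" "sup_norm N f \<le> B"
proof -
  have "bdd_above ((\<lambda>t. \<bar>f t\<bar>) ` {0..real N * pi})" using assms by (rule bdd_aboveI2)
  then show "\<bar>f 0\<bar> \<le> sup_norm N f"
    unfolding sup_norm_def by (rule cSUP_upper[rotated]) simp
  show "sup_norm N f \<le> B"
    unfolding sup_norm_def by (rule cSUP_least) (simp_all add: assms)
qed

text \<open>The upper bound is uniform in \<open>\<xi>\<close>, which makes the supremum
  \<open>r0\<close> a genuine one; its rate is 16 + 2. The lower bound comes from the initial value
  of \<open>phi1\<close>.\<close>

lemma R0_bounds: "1 \<le> R0 N \<xi>" "R0 N \<xi> \<le> exp (18 * (real N * pi))"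
proof -
  let ?g = "\<lambda>t y. - hill_coeff (zsol t \<xi> 0) (1/2) * y"
  have b: "\<bar>y t\<bar> \<le> exp (18 * (real N * pi))" "\<bar>deriv y t\<bar> \<le> exp (18 * (real N * pi))"
    if "y = ivp2 ?g a b" "norm (a, b) = 1" "t \<in> {0..real N * pi}" for y a b t
  proof -
    have "norm (y t, deriv y t) \<le> norm (y 0, deriv y 0) * exp ((16 + 2) * (real N * pi))"
      using ivp2(1)[OF lipschitz_rhs_circular, of \<xi> a b] hill_coeff_bound[of "1/2" "1/2"] that
      by (intro hill_solution_bound[where \<kappa> = "\<lambda>t. hill_coeff (zsol t \<xi> 0) (1/2)"])
        (auto simp: power_divide)
    then have "norm (y t, deriv y t) \<le> exp (18 * (real N * pi))"
      using ivp2(2,3)[OF lipschitz_rhs_circular, of \<xi> a b] that by simp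
    then show "\<bar>y t\<bar> \<le> exp (18 * (real N * pi))" "\<bar>deriv y t\<bar> \<le> exp (18 * (real N * pi))"
      using norm_fst_le[of "y t" "deriv y t"] norm_snd_le[of "deriv y t" "y t"] by auto
  qed
  have 1: "phi1 \<xi> = ivp2 ?g 1 0" "norm (1::real, 0::real) = 1"
    and 2: "phi2 \<xi> = ivp2 ?g 0 1" "norm (0::real, 1::real) = 1"
    by (simp_all add: phi1_def phi2_def norm_Pair)
  have "phi1 \<xi> 0 = 1"
    using ivp2(2)[OF lipschitz_rhs_circular, of \<xi> 1 0] by (simp add: phi1_def)
  then show "1 \<le> R0 N \<xi>"
    using sup_norm_bounds(1)[of N "phi1 \<xi>", OF b(1)[OF 1]] by (simp add: R0_def le_max_iff_disj)
  show "R0 N \<xi> \<le> exp (18 * (real N * pi))"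
    unfolding R0_def
    using sup_norm_bounds(2)[OF b(1)[OF 1]] sup_norm_bounds(2)[OF b(2)[OF 1]]
      sup_norm_bounds(2)[OF b(1)[OF 2]] sup_norm_bounds(2)[OF b(2)[OF 2]] by simp
qed

lemma r0_ge_1:
  assumes "0 \<le> xs"
  shows "1 \<le> r0 N xs"
proof -
  have "bdd_above (R0 N ` {0..xs})" using R0_bounds(2) by (rule bdd_aboveI2)
  then have "R0 N 0 \<le> r0 N xs" unfolding r0_def using assms by (intro cSUP_upper) auto
  then show ?thesis using R0_bounds(1)[of N 0] by linarith
qed

text \<open>\<open>R\<^sub>m\<close> is the maximum point of \<open>x - \<beta>\<^sub>1 x^5 - \<beta>\<^sub>2 x^3\<close>, and the left-hand side of the equation
  defining \<open>E\<^sup>*\<close> is minus the maximum; this makes it monotone in the coefficients.\<close>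

lemma quintic_maximum:
  fixes \<beta>1 \<beta>2 :: real
  assumes pos: "0 < \<beta>1" "0 < \<beta>2"
  defines "s \<equiv> (sqrt (9 * \<beta>2\<^sup>2 + 20 * \<beta>1) - 3 * \<beta>2) / (10 * \<beta>1)"
  defines "R \<equiv> sqrt s"
  shows "0 < R" "2 * R ^ 3 * (2 * \<beta>1 * R\<^sup>2 + \<beta>2) = R - \<beta>1 * R ^ 5 - \<beta>2 * R ^ 3"
    "5 * \<beta>1 * R ^ 4 \<le> 1"
    "0 \<le> x \<Longrightarrow> x - \<beta>1 * x ^ 5 - \<beta>2 * x ^ 3 \<le> R - \<beta>1 * R ^ 5 - \<beta>2 * R ^ 3"
proof -
  define w where "w = sqrt (9 * \<beta>2\<^sup>2 + 20 * \<beta>1)"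
  have w2: "w\<^sup>2 = 9 * \<beta>2\<^sup>2 + 20 * \<beta>1" using pos by (simp add: w_def)
  have "3 * \<beta>2 < w"
    unfolding w_def using pos by (intro real_less_rsqrt) (simp add: power_mult_distrib)
  then have s: "0 < s" using pos by (simp add: s_def w_def)
  then show R: "0 < R" by (simp add: R_def)
  have R2: "R\<^sup>2 = s" using s by (simp add: R_def)
  have ws: "w = 10 * \<beta>1 * s + 3 * \<beta>2" using pos by (simp add: s_def w_def)
  have "\<beta>1 * (5 * \<beta>1 * s\<^sup>2 + 3 * \<beta>2 * s) = \<beta>1 * 1"
    using w2 unfolding ws by (simp add: power2_eq_square algebra_simps)
  \<comment> \<open>The derivative of \<open>x - \<beta>1 * x ^ 5 - \<beta>2 * x ^ 3\<close>
    vanishes at \<open>R\<close>, written in terms of \<open>s = R\<^sup>2\<close>.\<close>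
  then have crit: "5 * \<beta>1 * s\<^sup>2 + 3 * \<beta>2 * s = 1" using pos by simp
  have R4: "R ^ 4 = s\<^sup>2" unfolding R2[symmetric] by (simp flip: power_mult)
  have crit': "5 * \<beta>1 * R ^ 4 + 3 * \<beta>2 * R\<^sup>2 = 1" using crit by (simp add: R4 R2)
  then show "5 * \<beta>1 * R ^ 4 \<le> 1" using pos zero_le_power2[of R]
    by (smt (verit) mult_nonneg_nonneg)
  have "R - \<beta>1 * R ^ 5 - \<beta>2 * R ^ 3 = R * (5 * \<beta>1 * R ^ 4 + 3 * \<beta>2 * R\<^sup>2) - \<beta>1 * R ^ 5 - \<beta>2 * R ^ 3"
    by (simp add: crit')
  also have "\<dots> = 2 * R ^ 3 * (2 * \<beta>1 * R\<^sup>2 + \<beta>2)"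
    by (simp add: algebra_simps eval_nat_numeral)
  finally show "2 * R ^ 3 * (2 * \<beta>1 * R\<^sup>2 + \<beta>2) = R - \<beta>1 * R ^ 5 - \<beta>2 * R ^ 3" ..
  show "x - \<beta>1 * x ^ 5 - \<beta>2 * x ^ 3 \<le> R - \<beta>1 * R ^ 5 - \<beta>2 * R ^ 3" if x: "0 \<le> x"
  proof -
    \<comment> \<open>On the half line third and fifth powers lie above their tangents at
      \<open>R\<close>. Since \<open>R\<close> is critical, the slopes of the weighted tangents add
      up to 1.\<close>
    have "x ^ 3 - (R ^ 3 + 3 * R\<^sup>2 * (x - R)) = (x - R)\<^sup>2 * (x + 2 * R)"
      by (simp add: algebra_simps eval_nat_numeral)
    also have "\<dots> \<ge> 0" using x R by simp
    finally have 3: "\<beta>2 * (R ^ 3 + 3 * R\<^sup>2 * (x - R)) \<le> \<beta>2 * x ^ 3"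
      using pos by (intro mult_left_mono) auto
    have "x ^ 5 - (R ^ 5 + 5 * R ^ 4 * (x - R)) = (x - R)\<^sup>2 * (x ^ 3 + 2 * x\<^sup>2 * R + 3 * x * R\<^sup>2 + 4 * R ^ 3)"
      by (simp add: algebra_simps eval_nat_numeral)
    also have "\<dots> \<ge> 0" using x R by simp
    finally have 5: "\<beta>1 * (R ^ 5 + 5 * R ^ 4 * (x - R)) \<le> \<beta>1 * x ^ 5"
      using pos by (intro mult_left_mono) auto
    have "\<beta>1 * (R ^ 5 + 5 * R ^ 4 * (x - R)) + \<beta>2 * (R ^ 3 + 3 * R\<^sup>2 * (x - R))
        = \<beta>1 * R ^ 5 + \<beta>2 * R ^ 3 + (x - R) * (5 * \<beta>1 * R ^ 4 + 3 * \<beta>2 * R\<^sup>2)"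
      by (simp add: algebra_simps)
    then show ?thesis using 3 5 by (simp add: crit')
  qed
qed

section \<open>The root defining \<open>E\<^sup>*\<close>, and positivity of the
  \<open>\<xi>\<^sub>p\<close>\<close>

context
  fixes N :: nat
  assumes N: "0 < N"
begin

lemma b1_less: "0 \<le> e \<Longrightarrow> e < e' \<Longrightarrow> e' < 1 \<Longrightarrow> b1 N e < b1 N e'"
  unfolding b1_def by (rule frac_less) (use N in \<open>auto intro: power_mono\<close>)

lemma b2_less: "0 \<le> e \<Longrightarrow> e < e' \<Longrightarrow> e' < 1 \<Longrightarrow> b2 N e < b2 N e'"
  unfolding b2_def by (rule frac_less) (use N in \<open>auto intro: power_mono\<close>)

lemma b1_0 [simp]: "b1 N 0 = 0" and b2_0 [simp]: "b2 N 0 = 0"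
  by (simp_all add: b1_def b2_def)

lemma b1_pos: "0 < e \<Longrightarrow> e < 1 \<Longrightarrow> 0 < b1 N e"
  using b1_less[of 0 e] by simp

lemma b2_pos: "0 < e \<Longrightarrow> e < 1 \<Longrightarrow> 0 < b2 N e"
  using b2_less[of 0 e] by simp

definition E1_fun :: "real \<Rightarrow> real" where
  "E1_fun e = 2 * Rm N e ^ 3 * (2 * b1 N e * (Rm N e)\<^sup>2 + b2 N e)"

lemma E1_fun_props:
  assumes "0 < e" "e < 1"
  shows "0 < Rm N e"
    "E1_fun e = Rm N e - b1 N e * Rm N e ^ 5 - b2 N e * Rm N e ^ 3"
    "5 * b1 N e * Rm N e ^ 4 \<le> 1"
    "0 \<le> x \<Longrightarrow> x - b1 N e * x ^ 5 - b2 N e * x ^ 3 \<le> E1_fun e"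
  using quintic_maximum[OF b1_pos[OF assms] b2_pos[OF assms]]
  unfolding Rm_def[symmetric] E1_fun_def by auto

lemma E1_fun_less:
  assumes "0 < e" "e < e'" "e' < 1"
  shows "E1_fun e' < E1_fun e"
proof -
  \<comment> \<open>The maximum point for \<open>e'\<close> is the test point for \<open>e\<close>,
    whose coefficients are smaller.\<close>
  define R where "R = Rm N e'"
  have e': "0 < e'" "e' < 1" using assms by auto
  have R: "0 < R" using E1_fun_props(1)[OF e'] by (simp add: R_def)
  have "b1 N e * R ^ 5 < b1 N e' * R ^ 5" "b2 N e * R ^ 3 < b2 N e' * R ^ 3"
    using assms R b1_less[of e e'] b2_less[of e e'] by auto
  then have "E1_fun e' < R - b1 N e * R ^ 5 - b2 N e * R ^ 3"
    by (simp add: E1_fun_props(2)[OF e'] flip: R_def)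
  also have "\<dots> \<le> E1_fun e" using R assms by (intro E1_fun_props(4)) auto
  finally show ?thesis .
qed

text \<open>The intermediate value theorem gives a root: the maximum is at least \<open>r0\<close>
  for small \<open>e\<close>, because the coefficients tend to 0, and at most \<open>r0\<close> for
  \<open>e = 1/2\<close>. Strict monotonicity makes the root unique, so that the description
  \<open>E1\<close> is proper.\<close>

lemma E1_bounds:
  assumes "0 \<le> xs"
  shows "0 < E1 N xs" "E1 N xs < 1"
proof -
  define r where "r = r0 N xs"
  have r: "1 \<le> r" using r0_ge_1[OF assms] by (simp add: r_def)
  have "((\<lambda>a. b1 N a * (2 * r) ^ 5 + b2 N a * (2 * r) ^ 3) \<longlongrightarrow> b1 N 0 * (2 * r) ^ 5 + b2 N 0 * (2 * r) ^ 3) (at_right 0)"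
    unfolding b1_def b2_def by (intro tendsto_intros) auto
  then have "eventually (\<lambda>a. b1 N a * (2 * r) ^ 5 + b2 N a * (2 * r) ^ 3 < r) (at_right 0)"
    using r by (intro order_tendstoD(2)) auto
  moreover have "eventually (\<lambda>a. a \<in> {0<..<1/2}) (at_right (0::real))"
    by (intro eventually_at_right_real) auto
  ultimately have "eventually (\<lambda>a. b1 N a * (2 * r) ^ 5 + b2 N a * (2 * r) ^ 3 < r \<and> a \<in> {0<..<1/2}) (at_right 0)"
    by eventually_elim auto
  then obtain a where a: "b1 N a * (2 * r) ^ 5 + b2 N a * (2 * r) ^ 3 < r" "0 < a" "a < 1/2"
    using eventually_happens[of _ "at_right (0::real)"] by (auto simp: trivial_limit_at_right_real)
  \<comment> \<open>At the test point \<open>2 * r\<close> the higher powers take away less than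
    \<open>r\<close>.\<close>
  have "r \<le> E1_fun a"
    using E1_fun_props(4)[of a "2 * r"] a r by simp
  moreover have "E1_fun (1/2) \<le> r"
  proof -
    define R where "R = Rm N (1/2)"
    have h: "0 < (1/2::real)" "(1/2::real) < 1" by auto
    \<comment> \<open>For \<open>e = 1/2\<close> the quintic coefficient is so large that the
      maximum point is at most 1; the maximum is smaller still, while \<open>r\<close> is at least
      1.\<close>
    have "1 \<le> (real N * pi)\<^sup>2"
      using N pi_gt3 mult_mono[of 1 "real N" 1 pi] by (intro one_le_power) auto
    then have "1 \<le> 5 * b1 N (1/2)" by (simp add: b1_def power_divide)
    then have "1 * R ^ 4 \<le> 5 * b1 N (1/2) * R ^ 4" by (intro mult_right_mono) auto
    then have "R ^ 4 \<le> 1" using E1_fun_props(3)[OF h] by (simp add: R_def)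
    then have "R \<le> 1" using power_mono_iff[of R 1 4] E1_fun_props(1)[OF h] by (simp add: R_def)
    moreover have "0 \<le> b1 N (1/2) * R ^ 5" "0 \<le> b2 N (1/2) * R ^ 3"
      using b1_pos[OF h] b2_pos[OF h] E1_fun_props(1)[OF h] by (auto simp: R_def)
    ultimately show ?thesis using r by (simp add: E1_fun_props(2)[OF h] flip: R_def)
  qed
  moreover have "continuous_on {a..1/2} E1_fun"
  proof -
    have nz: "b1 N x \<noteq> 0" if "x \<in> {a..1/2}" for x using b1_pos[of x] a that by auto
    have c: "continuous_on {a..1/2} (b1 N)" "continuous_on {a..1/2} (b2 N)"
      unfolding b1_def b2_def by (intro continuous_intros; auto)+
    then have "continuous_on {a..1/2} (Rm N)"
      unfolding Rm_def by (intro continuous_intros) (auto simp: nz)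
    then show ?thesis unfolding E1_fun_def using c by (intro continuous_intros)
  qed
  ultimately obtain x where x: "a \<le> x" "x \<le> 1/2" "E1_fun x = r"
    using IVT2'[of E1_fun "1/2" r a] a by auto
  have "E1 N xs = x"
    unfolding E1_def
  proof (rule the_equality)
    show "0 < x \<and> x < 1 \<and> - 2 * Rm N x ^ 3 * (2 * b1 N x * (Rm N x)\<^sup>2 + b2 N x) = - r0 N xs"
      using x a by (auto simp: E1_fun_def r_def)
    fix y assume "0 < y \<and> y < 1 \<and> - 2 * Rm N y ^ 3 * (2 * b1 N y * (Rm N y)\<^sup>2 + b2 N y) = - r0 N xs"
    then have "0 < y" "y < 1" "E1_fun y = r" by (auto simp: E1_fun_def r_def)
    then show "y = x"
      using E1_fun_less[of x y] E1_fun_less[of y x] x a by (cases x y rule: linorder_cases) auto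
  qed
  then show "0 < E1 N xs" "E1 N xs < 1" using x a by auto
qed

lemma e_star_less_1:
  assumes "0 \<le> xs"
  shows "e_star N p xs < 1"
  using E1_bounds[OF assms] by (simp add: e_star_def E2_def min_less_iff_disj)

text \<open>Since \<open>M \<ge> 0\<close>, a positive \<open>e\<^sup>*\<close> forces \<open>\<Delta>\<^sub>* > 0\<close>, hence \<open>\<xi>\<^sub>1 > \<dots> > \<xi>\<^sub>\<nu> > 0\<close>.\<close>

lemma xi_pos:
  assumes xs: "0 \<le> xs" and e: "0 < e_star N p' xs" and p: "p \<in> {1..nu N}"
  shows "0 < xi N p"
proof -
  note E1 = E1_bounds[OF xs]
  have "0 < Rcal N xs" using E1_fun_props(1)[OF E1] by (simp add: Rcal_def)
  moreover have sigma: "0 < sigma_star N xs" using E1 by (simp add: sigma_star_def)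
  ultimately have Psi: "0 < Psi N xs"
    unfolding Psi_def using N E1 by (intro divide_pos_pos mult_pos_pos) (auto intro!: add_pos_nonneg)
  define d where "d = \<bar>dphi1_end N p'\<bar>"
  have "Psi N xs * E2 N p' xs \<le> Psi N xs * (d / (2 * Psi N xs))"
    using Psi by (intro mult_left_mono) (auto simp: E2_def d_def)
  then have "0 \<le> d - Psi N xs * E2 N p' xs"
    using Psi by (simp add: d_def)
  then have M: "0 \<le> Mconst N p' xs"
    unfolding Mconst_def d_def[symmetric] using sigma E1 by (intro divide_nonneg_nonneg mult_nonneg_nonneg) auto
  \<comment> \<open>Division by zero yields 0, so a positive quotient also rules out
    \<open>Mconst N p' xs = 0\<close>.\<close>
  have "0 < Delta_star N xs / Mconst N p' xs" using e by (simp add: e_star_def)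
  then have "0 < Delta_star N xs" using M by (simp add: zero_less_divide_iff)
  then have step: "xi_ext N xs (j + 1) < xi_ext N xs j" if "j \<le> nu N" for j
    using that by (simp add: Delta_star_def)
  \<comment> \<open>The induction descends from the index \<open>nu N + 1\<close>, where
    \<open>xi_ext\<close> is 0.\<close>
  have "0 < xi_ext N xs (nu N - k)" if "k < nu N" for k
    using that
  proof (induction k)
    case 0
    then show ?case using step[of "nu N"] by (simp add: xi_ext_def)
  next
    case (Suc k)
    then show ?case using step[of "nu N - Suc k"] by (simp add: Suc_diff_Suc)
  qed
  from this[of "nu N - p"] show ?thesis using p by (simp add: xi_ext_def)
qed

end

section \<open>The Sitnikov system in eccentric anomaly\<close>

type_synonym state = "real \<times> real \<times> real \<times> real \<times> real \<times> real \<times> real \<times> real \<times> real \<times> real"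

text \<open>With the eccentric anomaly \<open>u\<close> as independent variable, \<open>t = u - e sin u\<close>, and with the
  additional unknowns \<open>w = 1 / sqrt (z\<^sup>2 + r\<^sup>2)\<close>, \<open>C = cos u\<close>, \<open>S = sin u\<close>, the equations for \<open>(z, z')\<close>
  and for two solutions of the Hill equation become a polynomial autonomous system. The eccentricity
  is a constant unknown, and \<open>t = 2 N \<pi>\<close> corresponds to \<open>u = 2 N \<pi>\<close>.\<close>

definition anomaly_field :: "state \<Rightarrow> state" where
  "anomaly_field = (\<lambda>(z, v, w, C, S, e, y, y', x, x').
     ((1 - e * C) * v,
      - ((1 - e * C) * z * w ^ 3),
      - ((1 - e * C) * w ^ 3 * (z * v + e * S / 4)),
      - S, C, 0,
      (1 - e * C) * y',
      - ((1 - e * C) * ((1 - e * C)\<^sup>2 / 4 - 2 * z\<^sup>2) * w ^ 5 * y),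
      (1 - e * C) * x',
      - ((1 - e * C) * ((1 - e * C)\<^sup>2 / 4 - 2 * z\<^sup>2) * w ^ 5 * x)))"

definition anomaly_state ::
  "(real \<Rightarrow> real) \<Rightarrow> (real \<Rightarrow> real) \<Rightarrow> (real \<Rightarrow> real) \<Rightarrow> real \<Rightarrow> real \<Rightarrow> state" where
  "anomaly_state z y x e u =
     (z (u - e * sin u), deriv z (u - e * sin u),
      1 / sqrt ((z (u - e * sin u))\<^sup>2 + ((1 - e * cos u) / 2)\<^sup>2), cos u, sin u, e,
      y (u - e * sin u), deriv y (u - e * sin u), x (u - e * sin u), deriv x (u - e * sin u))"

lemma vpoly_anomaly_field: "vpoly anomaly_field"
  unfolding anomaly_field_def case_prod_unfold
  by (intro vpoly_Pair vpoly_real polyf_mult polyf_add polyf_diff polyf_uminus polyf_power polyf_divide polyf_const;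
      rule polyf_linear, simp add: linear_conv_bounded_linear[symmetric] linear_iff)

lemma powr_half_odd:
  assumes "0 < A"
  shows "A powr (3/2) = sqrt A ^ 3" "A powr (5/2) = sqrt A ^ 5"
proof -
  have "sqrt A ^ n = A powr (real n / 2)" for n
  proof -
    have "sqrt A ^ n = sqrt A powr real n" using assms by (simp add: powr_realpow)
    also have "\<dots> = (A powr (1/2)) powr real n" using assms by (simp only: powr_half_sqrt less_imp_le)
    finally show ?thesis by (simp add: powr_powr)
  qed
  from this[of 3] this[of 5] show "A powr (3/2) = sqrt A ^ 3" "A powr (5/2) = sqrt A ^ 5" by simp_all
qed

lemma force_eq:
  assumes "0 < z\<^sup>2 + r\<^sup>2"
  shows "- z / (z\<^sup>2 + r\<^sup>2) powr (3/2) = - (z * (1 / sqrt (z\<^sup>2 + r\<^sup>2)) ^ 3)"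
    and "hill_coeff z r = (r\<^sup>2 - 2 * z\<^sup>2) * (1 / sqrt (z\<^sup>2 + r\<^sup>2)) ^ 5"
  using powr_half_odd[OF assms] by (simp_all add: hill_coeff_def power_one_over)

text \<open>The derivative of \<open>w = 1 / sqrt A\<close> is polynomial in \<open>w\<close> and
  the derivative of \<open>A\<close>. This is why adjoining \<open>w\<close> as an unknown removes
  the fractional powers.\<close>

lemma DERIV_inverse_sqrt:
  assumes "(A has_real_derivative d) (at x within S)" "0 < A x"
  shows "((\<lambda>x. 1 / sqrt (A x)) has_real_derivative - ((1 / sqrt (A x)) ^ 3 * (d / 2))) (at x within S)"
proof -
  have "((\<lambda>x. 1 / sqrt (A x)) has_real_derivative
      (0 * sqrt (A x) - 1 * (inverse (sqrt (A x)) / 2 * d)) / (sqrt (A x) * sqrt (A x))) (at x within S)"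
    using assms by (intro DERIV_divide DERIV_const DERIV_chain'[OF assms(1) DERIV_real_sqrt]) auto
  then show ?thesis
    by (rule DERIV_cong) (simp add: field_simps power3_eq_cube)
qed

text \<open>All time derivatives are multiplied by \<open>dt/du = 1 - e * cos u\<close>. The summand
  \<open>e * S / 4\<close> in the equation for \<open>w\<close> comes from \<open>r dr/du\<close>
  with \<open>r = (1 - e * cos u) / 2\<close>, after that common factor has been split off.\<close>

lemma anomaly_state_derivative:
  assumes e: "0 \<le> e" "e < 1" and z: "solves2 (sitnikov e) z"
    and y: "solves2 (\<lambda>t y. - q z t e * y) y" and x: "solves2 (\<lambda>t y. - q z t e * y) x"
  shows "(anomaly_state z y x e has_vector_derivative anomaly_field (anomaly_state z y x e u)) (at u)"
proof -
  define \<tau> where "\<tau> = (\<lambda>u. u - e * sin u)"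
  define R where "R = (\<lambda>u. 1 - e * cos u)"
  define A where "A = (\<lambda>u. (z (\<tau> u))\<^sup>2 + (R u / 2)\<^sup>2)"
  define w where "w = (\<lambda>u. 1 / sqrt (A u))"
  have \<tau>: "(\<tau> has_real_derivative R u) (at u)"
    unfolding \<tau>_def R_def by (auto intro!: derivative_eq_intros)
  have rad: "rad (\<tau> u) e = R u / 2" by (simp add: \<tau>_def R_def rad_kepler[OF e])
  have "e * cos u \<le> e * 1" using e by (intro mult_left_mono) auto
  then have R: "0 < R u" using e by (simp add: R_def)
  then have A: "0 < A u" by (simp add: A_def add_nonneg_pos)
  have chain: "((\<lambda>u. f (\<tau> u)) has_real_derivative d * R u) (at u)"
    if "(f has_real_derivative d) (at (\<tau> u))" for f d
    using DERIV_chain2[OF that \<tau>] .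
  have 1: "((\<lambda>u. z (\<tau> u)) has_real_derivative R u * deriv z (\<tau> u)) (at u)"
    using chain[OF solves2_deriv(1)[OF z]] by (simp add: mult.commute)
  have 2: "((\<lambda>u. deriv z (\<tau> u)) has_real_derivative - (R u * z (\<tau> u) * w u ^ 3)) (at u)"
  proof (rule DERIV_cong[OF chain[OF solves2_deriv(2)[OF z]]])
    have "sitnikov e (\<tau> u) (z (\<tau> u)) = - (z (\<tau> u) * w u ^ 3)"
      unfolding sitnikov_def rad w_def A_def by (rule force_eq(1)) (use A in \<open>simp only: A_def\<close>)
    then show "sitnikov e (\<tau> u) (z (\<tau> u)) * R u = - (R u * z (\<tau> u) * w u ^ 3)" by simp
  qed
  have dR: "(R has_real_derivative e * sin u) (at u)"
    unfolding R_def by (auto intro!: derivative_eq_intros)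
  have dA: "(A has_real_derivative 2 * R u * (z (\<tau> u) * deriv z (\<tau> u) + e * sin u / 4)) (at u)"
    unfolding A_def
    by (rule DERIV_cong[OF DERIV_add[OF DERIV_power[OF 1] DERIV_power[OF DERIV_cdivide[OF dR]]]])
      (simp add: algebra_simps)
  have 3: "(w has_real_derivative - (R u * w u ^ 3 * (z (\<tau> u) * deriv z (\<tau> u) + e * sin u / 4))) (at u)"
    unfolding w_def by (rule DERIV_cong[OF DERIV_inverse_sqrt[OF dA A]]) (simp add: algebra_simps)
  have hill: "((\<lambda>u. f (\<tau> u)) has_real_derivative R u * deriv f (\<tau> u)) (at u)"
    "((\<lambda>u. deriv f (\<tau> u)) has_real_derivative
      - (R u * ((R u)\<^sup>2 / 4 - 2 * (z (\<tau> u))\<^sup>2) * w u ^ 5 * f (\<tau> u))) (at u)"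
    if f: "solves2 (\<lambda>t y. - q z t e * y) f" for f
  proof -
    show "((\<lambda>u. f (\<tau> u)) has_real_derivative R u * deriv f (\<tau> u)) (at u)"
      using chain[OF solves2_deriv(1)[OF f]] by (simp add: mult.commute)
    show "((\<lambda>u. deriv f (\<tau> u)) has_real_derivative
      - (R u * ((R u)\<^sup>2 / 4 - 2 * (z (\<tau> u))\<^sup>2) * w u ^ 5 * f (\<tau> u))) (at u)"
    proof (rule DERIV_cong[OF chain[OF solves2_deriv(2)[OF f]]])
      have "q z (\<tau> u) e = ((R u / 2)\<^sup>2 - 2 * (z (\<tau> u))\<^sup>2) * w u ^ 5"
        unfolding q_def rad w_def A_def by (rule force_eq(2)) (use A in \<open>simp only: A_def\<close>)
      then show "- q z (\<tau> u) e * f (\<tau> u) * R u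
          = - (R u * ((R u)\<^sup>2 / 4 - 2 * (z (\<tau> u))\<^sup>2) * w u ^ 5 * f (\<tau> u))"
        by (simp add: power_divide)
    qed
  qed
  have "((\<lambda>u. (z (\<tau> u), deriv z (\<tau> u), w u, cos u, sin u, e, y (\<tau> u), deriv y (\<tau> u), x (\<tau> u), deriv x (\<tau> u)))
    has_vector_derivative anomaly_field
      (z (\<tau> u), deriv z (\<tau> u), w u, cos u, sin u, e, y (\<tau> u), deriv y (\<tau> u), x (\<tau> u), deriv x (\<tau> u))) (at u)"
    unfolding anomaly_field_def prod.case
    using 1 2 3 hill[OF y] hill[OF x] DERIV_cos[of u] DERIV_sin[of u]
    by (intro has_vector_derivative_Pair has_vector_derivative_const;
        simp add: has_real_derivative_iff_has_vector_derivative[symmetric] R_def)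
  then show ?thesis
    by (simp add: anomaly_state_def[abs_def] \<tau>_def w_def A_def R_def)
qed

section \<open>Regularity of the discriminant along the family\<close>

lemma cdiff_inverse_sqrt:
  assumes "cdiff n J A" and pos: "\<And>e. e \<in> J \<Longrightarrow> 0 < A e"
  shows "cdiff n J (\<lambda>e. 1 / sqrt (A e))"
  using assms(1)
proof (induction n)
  case (Suc n)
  then obtain A' where A': "\<forall>e\<in>J. (A has_vector_derivative A' e) (at e within J)" "cdiff n J A'"
    by auto
  define h where "h = (\<lambda>e. 1 / sqrt (A e))"
  have h: "cdiff n J h" using Suc.IH cdiff_Suc[OF Suc.prems] by (simp add: h_def)
  \<comment> \<open>The derivative is again a product of copies of \<open>h\<close> and of
    \<open>A'\<close>, so the induction closes.\<close>
  have "cdiff n J (\<lambda>e. h e * (h e * h e))" by (intro cdiff_mult h)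
  then have "cdiff n J (\<lambda>e. (- 1 / 2) * (h e * (h e * h e) * A' e))"
    by (intro cdiff_mult cdiff_const A'(2) h)
  moreover have "(h has_vector_derivative (- 1 / 2) * (h e * (h e * h e) * A' e)) (at e within J)"
    if "e \<in> J" for e
    using DERIV_inverse_sqrt[of A "A' e" e J] A'(1) pos[OF that] that
    by (simp add: h_def has_real_derivative_iff_has_vector_derivative power3_eq_cube mult_ac)
  ultimately show ?case
    unfolding cdiff.simps h_def[symmetric]
    by (intro exI[of _ "\<lambda>e. (- 1 / 2) * (h e * (h e * h e) * A' e)"]) simp
qed simp

lemma smooth_on_cdiff:
  assumes "smooth_on S f"
  shows "cdiff n S f"
proof -
  have "cdiff n S ((deriv_on S ^^ k) f)" for k
  proof (induction n arbitrary: k)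
    case (Suc n)
    have "((deriv_on S ^^ k) f has_vector_derivative (deriv_on S ^^ Suc k) f e) (at e within S)" if "e \<in> S" for e
      using assms that by (auto simp: smooth_on_def deriv_on_def vector_derivative_works[symmetric])
    then show ?case using Suc by (auto intro!: exI[of _ "(deriv_on S ^^ Suc k) f"] simp del: funpow.simps)
  qed simp
  from this[of 0] show ?thesis by simp
qed

text \<open>In the theorem the positivity of \<open>e_star N p xs\<close> is supplied by the
  eccentricity under consideration, which lies strictly between 0 and it.\<close>

locale sitnikov_family =
  fixes N p :: nat and xs :: real and H :: "real \<Rightarrow> real"
  assumes N: "odd N" and p: "p \<in> {1..nu N}" and xs: "0 < xs"
    and family: "periodic_family N p xs H" and E: "0 < e_star N p xs"
begin

abbreviation "E \<equiv> e_star N p xs"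

lemma N_pos: "0 < N"
  using N by (rule odd_pos)

lemma E_less_1: "E < 1"
  using e_star_less_1[OF N_pos] xs by simp

lemma Zfam:
  assumes e: "e \<in> {0..<E}"
  shows "solves2 (sitnikov e) (Zfam H e)" "Zfam H e 0 = H e" "deriv (Zfam H e) 0 = 0"
  using zsol[of e "H e"] e E_less_1 by (auto simp: Zfam_def[abs_def])

lemma Zfam_even_periodic:
  assumes e: "e \<in> {0..<E}"
  shows "Zfam H e (- t) = Zfam H e t" "Zfam H e (t + 2 * real N * pi) = Zfam H e t"
  using family e by (auto simp: periodic_family_def even_periodic_solution_def)

lemma lipschitz_rhs_q:
  assumes e: "e \<in> {0..<E}"
  shows "lipschitz_rhs (\<lambda>t y. - q (Zfam H e) t e * y)"
  unfolding q_def
  using continuous_on_DERIV[OF solves2_deriv(1)[OF Zfam(1)[OF e]]] e E_less_1 rad_lower[of e]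
  by (intro lipschitz_rhs_hill[where \<rho> = "(1 - e) / 2"] continuous_on_rad) auto

definition hill_sol :: "real \<Rightarrow> real \<Rightarrow> real \<Rightarrow> real \<Rightarrow> real" where
  "hill_sol a b e = ivp2 (\<lambda>t y. - q (Zfam H e) t e * y) a b"

lemma hill_sol:
  assumes e: "e \<in> {0..<E}"
  shows "solves2 (\<lambda>t y. - q (Zfam H e) t e * y) (hill_sol a b e)"
    "hill_sol a b e 0 = a" "deriv (hill_sol a b e) 0 = b"
  unfolding hill_sol_def by (rule ivp2[OF lipschitz_rhs_q[OF e]])+

lemma Delta_hill_sol: "Delta N H e = hill_sol 1 0 e (2 * real N * pi) + deriv (hill_sol 0 1 e) (2 * real N * pi)"
  by (simp add: Delta_def discriminant_def hill_sol_def)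

definition X :: "real \<Rightarrow> real \<Rightarrow> state" where
  "X u e = anomaly_state (Zfam H e) (hill_sol 1 0 e) (hill_sol 0 1 e) e u"

lemma X_derivative:
  assumes "e \<in> {0..<E}"
  shows "((\<lambda>u. X u e) has_vector_derivative anomaly_field (X u e)) (at u)"
  unfolding X_def
  by (rule anomaly_state_derivative) (use assms E_less_1 Zfam(1) hill_sol(1) in auto)

text \<open>The family is smooth on a half-open interval, whereas the flow theorem works on a
  compact parameter set; hence the intervals \<open>{0..c}\<close> with
  \<open>c < E\<close>.\<close>

lemma cdiff_H: "c < E \<Longrightarrow> cdiff n {0..c} H"
  using family by (intro cdiff_subset[OF smooth_on_cdiff[of "{0..<E}"]]) (auto simp: periodic_family_def)

lemma cdiff_X0:
  assumes "c < E"
  shows "cdiff n {0..c} (X 0)"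
proof -
  have lin: "cdiff n {0..c} (\<lambda>e. (1 - e) / 2)"
    using cdiff_add[OF cdiff_const[of n _ "1/2"] cdiff_mult[OF cdiff_const[of n _ "- (1/2)"] cdiff_ident], of "{0..c}"]
    by (simp add: field_simps)
  have "cdiff n {0..c} (\<lambda>e. 1 / sqrt (H e * H e + (1 - e) / 2 * ((1 - e) / 2)))"
  proof (intro cdiff_inverse_sqrt cdiff_add cdiff_mult lin cdiff_H assms)
    fix e assume "e \<in> {0..c}"
    then have "0 < (1 - e) / 2" using assms E_less_1 by auto
    then show "0 < H e * H e + (1 - e) / 2 * ((1 - e) / 2)"
      by (intro add_nonneg_pos mult_pos_pos) auto
  qed
  then have "cdiff n {0..c} (\<lambda>e. (H e, 0 :: real, 1 / sqrt (H e * H e + (1 - e) / 2 * ((1 - e) / 2)),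
      1 :: real, 0 :: real, e, 1 :: real, 0 :: real, 0 :: real, 1 :: real))"
    by (intro cdiff_Pair cdiff_const cdiff_ident cdiff_H assms)
  then show ?thesis
  proof (rule cdiff_cong[rotated])
    fix e assume "e \<in> {0..c}"
    then have "e \<in> {0..<E}" using assms by auto
    then show "(H e, 0, 1 / sqrt (H e * H e + (1 - e) / 2 * ((1 - e) / 2)), 1, 0, e, 1, 0, 0, 1) = X 0 e"
      by (simp add: X_def anomaly_state_def Zfam hill_sol power2_eq_square)
  qed
qed

text \<open>Only the uniform bound takes work. Along a solution the Sitnikov equation has the form
  of a linear equation with bounded coefficient, so one exponential estimate covers \<open>z\<close>
  and both Hill solutions.\<close>

lemma flow_family_X:
  assumes c: "0 < c" "c < E"
  shows "flow_family anomaly_field T {0..c} X"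
  unfolding flow_family_def
proof (intro conjI ballI)
  fix e t assume "e \<in> {0..c}" "t \<in> {0..T}"
  then show "((\<lambda>t. X t e) has_vector_derivative anomaly_field (X t e)) (at t within {0..T})"
    using c by (intro has_vector_derivative_at_within[OF X_derivative]) auto
next
  define \<rho> where "\<rho> = (1 - c) / 2"
  have \<rho>: "0 < \<rho>" using c E_less_1 by (simp add: \<rho>_def)
  have rad: "\<rho> \<le> rad t e" if "e \<in> {0..c}" for t e
    using rad_lower[of e t] that c E_less_1 by (simp add: \<rho>_def)
  have "bounded (H ` {0..c})"
    using cdiff_continuous[OF cdiff_H[OF c(2)]]
    by (intro compact_imp_bounded compact_continuous_image) auto
  then obtain B where "\<forall>h\<in>H ` {0..c}. norm h \<le> B"
    unfolding bounded_iff by blast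
  then have B: "\<bar>H e\<bar> \<le> B" if "e \<in> {0..c}" for e using that by auto
  define K where "K = 2 / \<rho> ^ 3"
  \<comment> \<open>For \<open>u\<close> in \<open>{0..T}\<close> the time
    \<open>u - e * sin u\<close> lies in \<open>{0..T + 1}\<close>.\<close>
  define C where "C = exp ((K + 2) * (T + 1))"
  have bound: "\<bar>f (u - e * sin u)\<bar> \<le> norm (f 0, deriv f 0) * C" "\<bar>deriv f (u - e * sin u)\<bar> \<le> norm (f 0, deriv f 0) * C"
    if f: "solves2 (\<lambda>t y. - \<kappa> t * y) f" "\<And>t. \<bar>\<kappa> t\<bar> \<le> K" and e: "e \<in> {0..c}" and u: "u \<in> {0..T}" for f \<kappa> e u
  proof -
    have "e * sin u \<le> 1 * u"
    proof (cases "0 \<le> sin u")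
      case True
      then show ?thesis using e u c E_less_1 sin_x_le_x[of u] by (intro mult_mono) auto
    next
      case False
      then have "e * sin u \<le> 0" using e by (simp add: mult_nonneg_nonpos)
      then show ?thesis using u by auto
    qed
    moreover have "e * (- sin u) \<le> 1 * 1"
    proof -
      have "e * (- sin u) \<le> e * 1"
        using e sin_ge_minus_one[of u] by (intro mult_left_mono) auto
      then show ?thesis using e c E_less_1 by simp
    qed
    ultimately have "u - e * sin u \<in> {0..T + 1}" using u by simp
    from hill_solution_bound[OF f this]
    show "\<bar>f (u - e * sin u)\<bar> \<le> norm (f 0, deriv f 0) * C" "\<bar>deriv f (u - e * sin u)\<bar> \<le> norm (f 0, deriv f 0) * C"
      using norm_fst_le[of "f (u - e * sin u)" "deriv f (u - e * sin u)"]
        norm_snd_le[of "deriv f (u - e * sin u)" "f (u - e * sin u)"]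
      by (auto simp: C_def)
  qed
  show "\<exists>M. \<forall>e\<in>{0..c}. \<forall>u\<in>{0..T}. norm (X u e) \<le> M"
  proof (intro exI ballI)
    fix e u assume e: "e \<in> {0..c}" and u: "u \<in> {0..T}"
    then have e': "e \<in> {0..<E}" using c by auto
    have C: "0 \<le> C" by (simp add: C_def)
    \<comment> \<open>This is the force divided by \<open>- z\<close>, read as a given function of
      time.\<close>
    define \<kappa> where "\<kappa> t = 1 / ((Zfam H e t)\<^sup>2 + (rad t e)\<^sup>2) powr (3/2)" for t
    have "sitnikov e t (Zfam H e t) = - \<kappa> t * Zfam H e t" for t
      by (simp add: sitnikov_def \<kappa>_def)
    then have z: "solves2 (\<lambda>t y. - \<kappa> t * y) (Zfam H e)"
      using Zfam(1)[OF e'] by (simp add: solves2_def)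
    have \<kappa>: "\<bar>\<kappa> t\<bar> \<le> K" for t
    proof -
      have "\<rho>\<^sup>2 \<le> (Zfam H e t)\<^sup>2 + (rad t e)\<^sup>2"
        using rad[OF e, of t] \<rho> by (intro add_increasing power_mono) auto
      then have "(\<rho>\<^sup>2) powr (3/2) \<le> ((Zfam H e t)\<^sup>2 + (rad t e)\<^sup>2) powr (3/2)"
        by (intro powr_mono2) auto
      moreover have "(\<rho>\<^sup>2) powr (3/2) = \<rho> ^ 3"
        using \<rho> by (simp add: powr_powr flip: powr_numeral)
      ultimately have "\<kappa> t \<le> 1 / \<rho> ^ 3"
        unfolding \<kappa>_def using \<rho> by (intro divide_left_mono mult_pos_pos) (auto intro: less_le_trans[of 0 "\<rho> ^ 3"])
      also have "\<dots> \<le> K" using \<rho> by (simp add: K_def divide_right_mono)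
      finally show ?thesis by (simp add: \<kappa>_def)
    qed
    have q: "\<bar>q (Zfam H e) t e\<bar> \<le> K" for t
      unfolding q_def K_def by (rule hill_coeff_bound[OF \<rho> rad[OF e]])
    define s where "s = u - e * sin u"
    have zb: "\<bar>Zfam H e s\<bar> \<le> B * C" "\<bar>deriv (Zfam H e) s\<bar> \<le> B * C"
      using bound[OF z \<kappa> e u] B[OF e] C mult_right_mono[OF B[OF e] C]
      by (auto simp: Zfam[OF e'] s_def norm_Pair)
    have yb: "\<bar>hill_sol a b e s\<bar> \<le> C" "\<bar>deriv (hill_sol a b e) s\<bar> \<le> C" if "norm (a, b) = 1" for a b
      using bound[OF hill_sol(1)[OF e', of a b] q e u] that by (auto simp: hill_sol[OF e'] s_def)
    have "\<rho> \<le> (1 - e * cos u) / 2"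
      using rad[OF e, of s] rad_kepler[of e u] e' E_less_1 by (simp add: s_def)
    then have "\<rho>\<^sup>2 \<le> (Zfam H e s)\<^sup>2 + ((1 - e * cos u) / 2)\<^sup>2"
      using \<rho> by (intro add_increasing power_mono) auto
    then have "\<rho> \<le> sqrt ((Zfam H e s)\<^sup>2 + ((1 - e * cos u) / 2)\<^sup>2)"
      by (rule real_le_rsqrt)
    then have wb: "\<bar>1 / sqrt ((Zfam H e s)\<^sup>2 + ((1 - e * cos u) / 2)\<^sup>2)\<bar> \<le> 1 / \<rho>"
      using \<rho> by (simp add: frac_le)
    have *: "norm (a, b) \<le> A + B" if "\<bar>a\<bar> \<le> A" "norm b \<le> B" for a :: real and b :: "'z::real_normed_vector" and A B
      using norm_Pair_le[of a b] that by simp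
    have 1: "norm (1::real, 0::real) = 1" "norm (0::real, 1::real) = 1" by (simp_all add: norm_Pair)
    show "norm (X u e) \<le> B * C + (B * C + (1 / \<rho> + (1 + (1 + (1 + (C + (C + (C + C))))))))"
      unfolding X_def anomaly_state_def s_def[symmetric]
    proof (intro * zb wb yb 1)
      show "\<bar>e\<bar> \<le> 1" using e' E_less_1 by simp
      show "norm (deriv (hill_sol 0 1 e) s) \<le> C" using yb[OF 1(2)] by simp
    qed auto
  qed
qed

lemma cdiff_Delta:
  assumes c: "0 < c" "c < E"
  shows "cdiff 3 {0..c} (Delta N H)"
proof -
  have "cdiff 3 {0..c} (X (2 * real N * pi))"
    by (rule flow_family_cdiff3[OF vpoly_anomaly_field flow_family_X[OF c] _ _ cdiff_X0[OF c(2)],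
          of "2 * real N * pi"]) auto
  \<comment> \<open>The functional adds the seventh and the tenth component, \<open>y\<close> and
    \<open>x'\<close>. At \<open>u = 2 N \<pi>\<close> time and anomaly agree, so the sum is the
    discriminant.\<close>
  moreover have "bounded_linear (\<lambda>s :: state. fst (snd (snd (snd (snd (snd (snd s))))))
    + snd (snd (snd (snd (snd (snd (snd (snd (snd s)))))))))"
    by (intro bounded_linear_intros)
  ultimately have "cdiff 3 {0..c} (\<lambda>e. fst (snd (snd (snd (snd (snd (snd (X (2 * real N * pi) e)))))))
    + snd (snd (snd (snd (snd (snd (snd (snd (snd (X (2 * real N * pi) e))))))))))"
    by (rule cdiff_bounded_linear[rotated])
  moreover have "sin (2 * real N * pi) = 0" using sin_npi[of "2 * N"] by simp
  ultimately show ?thesis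
    by (simp add: X_def anomaly_state_def Delta_hill_sol[abs_def])
qed

end

section \<open>The discriminant at \<open>e = 0\<close>\<close>

lemma DERIV_shift_within:
  fixes f :: "real \<Rightarrow> real"
  assumes "(f has_real_derivative d) (at (u + b) within {0..T})" and b: "0 \<le> b"
  shows "((\<lambda>u. f (u + b)) has_real_derivative d) (at u within {0..T - b})"
proof -
  have "((\<lambda>u. u + b) has_real_derivative 1) (at u within {0..T - b})"
    by (auto intro!: derivative_eq_intros)
  moreover have "(f has_real_derivative d) (at (u + b) within (\<lambda>u. u + b) ` {0..T - b})"
    using assms by (rule_tac DERIV_subset[OF assms(1)]) auto
  ultimately show ?thesis using DERIV_image_chain[of f d "\<lambda>u. u + b" u "{0..T - b}" 1] by (simp add: o_def)
qed

lemma DERIV_zero_const: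
  fixes f :: "real \<Rightarrow> real"
  assumes "\<And>t. t \<in> {0..T} \<Longrightarrow> (f has_real_derivative 0) (at t within {0..T})" "t \<in> {0..T}"
  shows "f t = f 0"
proof -
  obtain c where "\<forall>t\<in>{0..T}. f t = c"
    using has_field_derivative_zero_constant[of "{0..T}" f] assms(1) by auto
  then show ?thesis using assms(2) by auto
qed

lemma symmetric_deriv_zero:
  fixes f :: "real \<Rightarrow> real"
  assumes d: "(f has_real_derivative d) (at s)" and sym: "\<And>h. f (s + h) = f (s - h)"
  shows "d = 0"
proof -
  have "((\<lambda>t. f (2 * s - t)) has_real_derivative d * (- 1)) (at s)"
    by (rule DERIV_chain2[where g = "\<lambda>t. 2 * s - t"]) (use d in \<open>auto intro!: derivative_eq_intros\<close>)
  moreover have "(\<lambda>t. f (2 * s - t)) = f"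
  proof
    fix t show "f (2 * s - t) = f t" using sym[of "s - t"] by (simp add: algebra_simps)
  qed
  ultimately have "d * (- 1) = d" using d DERIV_unique by metis
  then show ?thesis by simp
qed

section \<open>First variation of the anomaly field at eccentricity zero\<close>

lemma line_has_vector_derivative:
  fixes p h :: "'a::real_normed_vector"
  shows "((\<lambda>s. p + s *\<^sub>R h) has_vector_derivative h) (at 0)"
  unfolding has_vector_derivative_def by (auto intro!: derivative_eq_intros)

text \<open>The base point has eccentricity 0 and the direction has eccentricity component 1, so
  \<open>s\<close> itself is the eccentricity along the line, while the cosine and sine components
  stay fixed.\<close>

lemma anomaly_component_derivatives:
  fixes C z \<zeta> w \<omega> v \<eta> S y \<alpha> :: real
  shows "((\<lambda>s. (1 - s * C) * (v + s * \<eta>)) has_real_derivative \<eta> - C * v) (at 0)"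
    and "((\<lambda>s. - ((1 - s * C) * (z + s * \<zeta>) * (w + s * \<omega>) ^ 3)) has_real_derivative
      C * z * w ^ 3 - \<zeta> * w ^ 3 - 3 * z * w\<^sup>2 * \<omega>) (at 0)"
    and "((\<lambda>s. - ((1 - s * C) * (w + s * \<omega>) ^ 3 * ((z + s * \<zeta>) * (v + s * \<eta>) + s * S / 4))) has_real_derivative
      C * w ^ 3 * z * v - 3 * w\<^sup>2 * \<omega> * z * v - w ^ 3 * (\<zeta> * v + z * \<eta> + S / 4)) (at 0)"
    and "((\<lambda>s. - ((1 - s * C) * ((1 - s * C)\<^sup>2 / 4 - 2 * (z + s * \<zeta>)\<^sup>2) * (w + s * \<omega>) ^ 5 * (y + s * \<alpha>)))
      has_real_derivative
      (C * ((1/4 - 2 * z\<^sup>2) * w ^ 5) + (C / 2 + 4 * z * \<zeta>) * w ^ 5 - 5 * (1/4 - 2 * z\<^sup>2) * w ^ 4 * \<omega>) * y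
       - (1/4 - 2 * z\<^sup>2) * w ^ 5 * \<alpha>) (at 0)"
  by ((((rule derivative_eq_intros refl | (simp; fail))+)[1], simp add: algebra_simps add_divide_distrib diff_divide_distrib)+)

text \<open>Applied to a vector, the Frechet derivative is the derivative along a line, which
  reduces the formula to calculus in one variable.\<close>

lemma anomaly_field_variation:
  "frechet_derivative anomaly_field (at (z, v, w, C, S, 0, y, y', x, x')) (\<zeta>, \<eta>, \<omega>, 0, 0, 1, \<alpha>, \<alpha>', \<beta>, \<beta>') =
    (\<eta> - C * v,
     C * z * w ^ 3 - \<zeta> * w ^ 3 - 3 * z * w\<^sup>2 * \<omega>,
     C * w ^ 3 * z * v - 3 * w\<^sup>2 * \<omega> * z * v - w ^ 3 * (\<zeta> * v + z * \<eta> + S / 4),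
     0, 0, 0,
     \<alpha>' - C * y',
     (C * ((1/4 - 2 * z\<^sup>2) * w ^ 5) + (C / 2 + 4 * z * \<zeta>) * w ^ 5 - 5 * (1/4 - 2 * z\<^sup>2) * w ^ 4 * \<omega>) * y
       - (1/4 - 2 * z\<^sup>2) * w ^ 5 * \<alpha>,
     \<beta>' - C * x',
     (C * ((1/4 - 2 * z\<^sup>2) * w ^ 5) + (C / 2 + 4 * z * \<zeta>) * w ^ 5 - 5 * (1/4 - 2 * z\<^sup>2) * w ^ 4 * \<omega>) * x
       - (1/4 - 2 * z\<^sup>2) * w ^ 5 * \<beta>)"
  (is "_ = ?R")
proof -
  let ?p = "(z, v, w, C, S, 0, y, y', x, x') :: state"
  let ?h = "(\<zeta>, \<eta>, \<omega>, 0, 0, 1, \<alpha>, \<alpha>', \<beta>, \<beta>') :: state"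
  let ?D = "frechet_derivative anomaly_field (at ?p)"
  have "(anomaly_field has_derivative ?D) (at ?p)"
    by (rule quadratic_approx_has_derivative[OF vpoly_tangent(2,3)[OF vpoly_anomaly_field]])
  then have D: "(anomaly_field has_derivative ?D) (at (?p + (0::real) *\<^sub>R ?h))" by simp
  note line = line_has_vector_derivative[of ?p ?h]
  have "((\<lambda>s. anomaly_field (?p + s *\<^sub>R ?h)) has_vector_derivative ?D ?h) (at 0)"
    using vector_derivative_diff_chain_within[OF line has_derivative_at_withinI[OF D]] by (simp only: o_def)
  moreover have "((\<lambda>s. anomaly_field (?p + s *\<^sub>R ?h)) has_vector_derivative ?R) (at 0)"
    unfolding anomaly_field_def scaleR_Pair add_Pair prod.case has_vector_derivative_Pair_iff
      has_real_derivative_iff_has_vector_derivative[symmetric]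
    by (simp only: real_scaleR_def mult_zero_right mult_1_right add_0_right add_0_left)
      (intro conjI anomaly_component_derivatives DERIV_const)
  ultimately show ?thesis by (rule vector_derivative_unique_at)
qed

section \<open>The circular solution and its Hill equation\<close>

context sitnikov_family
begin

lemma zero_in: "0 \<in> {0..<E}"
  using E by simp

lemma Zfam_multiple_period:
  assumes "e \<in> {0..<E}"
  shows "Zfam H e (t + real k * (2 * real N * pi)) = Zfam H e t"
proof (induction k arbitrary: t)
  case (Suc k)
  have "Zfam H e (t + real (Suc k) * (2 * real N * pi)) = Zfam H e (t + 2 * real N * pi + real k * (2 * real N * pi))"
    by (simp add: algebra_simps)
  then show ?case using Suc[of "t + 2 * real N * pi"] Zfam_even_periodic(2)[OF assms] by simp
qed simp

text \<open>Evenness together with the period \<open>2 N \<pi>\<close> makes every multiple of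
  \<open>N \<pi>\<close> a centre of symmetry.\<close>

lemma deriv_Zfam_half_period:
  assumes e: "e \<in> {0..<E}"
  shows "deriv (Zfam H e) (real k * (real N * pi)) = 0"
proof (rule symmetric_deriv_zero[OF solves2_deriv(1)[OF Zfam(1)[OF e]]])
  fix h
  have "Zfam H e (real k * (real N * pi) - h) = Zfam H e (h - real k * (real N * pi))"
    using Zfam_even_periodic(1)[OF e, of "h - real k * (real N * pi)"] by simp
  also have "\<dots> = Zfam H e (h - real k * (real N * pi) + real k * (2 * real N * pi))"
    by (rule Zfam_multiple_period[OF e, symmetric])
  finally show "Zfam H e (real k * (real N * pi) + h) = Zfam H e (real k * (real N * pi) - h)"
    by (simp add: algebra_simps)
qed

definition Z where "Z = Zfam H 0"
definition V where "V = deriv Z"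
definition w where "w t = 1 / sqrt ((Z t)\<^sup>2 + (1/2)\<^sup>2)"
definition K where "K t = (1/4 - 2 * (Z t)\<^sup>2) * w t ^ 5"
definition a where "a = hill_sol 1 0 0"
definition a' where "a' = deriv a"
definition b where "b = hill_sol 0 1 0"
definition b' where "b' = deriv b"

lemma radicand_pos: "0 < (Z t)\<^sup>2 + (1/2)\<^sup>2"
  by (rule add_nonneg_pos) auto

lemma w_square: "(w t)\<^sup>2 * ((Z t)\<^sup>2 + 1/4) = 1"
  using radicand_pos[of t] by (simp add: w_def power_divide)

lemma q_K: "q Z t 0 = K t"
  using force_eq(2)[OF radicand_pos[of t]] by (simp add: q_def K_def w_def power_divide)

lemma K_bound: "\<bar>K t\<bar> \<le> 16"
  using hill_coeff_bound[of "1/2" "1/2" "Z t"] q_K[of t] by (simp add: q_def power_divide)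

lemma d_Z: "(Z has_real_derivative V t) (at t)"
  using solves2_deriv(1)[OF Zfam(1)[OF zero_in]] by (simp add: Z_def V_def)

lemma sitnikov_0: "sitnikov 0 t (Z t) = - (Z t * w t ^ 3)"
  using force_eq(1)[OF radicand_pos[of t]] by (simp add: sitnikov_def w_def)

lemma d_V: "(V has_real_derivative - (Z t * w t ^ 3)) (at t)"
  using solves2_deriv(2)[OF Zfam(1)[OF zero_in], of t] sitnikov_0[of t] by (simp add: Z_def V_def)

lemma d_w: "(w has_real_derivative - (w t ^ 3 * (Z t * V t))) (at t)"
proof -
  have "((\<lambda>t. (Z t)\<^sup>2 + (1/2)\<^sup>2) has_real_derivative 2 * (Z t * V t)) (at t)"
    by (rule DERIV_cong[OF DERIV_add[OF DERIV_power[OF d_Z] DERIV_const]]) simp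
  from DERIV_inverse_sqrt[OF this radicand_pos] show ?thesis
    unfolding w_def by (rule DERIV_cong) simp
qed

lemma hill_0:
  assumes "solves2 (\<lambda>t y. - q (Zfam H 0) t 0 * y) y"
  shows "(y has_real_derivative deriv y t) (at t)" "(deriv y has_real_derivative - K t * y t) (at t)"
  using solves2_deriv[OF assms, of t] q_K[of t] by (auto simp: Z_def)

lemma d_a: "(a has_real_derivative a' t) (at t)" "(a' has_real_derivative - K t * a t) (at t)"
  unfolding a'_def a_def by (rule hill_0 hill_sol[OF zero_in])+

lemma d_b: "(b has_real_derivative b' t) (at t)" "(b' has_real_derivative - K t * b t) (at t)"
  unfolding b'_def b_def by (rule hill_0 hill_sol[OF zero_in])+

lemma ab_0: "a 0 = 1" "a' 0 = 0" "b 0 = 0" "b' 0 = 1"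
  unfolding a'_def a_def b'_def b_def by (rule hill_sol[OF zero_in])+

lemma Z_0: "Z 0 = H 0" "0 < H 0" "V 0 = 0"
proof -
  show "Z 0 = H 0" "V 0 = 0" using Zfam[OF zero_in] by (auto simp: Z_def V_def)
  show "0 < H 0" using xi_pos[OF N_pos _ E p] xs family zero_in by (simp add: periodic_family_def)
qed

lemma V_half_period: "V (real k * (real N * pi)) = 0"
  using deriv_Zfam_half_period[OF zero_in] by (simp add: V_def Z_def)

text \<open>The velocity vanishes at 0 and at \<open>N \<pi>\<close>, so conservation of energy
  gives equal distances at these times. The circular equation is autonomous and odd in
  \<open>z\<close>; uniqueness extends the relation to all times.\<close>

lemma half_period_shift: "\<exists>s. s\<^sup>2 = 1 \<and> (\<forall>t. Z (t + real N * pi) = s * Z t)"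
proof -
  \<comment> \<open>This is the energy, with potential \<open>- w\<close>.\<close>
  have "((\<lambda>t. (V t)\<^sup>2 / 2 - w t) has_real_derivative 0) (at t within S)" for t S
    by (rule DERIV_cong[OF DERIV_diff[OF DERIV_cdivide[OF DERIV_power[OF DERIV_subset[OF d_V]]] DERIV_subset[OF d_w]]])
      (auto simp: algebra_simps)
  then have "(V (real N * pi))\<^sup>2 / 2 - w (real N * pi) = (V 0)\<^sup>2 / 2 - w 0"
    by (intro DERIV_zero_const[of "real N * pi"]) auto
  then have w: "w (real N * pi) = w 0"
    using V_half_period[of 0] V_half_period[of 1] by simp
  have "(w (real N * pi))\<^sup>2 * ((Z (real N * pi))\<^sup>2 + 1/4) = (w (real N * pi))\<^sup>2 * ((Z 0)\<^sup>2 + 1/4)"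
    using w_square[of "real N * pi"] w_square[of 0] by (simp add: w)
  moreover have "w (real N * pi) \<noteq> 0"
    using w_square[of "real N * pi"] by auto
  ultimately have eq: "(Z (real N * pi))\<^sup>2 = (Z 0)\<^sup>2" by simp
  define s where "s = Z (real N * pi) / Z 0"
  have Z0: "Z 0 \<noteq> 0" using Z_0 by simp
  have s: "s\<^sup>2 = 1" using eq Z0 by (simp add: s_def power_divide)
  \<comment> \<open>Because \<open>s\<close> is its own inverse, \<open>y\<close> starts at
    \<open>Z 0\<close>.\<close>
  define y where "y = (\<lambda>t. s * Z (t + real N * pi))"
  have dy: "(y has_real_derivative s * V (t + real N * pi)) (at t)" for t
    unfolding y_def using DERIV_shift[of Z "V (t + real N * pi)" t "real N * pi"] d_Z
    by (intro DERIV_cmult) simp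
  have "((\<lambda>t. V (t + real N * pi)) has_real_derivative - (Z (t + real N * pi) * w (t + real N * pi) ^ 3)) (at t)" for t
    using DERIV_shift[of V "- (Z (t + real N * pi) * w (t + real N * pi) ^ 3)" t "real N * pi"] d_V by simp
  then have "((\<lambda>t. s * V (t + real N * pi)) has_real_derivative s * - (Z (t + real N * pi) * w (t + real N * pi) ^ 3)) (at t)" for t
    by (intro DERIV_cmult)
  moreover have "s * - (Z (t + real N * pi) * w (t + real N * pi) ^ 3) = sitnikov 0 t (y t)" for t
  proof -
    have "sitnikov 0 t (y t) = s * sitnikov 0 (t + real N * pi) (Z (t + real N * pi))"
      using s by (simp add: sitnikov_def y_def power_mult_distrib)
    then show ?thesis by (simp add: sitnikov_0)
  qed
  ultimately have d2y: "((\<lambda>t. s * V (t + real N * pi)) has_real_derivative sitnikov 0 t (y t)) (at t)" for t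
    by metis
  have "solves2 (sitnikov 0) y"
    unfolding solves2_def using dy d2y by (intro exI[of _ "\<lambda>t. s * V (t + real N * pi)"]) simp
  moreover have "solves2 (sitnikov 0) Z" using Zfam(1)[OF zero_in] by (simp add: Z_def)
  moreover have "y 0 = Z 0"
  proof -
    have "y 0 = s\<^sup>2 * Z 0" using Z0 by (simp add: y_def s_def power2_eq_square)
    then show ?thesis by (simp add: s)
  qed
  moreover have "deriv y 0 = deriv Z 0"
    using DERIV_imp_deriv[OF dy[of 0]] V_half_period[of 1] Z_0(3) by (simp add: V_def)
  ultimately have "y = Z"
    by (intro solves2_unique[OF lipschitz_rhs_sitnikov[of 0]]) auto
  have "Z (t + real N * pi) = s * Z t" for t
  proof -
    have "Z t = s * Z (t + real N * pi)" using fun_cong[OF \<open>y = Z\<close>, of t] by (simp add: y_def)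
    then have "s * Z t = s * (s * Z (t + real N * pi))" by (rule arg_cong)
    also have "\<dots> = s\<^sup>2 * Z (t + real N * pi)" by (simp add: power2_eq_square)
    finally have "s * Z t = s\<^sup>2 * Z (t + real N * pi)" .
    then show ?thesis by (simp add: s)
  qed
  with s show ?thesis by blast
qed

definition s where "s = (SOME s. s\<^sup>2 = 1 \<and> (\<forall>t. Z (t + real N * pi) = s * Z t))"

lemma s: "s\<^sup>2 = 1" "Z (t + real N * pi) = s * Z t"
proof -
  have "s\<^sup>2 = 1 \<and> (\<forall>t. Z (t + real N * pi) = s * Z t)"
    unfolding s_def by (rule someI_ex[OF half_period_shift])
  then show "s\<^sup>2 = 1" "Z (t + real N * pi) = s * Z t" by blast+
qed

lemma V_shift: "V (t + real N * pi) = s * V t"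
proof -
  have "((\<lambda>t. Z (t + real N * pi)) has_real_derivative V (t + real N * pi)) (at t)"
    using DERIV_shift[of Z "V (t + real N * pi)" t "real N * pi"] d_Z by simp
  moreover have "((\<lambda>t. Z (t + real N * pi)) has_real_derivative s * V t) (at t)"
    unfolding s(2) by (rule DERIV_cmult[OF d_Z])
  ultimately show ?thesis by (rule DERIV_unique)
qed

lemma w_shift: "w (t + real N * pi) = w t"
  using s(1) by (simp add: w_def s(2) power_mult_distrib)

lemma K_shift: "K (t + real N * pi) = K t"
  using s(1) by (simp add: K_def w_shift s(2) power_mult_distrib)

text \<open>The derivative of the circular solution solves the variational equation.\<close>

lemma V_eq_b: "\<exists>k. k \<noteq> 0 \<and> (\<forall>t. V t = k * b t) \<and> (\<forall>t. - (Z t * w t ^ 3) = k * b' t)"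
proof -
  \<comment> \<open>This is the acceleration at time 0. It is nonzero because
    \<open>\<xi>\<^sub>p\<close> is positive; for the rest position \<open>V\<close> would vanish
    identically.\<close>
  define k where "k = - (Z 0 * w 0 ^ 3)"
  have "w 0 \<noteq> 0" using w_square[of 0] by auto
  then have k: "k \<noteq> 0" using Z_0 by (simp add: k_def)
  have dV: "deriv V = (\<lambda>t. - (Z t * w t ^ 3))"
    using DERIV_imp_deriv[OF d_V] by auto
  have d2V: "((\<lambda>t. - (Z t * w t ^ 3)) has_real_derivative - K t * V t) (at t)" for t
  proof (rule DERIV_cong[OF DERIV_minus[OF DERIV_mult[OF d_Z DERIV_power[OF d_w]]]])
    have "w t ^ 3 = w t ^ 3 * ((w t)\<^sup>2 * ((Z t)\<^sup>2 + 1/4))" by (simp add: w_square)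
    then have "V t * w t ^ 3 = V t * (w t ^ 5 * ((Z t)\<^sup>2 + 1/4))" by (simp add: eval_nat_numeral algebra_simps)
    then show "- (V t * w t ^ 3 + real 3 * (- (w t ^ 3 * (Z t * V t)) * w t ^ (3 - Suc 0)) * Z t) = - K t * V t"
      by (simp add: K_def eval_nat_numeral algebra_simps)
  qed
  have 1: "solves2 (\<lambda>t y. - q (Zfam H 0) t 0 * y) V"
    unfolding solves2_def using d_V d2V q_K
    by (intro exI[of _ "\<lambda>t. - (Z t * w t ^ 3)"]) (auto simp: Z_def)
  have kb: "((\<lambda>t. k * b t) has_real_derivative k * b' t) (at t)"
    "((\<lambda>t. k * b' t) has_real_derivative k * (- K t * b t)) (at t)" for t
    by (rule DERIV_cmult[OF d_b(1)], rule DERIV_cmult[OF d_b(2)])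
  have "k * (- K t * b t) = - q (Zfam H 0) t 0 * (k * b t)" for t
    using q_K[of t] by (simp add: Z_def)
  from DERIV_cong[OF kb(2) this] kb(1) have 2: "solves2 (\<lambda>t y. - q (Zfam H 0) t 0 * y) (\<lambda>t. k * b t)"
    unfolding solves2_def by (intro exI[of _ "\<lambda>t. k * b' t"] allI conjI)
  have eq: "V = (\<lambda>t. k * b t)"
  proof (rule solves2_unique[OF lipschitz_rhs_q[OF zero_in] 1 2])
    show "V 0 = k * b 0" by (simp add: Z_0 ab_0)
    show "deriv V 0 = deriv (\<lambda>t. k * b t) 0"
      using DERIV_imp_deriv[OF kb(1)[of 0]] by (simp add: dV ab_0 k_def)
  qed
  moreover have "- (Z t * w t ^ 3) = k * b' t" for t
  proof (rule DERIV_unique[OF d_V[of t]])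
    show "(V has_real_derivative k * b' t) (at t)" unfolding eq by (rule kb(1))
  qed
  ultimately show ?thesis using k by (intro exI[of _ k]) auto
qed

lemma b_shift: "b (t + real N * pi) = s * b t" "b' (t + real N * pi) = s * b' t"
proof -
  obtain k where k: "k \<noteq> 0" "\<And>t. V t = k * b t" "\<And>t. - (Z t * w t ^ 3) = k * b' t"
    using V_eq_b by blast
  have "k * b (t + real N * pi) = k * (s * b t)"
    using V_shift[of t] by (simp add: k(2))
  then show "b (t + real N * pi) = s * b t" using k(1) by simp
  have "k * b' (t + real N * pi) = s * - (Z t * w t ^ 3)"
    using k(3)[of "t + real N * pi"] by (simp add: s(2) w_shift)
  also have "\<dots> = k * (s * b' t)" unfolding k(3) by simp
  finally have "k * b' (t + real N * pi) = k * (s * b' t)" .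
  then show "b' (t + real N * pi) = s * b' t" using k(1) by simp
qed

lemma b_period: "b (2 * real N * pi) = 0" "b' (2 * real N * pi) = 1"
proof -
  have "b (2 * real N * pi) = s * (s * b 0)" "b' (2 * real N * pi) = s * (s * b' 0)"
    using b_shift[of "real N * pi"] b_shift[of 0] by (simp_all add: algebra_simps)
  then show "b (2 * real N * pi) = 0" "b' (2 * real N * pi) = 1"
    using s(1) by (simp_all add: ab_0 power2_eq_square)
qed

text \<open>The Wronskian \<open>a * b' - a' * b\<close> is constant, and \<open>b\<close> has
  returned to its initial data.\<close>

lemma a_period: "a (2 * real N * pi) = 1"
proof -
  have "((\<lambda>t. a t * b' t - a' t * b t) has_real_derivative 0) (at t within S)" for t S
    by (rule DERIV_cong[OF DERIV_diff[OF DERIV_mult[OF DERIV_subset[OF d_a(1)] DERIV_subset[OF d_b(2)]]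
          DERIV_mult[OF DERIV_subset[OF d_a(2)] DERIV_subset[OF d_b(1)]]]]) (auto simp: algebra_simps)
  then have "a (2 * real N * pi) * b' (2 * real N * pi) - a' (2 * real N * pi) * b (2 * real N * pi)
      = a 0 * b' 0 - a' 0 * b 0"
    by (intro DERIV_zero_const[of "2 * real N * pi"]) auto
  then show ?thesis by (simp add: b_period ab_0)
qed

lemma Delta_0: "Delta N H 0 = 2"
  using a_period b_period by (simp add: Delta_hill_sol a_def b_def b'_def)

end

section \<open>Vanishing first derivative of the discriminant\<close>

context sitnikov_family
begin

text \<open>By the symmetry \<open>(t, e) \<mapsto> (t + N \<pi>, - e)\<close>, which needs \<open>N\<close> odd, the first order term in \<open>e\<close> of the
  Hill coefficient along the family changes sign under \<open>t \<mapsto> t + N \<pi>\<close>, whereas \<open>b\<^sup>2\<close> does not.\<close>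

lemma Delta_deriv_0:
  assumes c: "0 < c" "c < E"
  shows "(Delta N H has_real_derivative 0) (at 0 within {0..c})"
proof -
  define J where "J = {0..c}"
  \<comment> \<open>Functions shifted by \<open>N \<pi>\<close> are compared on the whole period
    \<open>{0..2 N \<pi>}\<close>, which uses times up to \<open>3 N \<pi>\<close>.\<close>
  define T where "T = 3 * (real N * pi)"
  have T: "0 \<le> T" by (simp add: T_def)
  have "\<exists>Y. flow_family (tangent anomaly_field) T J (\<lambda>t e. (X t e, Y t e)) \<and>
    cdiff (Suc 0) J (\<lambda>e. (X 0 e, Y 0 e)) \<and>
    (\<forall>e\<in>J. \<forall>t\<in>{0..T}. (X t has_vector_derivative Y t e) (at e within J))"
    unfolding J_def
    by (rule flow_family_cdiff_step[OF vpoly_anomaly_field flow_family_X[OF c] _ _ T cdiff_X0[OF c(2)]]) auto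
  then obtain Y where flow: "flow_family (tangent anomaly_field) T J (\<lambda>t e. (X t e, Y t e))"
    and dX: "\<forall>e\<in>J. \<forall>t\<in>{0..T}. (X t has_vector_derivative Y t e) (at e within J)" by blast
  have J0: "0 \<in> J" using c by (simp add: J_def)
  have J: "e \<in> {0..<E}" if "e \<in> J" for e using that c by (simp add: J_def)
  have nontrivial: "at 0 within J \<noteq> bot"
    using c by (simp add: J_def at_within_Icc_at_right)
  have unique: "d = d'" if "(f has_real_derivative d) (at 0 within J)" "(f has_real_derivative d') (at 0 within J)"
    for f d d'
    using that vector_derivative_unique_within[OF nontrivial]
    by (simp add: has_real_derivative_iff_has_vector_derivative)
  have const: "d = 0" if f: "(f has_real_derivative d) (at 0 within J)" and k: "\<And>e. e \<in> J \<Longrightarrow> f e = k" for f d k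
  proof (rule unique[OF f])
    show "(f has_real_derivative 0) (at 0 within J)"
      unfolding has_real_derivative_iff_has_vector_derivative
      by (rule has_vector_derivative_transform[OF J0 k has_vector_derivative_const])
  qed
  obtain \<zeta> \<eta> \<omega> \<gamma> \<gamma>' \<epsilon> \<alpha> \<alpha>' \<beta> \<beta>' where Y: "\<And>u. Y u 0 = (\<zeta> u, \<eta> u, \<omega> u, \<gamma> u, \<gamma>' u, \<epsilon> u, \<alpha> u, \<alpha>' u, \<beta> u, \<beta>' u)"
  proof
    show "Y u 0 = (fst (Y u 0), fst (snd (Y u 0)), fst (snd (snd (Y u 0))), fst (snd (snd (snd (Y u 0)))),
      fst (snd (snd (snd (snd (Y u 0))))), fst (snd (snd (snd (snd (snd (Y u 0)))))),
      fst (snd (snd (snd (snd (snd (snd (Y u 0))))))), fst (snd (snd (snd (snd (snd (snd (snd (Y u 0)))))))),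
      fst (snd (snd (snd (snd (snd (snd (snd (snd (Y u 0))))))))),
      snd (snd (snd (snd (snd (snd (snd (snd (snd (Y u 0))))))))))" for u by simp
  qed
  have X_eq: "X u = (\<lambda>e. (Zfam H e (u - e * sin u), deriv (Zfam H e) (u - e * sin u),
      1 / sqrt ((Zfam H e (u - e * sin u))\<^sup>2 + ((1 - e * cos u) / 2)\<^sup>2), cos u, sin u, e,
      hill_sol 1 0 e (u - e * sin u), deriv (hill_sol 1 0 e) (u - e * sin u),
      hill_sol 0 1 e (u - e * sin u), deriv (hill_sol 0 1 e) (u - e * sin u)))" for u
    by (simp add: X_def[abs_def] anomaly_state_def)
  have X_0: "X u 0 = (Z u, V u, w u, cos u, sin u, 0, a u, a' u, b u, b' u)" for u
    by (simp add: X_eq Z_def V_def w_def a_def a'_def b_def b'_def)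
  have comp:
    "((\<lambda>e. Zfam H e (u - e * sin u)) has_real_derivative \<zeta> u) (at 0 within J)"
    "((\<lambda>e. deriv (Zfam H e) (u - e * sin u)) has_real_derivative \<eta> u) (at 0 within J)"
    "((\<lambda>e. 1 / sqrt ((Zfam H e (u - e * sin u))\<^sup>2 + ((1 - e * cos u) / 2)\<^sup>2)) has_real_derivative \<omega> u) (at 0 within J)"
    "((\<lambda>e. cos u) has_real_derivative \<gamma> u) (at 0 within J)"
    "((\<lambda>e. sin u) has_real_derivative \<gamma>' u) (at 0 within J)"
    "((\<lambda>e. e) has_real_derivative \<epsilon> u) (at 0 within J)"
    "((\<lambda>e. hill_sol 1 0 e (u - e * sin u)) has_real_derivative \<alpha> u) (at 0 within J)"
    "((\<lambda>e. deriv (hill_sol 1 0 e) (u - e * sin u)) has_real_derivative \<alpha>' u) (at 0 within J)"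
    "((\<lambda>e. hill_sol 0 1 e (u - e * sin u)) has_real_derivative \<beta> u) (at 0 within J)"
    "((\<lambda>e. deriv (hill_sol 0 1 e) (u - e * sin u)) has_real_derivative \<beta>' u) (at 0 within J)"
    if "u \<in> {0..T}" for u
  proof -
    have "(X u has_vector_derivative Y u 0) (at 0 within J)" using dX J0 that by blast
    then show
      "((\<lambda>e. Zfam H e (u - e * sin u)) has_real_derivative \<zeta> u) (at 0 within J)"
      "((\<lambda>e. deriv (Zfam H e) (u - e * sin u)) has_real_derivative \<eta> u) (at 0 within J)"
      "((\<lambda>e. 1 / sqrt ((Zfam H e (u - e * sin u))\<^sup>2 + ((1 - e * cos u) / 2)\<^sup>2)) has_real_derivative \<omega> u) (at 0 within J)"
      "((\<lambda>e. cos u) has_real_derivative \<gamma> u) (at 0 within J)"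
      "((\<lambda>e. sin u) has_real_derivative \<gamma>' u) (at 0 within J)"
      "((\<lambda>e. e) has_real_derivative \<epsilon> u) (at 0 within J)"
      "((\<lambda>e. hill_sol 1 0 e (u - e * sin u)) has_real_derivative \<alpha> u) (at 0 within J)"
      "((\<lambda>e. deriv (hill_sol 1 0 e) (u - e * sin u)) has_real_derivative \<alpha>' u) (at 0 within J)"
      "((\<lambda>e. hill_sol 0 1 e (u - e * sin u)) has_real_derivative \<beta> u) (at 0 within J)"
      "((\<lambda>e. deriv (hill_sol 0 1 e) (u - e * sin u)) has_real_derivative \<beta>' u) (at 0 within J)"
      unfolding X_eq Y has_vector_derivative_Pair_iff has_real_derivative_iff_has_vector_derivative
      by blast+
  qed
  have \<gamma>: "\<gamma> u = 0" "\<gamma>' u = 0" "\<epsilon> u = 1" if "u \<in> {0..T}" for u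
    using unique[OF comp(4)[OF that] DERIV_const] unique[OF comp(5)[OF that] DERIV_const]
      unique[OF comp(6)[OF that] DERIV_ident] by auto
  \<comment> \<open>The component \<open>w\<close> is a function of position and radius, so its
    variation is determined by \<open>\<zeta>\<close>; the radius contributes
    \<open>cos u / 4\<close>.\<close>
  have \<omega>: "\<omega> u = - (w u ^ 3 * (Z u * \<zeta> u - cos u / 4))" if u: "u \<in> {0..T}" for u
  proof (rule unique[OF comp(3)[OF u]])
    define z where "z = (\<lambda>e. Zfam H e (u - e * sin u))"
    have z0: "z 0 = Z u" by (simp add: z_def Z_def)
    have dz: "(z has_real_derivative \<zeta> u) (at 0 within J)" using comp(1)[OF u] by (simp add: z_def)
    have "((\<lambda>e. (1 - e * cos u) / 2) has_real_derivative - cos u / 2) (at 0 within J)"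
      by (auto intro!: derivative_eq_intros)
    from DERIV_add[OF DERIV_power[OF dz] DERIV_power[OF this]]
    have "((\<lambda>e. (z e)\<^sup>2 + ((1 - e * cos u) / 2)\<^sup>2) has_real_derivative 2 * (Z u * \<zeta> u - cos u / 4)) (at 0 within J)"
      by (rule DERIV_cong) (simp add: z0)
    from DERIV_inverse_sqrt[OF this]
    have "((\<lambda>e. 1 / sqrt ((z e)\<^sup>2 + ((1 - e * cos u) / 2)\<^sup>2)) has_real_derivative
        - ((1 / sqrt ((z 0)\<^sup>2 + ((1 - 0 * cos u) / 2)\<^sup>2)) ^ 3 * (2 * (Z u * \<zeta> u - cos u / 4) / 2))) (at 0 within J)"
      using radicand_pos[of u] by (simp add: z0)
    then show "((\<lambda>e. 1 / sqrt ((Zfam H e (u - e * sin u))\<^sup>2 + ((1 - e * cos u) / 2)\<^sup>2)) has_real_derivative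
        - (w u ^ 3 * (Z u * \<zeta> u - cos u / 4))) (at 0 within J)"
      unfolding z_def by (rule DERIV_cong) (simp add: w_def Z_def)
  qed
  \<comment> \<open>\<open>k\<close> is minus the first variation, in \<open>e\<close>, of the Hill
    coefficient multiplied by \<open>dt/du\<close>.\<close>
  define k where "k u = cos u * K u + (cos u / 2 + 4 * Z u * \<zeta> u) * w u ^ 5
      - 5 * (1/4 - 2 * (Z u)\<^sup>2) * w u ^ 4 * \<omega> u" for u
  have ode:
    "(\<zeta> has_real_derivative \<eta> u - cos u * V u) (at u within {0..T})"
    "(\<eta> has_real_derivative cos u * Z u * w u ^ 3 - \<zeta> u * w u ^ 3 - 3 * Z u * (w u)\<^sup>2 * \<omega> u) (at u within {0..T})"
    "(\<alpha> has_real_derivative \<alpha>' u - cos u * a' u) (at u within {0..T})"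
    "(\<alpha>' has_real_derivative k u * a u - K u * \<alpha> u) (at u within {0..T})"
    "(\<beta> has_real_derivative \<beta>' u - cos u * b' u) (at u within {0..T})"
    "(\<beta>' has_real_derivative k u * b u - K u * \<beta> u) (at u within {0..T})"
    if u: "u \<in> {0..T}" for u
  proof -
    have "((\<lambda>t. (X t 0, Y t 0)) has_vector_derivative tangent anomaly_field (X u 0, Y u 0)) (at u within {0..T})"
      using flow J0 u unfolding flow_family_def by blast
    then have "((\<lambda>t. Y t 0) has_vector_derivative frechet_derivative anomaly_field (at (X u 0)) (Y u 0)) (at u within {0..T})"
      unfolding tangent_def fst_conv snd_conv has_vector_derivative_Pair_iff by blast
    then show
      "(\<zeta> has_real_derivative \<eta> u - cos u * V u) (at u within {0..T})"
      "(\<eta> has_real_derivative cos u * Z u * w u ^ 3 - \<zeta> u * w u ^ 3 - 3 * Z u * (w u)\<^sup>2 * \<omega> u) (at u within {0..T})"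
      "(\<alpha> has_real_derivative \<alpha>' u - cos u * a' u) (at u within {0..T})"
      "(\<alpha>' has_real_derivative k u * a u - K u * \<alpha> u) (at u within {0..T})"
      "(\<beta> has_real_derivative \<beta>' u - cos u * b' u) (at u within {0..T})"
      "(\<beta>' has_real_derivative k u * b u - K u * \<beta> u) (at u within {0..T})"
      unfolding X_0 Y \<gamma>[OF u] anomaly_field_variation has_vector_derivative_Pair_iff
        has_real_derivative_iff_has_vector_derivative k_def K_def
      by blast+
  qed
  have init: "\<alpha> 0 = 0" "\<alpha>' 0 = 0" "\<beta> 0 = 0" "\<beta>' 0 = 0"
  proof -
    have 0: "0 \<in> {0..T}" using T by simp
    show "\<alpha> 0 = 0" by (rule const[OF comp(7)[OF 0], of 1]) (use hill_sol[OF J] in simp)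
    show "\<alpha>' 0 = 0" by (rule const[OF comp(8)[OF 0], of 0]) (use hill_sol[OF J] in simp)
    show "\<beta> 0 = 0" by (rule const[OF comp(9)[OF 0], of 0]) (use hill_sol[OF J] in simp)
    show "\<beta>' 0 = 0" by (rule const[OF comp(10)[OF 0], of 1]) (use hill_sol[OF J] in simp)
  qed
  \<comment> \<open>At multiples of \<open>N \<pi>\<close> time equals anomaly for every
    \<open>e\<close>, and there the velocity vanishes along the whole family.\<close>
  have \<eta>: "\<eta> (real m * (real N * pi)) = 0" if m: "m \<le> 3" for m
  proof (rule const[OF comp(2)])
    have "real m * (real N * pi) \<le> 3 * (real N * pi)" using m by (intro mult_right_mono) auto
    then show "real m * (real N * pi) \<in> {0..T}" by (simp add: T_def)
    fix e assume "e \<in> J"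
    have "sin (real m * (real N * pi)) = 0" using sin_npi[of "m * N"] by (simp add: mult.assoc)
    then show "deriv (Zfam H e) (real m * (real N * pi) - e * sin (real m * (real N * pi))) = 0"
      using deriv_Zfam_half_period[OF J[OF \<open>e \<in> J\<close>]] by simp
  qed
  define P2 where "P2 = 2 * (real N * pi)"
  have P2: "P2 \<in> {0..T}" "P2 = T - real N * pi" by (simp_all add: P2_def T_def)
  have sub: "(f has_real_derivative d) (at u within {0..P})" if "(f has_real_derivative d) (at u within {0..T})" "P \<le> T"
    for f d u P
    using that(1) by (rule DERIV_subset) (use that(2) in auto)
  note at = DERIV_subset[OF _ subset_UNIV]
  \<comment> \<open>This combination is the derivative in \<open>e\<close> of the Wronskian, which
    is 1 for every \<open>e\<close>. At the end of the period it expresses the variation of the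
    trace through \<open>\<beta>\<close> and \<open>a'\<close>.\<close>
  have "((\<lambda>u. (\<alpha> u * b' u - \<alpha>' u * b u) + (\<beta>' u * a u - \<beta> u * a' u)) has_real_derivative 0) (at u within {0..T})"
    if u: "u \<in> {0..T}" for u
    by (rule DERIV_cong[OF DERIV_add[OF
        DERIV_diff[OF DERIV_mult[OF ode(3)[OF u] at[OF d_b(2)]] DERIV_mult[OF ode(4)[OF u] at[OF d_b(1)]]]
        DERIV_diff[OF DERIV_mult[OF ode(6)[OF u] at[OF d_a(1)]] DERIV_mult[OF ode(5)[OF u] at[OF d_a(2)]]]]])
      (simp add: algebra_simps)
  from DERIV_zero_const[OF this P2(1)]
  have trace: "\<alpha> P2 + \<beta>' P2 = \<beta> P2 * a' P2"
    using b_period a_period by (simp add: init P2_def mult.assoc)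
  \<comment> \<open>Only if \<open>a' P2\<close> is nonzero is the symmetry of
    \<open>\<zeta>\<close> derived; it then forces \<open>\<beta> P2 = 0\<close>.\<close>
  have "\<beta> P2 * a' P2 = 0"
  proof (cases "a' P2 = 0")
    case False
    define h where "h = real N * pi"
    note shifts = V_shift[folded h_def] w_shift[folded h_def] K_shift[folded h_def]
      s(2)[folded h_def] b_shift[folded h_def]
    have P2h: "P2 = 2 * h" "P2 = T - h" "0 \<le> h" by (simp_all add: P2_def T_def h_def)
    have shift: "((\<lambda>u. f (u + h)) has_real_derivative d) (at u within {0..P2})"
      if "(f has_real_derivative d) (at (u + h) within {0..T})" for f d u
      using DERIV_shift_within[OF that P2h(3)] by (simp add: P2h(2))
    have mem: "u \<in> {0..T}" "u + h \<in> {0..T}" if "u \<in> {0..P2}" for u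
      using that P2h unfolding atLeastAtMost_iff by linarith+
    have cos_shift: "cos (u + h) = - cos u" for u
    proof -
      have "cos h = - 1" using cos_npi[of N] N by (simp add: h_def)
      moreover have "sin h = 0" unfolding h_def by (rule sin_npi)
      ultimately show ?thesis by (simp add: cos_add)
    qed
    have ss: "s * s = 1" "s * (s * x) = x" for x
      using s(1) by (simp_all add: power2_eq_square flip: mult.assoc)
    \<comment> \<open>\<open>\<delta>\<close> measures how far \<open>\<zeta>\<close> is from
      \<open>\<zeta> (u + h) = - s * \<zeta> u\<close>. The terms with \<open>cos u\<close> cancel,
      since the cosine changes sign under the shift, and \<open>\<delta>\<close> solves the Hill
      equation at \<open>e = 0\<close>.\<close>
    define \<delta> where "\<delta> u = \<zeta> u + s * \<zeta> (u + h)" for u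
    define \<delta>' where "\<delta>' u = \<eta> u + s * \<eta> (u + h)" for u
    have P2T: "P2 \<le> T" using P2(1) by simp
    have d\<delta>: "(\<delta> has_real_derivative \<delta>' u) (at u within {0..P2})" if u: "u \<in> {0..P2}" for u
      unfolding \<delta>_def
      by (rule DERIV_cong[OF DERIV_add[OF sub[OF ode(1)[OF mem(1)[OF u]] P2T] DERIV_cmult[OF shift[OF ode(1)[OF mem(2)[OF u]]]]]])
        (simp add: \<delta>'_def shifts cos_shift, simp add: algebra_simps ss)
    have \<omega>_sum: "\<omega> u + \<omega> (u + h) = - (w u ^ 3 * (Z u * \<delta> u))" if u: "u \<in> {0..P2}" for u
      by (simp add: \<omega>[OF mem(1)[OF u]] \<omega>[OF mem(2)[OF u]] shifts cos_shift \<delta>_def, simp add: algebra_simps)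
    have d\<delta>': "(\<delta>' has_real_derivative - K u * \<delta> u) (at u within {0..P2})" if u: "u \<in> {0..P2}" for u
      unfolding \<delta>'_def
    proof (rule DERIV_cong[OF DERIV_add[OF sub[OF ode(2)[OF mem(1)[OF u]] P2T] DERIV_cmult[OF shift[OF ode(2)[OF mem(2)[OF u]]]]]])
      let ?W = "w u" let ?Z = "Z u"
      have "cos u * ?Z * ?W ^ 3 - \<zeta> u * ?W ^ 3 - 3 * ?Z * ?W\<^sup>2 * \<omega> u +
          s * (cos (u + h) * Z (u + h) * w (u + h) ^ 3 - \<zeta> (u + h) * w (u + h) ^ 3
            - 3 * Z (u + h) * (w (u + h))\<^sup>2 * \<omega> (u + h))
        = - (?W ^ 3 * \<delta> u) - 3 * ?Z * ?W\<^sup>2 * (\<omega> u + \<omega> (u + h))"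
        by (simp add: shifts cos_shift \<delta>_def, simp add: algebra_simps ss)
      also have "\<dots> = - (?W ^ 3 * (?W\<^sup>2 * (?Z\<^sup>2 + 1/4)) * \<delta> u) - 3 * ?Z * ?W\<^sup>2 * - (?W ^ 3 * (?Z * \<delta> u))"
        by (simp only: w_square \<omega>_sum[OF u] mult_1_right)
      also have "\<dots> = - K u * \<delta> u"
        by (simp add: K_def eval_nat_numeral algebra_simps)
      finally show "cos u * ?Z * ?W ^ 3 - \<zeta> u * ?W ^ 3 - 3 * ?Z * ?W\<^sup>2 * \<omega> u +
          s * (cos (u + h) * Z (u + h) * w (u + h) ^ 3 - \<zeta> (u + h) * w (u + h) ^ 3
            - 3 * Z (u + h) * (w (u + h))\<^sup>2 * \<omega> (u + h)) = - K u * \<delta> u" .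
    qed
    \<comment> \<open>Since \<open>\<eta>\<close> vanishes at 0 and at \<open>h\<close>,
      \<open>\<delta>\<close> and \<open>\<delta> 0 * a\<close> have the same initial data and
      coincide.\<close>
    define D where "D u = \<delta> u - \<delta> 0 * a u" for u
    define D' where "D' u = \<delta>' u - \<delta> 0 * a' u" for u
    have "norm (D u, D' u) \<le> norm (D 0, D' 0) * exp ((17 + 1) * P2)" if u: "u \<in> {0..P2}" for u
    proof (rule gronwall_linear[where f = "\<lambda>u. (D u, D' u)" and f' = "\<lambda>u. (D' u, - K u * D u)", OF _ _ _ u])
      fix u assume u: "u \<in> {0..P2}"
      have "(D has_real_derivative D' u) (at u within {0..P2})"
        unfolding D_def D'_def by (rule DERIV_diff[OF d\<delta>[OF u] DERIV_cmult[OF at[OF d_a(1)]]])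
      moreover have "(D' has_real_derivative - K u * D u) (at u within {0..P2})"
        unfolding D'_def
        by (rule DERIV_cong[OF DERIV_diff[OF d\<delta>'[OF u] DERIV_cmult[OF at[OF d_a(2)]]]])
          (simp add: D_def algebra_simps)
      ultimately show "((\<lambda>u. (D u, D' u)) has_vector_derivative (D' u, - K u * D u)) (at u within {0..P2})"
        by (simp add: has_vector_derivative_Pair_iff has_real_derivative_iff_has_vector_derivative)
      have "norm (D' u, - K u * D u) \<le> norm (D' u) + \<bar>K u\<bar> * norm (D u)"
        using norm_Pair_le[of "D' u" "- K u * D u"] by (simp add: abs_mult)
      also have "\<dots> \<le> norm (D u, D' u) + 16 * norm (D u, D' u)"
        using norm_fst_le[of "D u" "D' u"] norm_snd_le[of "D' u" "D u"] K_bound[of u]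
        by (intro add_mono mult_mono) auto
      finally show "norm (D' u, - K u * D u) \<le> 17 * norm (D u, D' u)" by simp
    qed simp
    moreover have "D 0 = 0" "D' 0 = 0"
      using \<eta>[of 0] \<eta>[of 1] by (simp_all add: D_def D'_def \<delta>'_def ab_0 h_def)
    ultimately have D: "D u = 0" "D' u = 0" if "u \<in> {0..P2}" for u
      using that by (auto simp: prod_eq_iff zero_prod_def)
    \<comment> \<open>The vanishing of \<open>\<eta>\<close> at \<open>2 N \<pi>\<close> and
      \<open>3 N \<pi>\<close> gives a second boundary condition; as \<open>a' P2\<close> is
      nonzero, it forces \<open>\<delta> 0 = 0\<close>.\<close>
    have "\<delta>' P2 = 0"
    proof -
      have "P2 = real 2 * (real N * pi)" by (simp add: P2_def)
      then have "\<eta> P2 = 0" by (rule ssubst) (rule \<eta>, simp)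
      have "P2 + h = real 3 * (real N * pi)" by (simp add: P2_def h_def)
      then have "\<eta> (P2 + h) = 0" by (rule ssubst) (rule \<eta>, simp)
      with \<open>\<eta> P2 = 0\<close> show ?thesis by (simp add: \<delta>'_def)
    qed
    then have "\<delta> 0 * a' P2 = 0" using D(2)[of P2] P2 by (simp add: D'_def)
    then have \<delta>: "\<delta> u = 0" if "u \<in> {0..P2}" for u
      using D(1)[OF that] False by (simp add: D_def)
    have \<zeta>_shift: "\<zeta> (u + h) = - s * \<zeta> u" if "u \<in> {0..P2}" for u
    proof -
      have "s * (\<zeta> u + s * \<zeta> (u + h)) = 0" using \<delta>[OF that] by (simp add: \<delta>_def)
      then show ?thesis by (simp add: distrib_left ss)
    qed
    have k_shift: "k (u + h) = - k u" if u: "u \<in> {0..P2}" for u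
    proof -
      have "\<omega> (u + h) = - \<omega> u" using \<omega>_sum[OF u] by (simp add: \<delta>[OF u])
      then show ?thesis
        using s(1) by (simp add: k_def shifts cos_shift \<zeta>_shift[OF u] power_mult_distrib, simp add: algebra_simps ss)
    qed
    \<comment> \<open>\<open>G\<close> is the Wronskian of the variation \<open>\<beta>\<close> with
      \<open>b\<close>. Its derivative changes sign under the shift by \<open>h\<close>, so
      \<open>G u + G (u + h)\<close> is constant; comparing \<open>u = 0\<close> with
      \<open>u = h\<close> gives \<open>G P2 = G 0\<close>, and \<open>G P2\<close> is
      \<open>\<beta> P2\<close>.\<close>
    define G where "G u = \<beta> u * b' u - \<beta>' u * b u" for u
    define m where "m u = - (cos u * (b' u)\<^sup>2) - k u * (b u)\<^sup>2" for u
    have dG: "(G has_real_derivative m u) (at u within {0..T})" if u: "u \<in> {0..T}" for u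
      unfolding G_def
      by (rule DERIV_cong[OF DERIV_diff[OF DERIV_mult[OF ode(5)[OF u] at[OF d_b(2)]] DERIV_mult[OF ode(6)[OF u] at[OF d_b(1)]]]])
        (simp add: m_def algebra_simps power2_eq_square)
    have m_shift: "m (u + h) = - m u" if u: "u \<in> {0..P2}" for u
      using s(1) by (simp add: m_def shifts cos_shift k_shift[OF u] power_mult_distrib)
    have "((\<lambda>u. G u + G (u + h)) has_real_derivative 0) (at u within {0..P2})" if u: "u \<in> {0..P2}" for u
      by (rule DERIV_cong[OF DERIV_add[OF sub[OF dG[OF mem(1)[OF u]] P2T] shift[OF dG[OF mem(2)[OF u]]]]])
        (simp add: m_shift[OF u])
    from DERIV_zero_const[OF this, of h] have "G P2 = G 0"
      using P2h by simp
    then have "\<beta> P2 = 0" using b_period by (simp add: G_def P2_def mult.assoc init ab_0)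
    then show ?thesis by simp
  qed simp
  with trace have tr: "\<alpha> P2 + \<beta>' P2 = 0" by simp
  have "sin P2 = 0" using sin_npi[of "2 * N"] by (simp add: P2_def mult.assoc)
  then have "Delta N H = (\<lambda>e. hill_sol 1 0 e (P2 - e * sin P2) + deriv (hill_sol 0 1 e) (P2 - e * sin P2))"
    by (simp add: Delta_hill_sol[abs_def] P2_def mult.assoc)
  moreover have "((\<lambda>e. hill_sol 1 0 e (P2 - e * sin P2) + deriv (hill_sol 0 1 e) (P2 - e * sin P2))
      has_real_derivative 0) (at 0 within J)"
    by (rule DERIV_cong[OF DERIV_add[OF comp(7)[OF P2(1)] comp(10)[OF P2(1)]] tr])
  ultimately show ?thesis by (simp add: J_def)
qed

end

section \<open>The stability criterion\<close>

text \<open>Regularity is known on each \<open>{0..c}\<close>, but the derivatives in question are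
  relative to \<open>{0..b}\<close>. At a point below \<open>c\<close> both intervals have the same
  neighbourhood filter, so the derivatives agree; midpoints provide the room for a larger
  \<open>c\<close>.\<close>

lemma deriv_on_iterates:
  assumes "\<And>c. 0 < c \<Longrightarrow> c < b \<Longrightarrow> cdiff n {0..c} f" and "k < n" and "e \<in> {0..<b}"
  shows "((deriv_on {0..b} ^^ k) f has_real_derivative (deriv_on {0..b} ^^ Suc k) f e) (at e within {0..b})"
  using assms
proof (induction n arbitrary: f k)
  case (Suc n)
  have local: "(f has_vector_derivative f' e) (at e within {0..b})" "deriv_on {0..b} f e = f' e"
    if f': "\<forall>e\<in>{0..c}. (f has_vector_derivative f' e) (at e within {0..c})" and e: "0 \<le> e" "e < c" and c: "c < b"
    for c f' e
  proof -
    have "at e within {0..c} = at e within {0..b}"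
      by (rule at_within_nhd[of e "{..<c}"]) (use e c in auto)
    then show d: "(f has_vector_derivative f' e) (at e within {0..b})"
      using f' e by (metis atLeastAtMost_iff less_imp_le)
    have "at e within {0..b} \<noteq> bot"
      using e c by (simp add: trivial_limit_within islimpt_Icc)
    then show "deriv_on {0..b} f e = f' e"
      unfolding deriv_on_def using d by (rule vector_derivative_within)
  qed
  have deriv: "(f has_real_derivative deriv_on {0..b} f e) (at e within {0..b})" if e: "e \<in> {0..<b}" for e
  proof -
    define c where "c = (e + b) / 2"
    have c: "0 < c" "e < c" "c < b" using e by (auto simp: c_def)
    obtain f' where f': "\<forall>e\<in>{0..c}. (f has_vector_derivative f' e) (at e within {0..c})"
      using Suc.prems(1)[OF c(1,3)] by auto
    from local[OF this _ c(2,3)] e show ?thesis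
      by (simp add: has_real_derivative_iff_has_vector_derivative)
  qed
  have cd: "cdiff n {0..c} (deriv_on {0..b} f)" if c: "0 < c" "c < b" for c
  proof -
    define c' where "c' = (c + b) / 2"
    have c': "0 < c'" "c < c'" "c' < b" using c by (auto simp: c'_def)
    obtain f' where f': "\<forall>e\<in>{0..c'}. (f has_vector_derivative f' e) (at e within {0..c'})" "cdiff n {0..c'} f'"
      using Suc.prems(1)[OF c'(1,3)] by auto
    show ?thesis
    proof (rule cdiff_cong)
      show "cdiff n {0..c} f'" using f'(2) c' by (rule_tac cdiff_subset) auto
      show "f' e = deriv_on {0..b} f e" if "e \<in> {0..c}" for e
        using local(2)[OF f'(1) _ _ c'(3), of e] that c' by simp
    qed
  qed
  show ?case
  proof (cases k)
    case 0
    then show ?thesis using deriv[OF Suc.prems(3)] by simp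
  next
    case (Suc j)
    then have "j < n" using Suc.prems(2) by simp
    from Suc.IH[OF cd this Suc.prems(3)] show ?thesis
      by (simp add: Suc funpow_swap1)
  qed
qed simp

section \<open>Taylor's inequality and the sign of the remainder\<close>

lemma le_if_deriv_le:
  fixes g h :: "real \<Rightarrow> real"
  assumes g: "\<And>x. x \<in> {0..<b} \<Longrightarrow> (g has_real_derivative g' x) (at x within {0..b})"
    and h: "\<And>x. x \<in> {0..<b} \<Longrightarrow> (h has_real_derivative h' x) (at x within {0..b})"
    and le: "\<And>x. x \<in> {0..<b} \<Longrightarrow> g' x \<le> h' x" and init: "g 0 \<le> h 0" and x: "x \<in> {0..<b}"
  shows "g x \<le> h x"
proof -
  have d: "((\<lambda>x. g x - h x) has_real_derivative g' y - h' y) (at y within {0..b})" if "y \<in> {0..<b}" for y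
    by (rule DERIV_diff[OF g[OF that] h[OF that]])
  have decr: "\<exists>d. DERIV (\<lambda>x. g x - h x) y :> d \<and> d \<le> 0" if y: "0 < y" "y < x" for y
    using d[of y] le[of y] y x by (intro exI[of _ "g' y - h' y"]) (simp add: at_within_Icc_at)
  have cont: "continuous_on {0..x} (\<lambda>x. g x - h x)"
  proof (rule DERIV_continuous_on)
    fix y assume "y \<in> {0..x}"
    then show "((\<lambda>x. g x - h x) has_real_derivative g' y - h' y) (at y within {0..x})"
      using x by (intro DERIV_subset[OF d]) auto
  qed
  have "g 0 - h 0 \<ge> g x - h x"
    using x by (intro DERIV_nonpos_imp_decreasing_open[OF _ decr cont]) auto
  then show ?thesis using init by simp
qed

text \<open>The bound on \<open>f3\<close> is integrated three times. Applied to a function and to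
  its negative, the one-sided estimate becomes a two-sided one.\<close>

lemma taylor_upper_bound:
  fixes f0 f1 f2 f3 :: "real \<Rightarrow> real"
  assumes d0: "\<And>x. x \<in> {0..<b} \<Longrightarrow> (f0 has_real_derivative f1 x) (at x within {0..b})"
    and d1: "\<And>x. x \<in> {0..<b} \<Longrightarrow> (f1 has_real_derivative f2 x) (at x within {0..b})"
    and d2: "\<And>x. x \<in> {0..<b} \<Longrightarrow> (f2 has_real_derivative f3 x) (at x within {0..b})"
    and zero: "f1 0 = 0" and K: "\<And>x. x \<in> {0..<b} \<Longrightarrow> f3 x \<le> K" and x: "x \<in> {0..<b}"
  shows "f0 x \<le> f0 0 + f2 0 * x\<^sup>2 / 2 + K * x ^ 3 / 6"
proof -
  have 2: "f2 y \<le> f2 0 + K * y" if "y \<in> {0..<b}" for y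
    by (rule le_if_deriv_le[where b = b and h = "\<lambda>y. f2 0 + K * y", OF d2 _ K _ that]) (auto intro!: derivative_eq_intros)
  have 1: "f1 y \<le> f2 0 * y + K * y\<^sup>2 / 2" if "y \<in> {0..<b}" for y
    by (rule le_if_deriv_le[where b = b and h = "\<lambda>y. f2 0 * y + K * y\<^sup>2 / 2", OF d1 _ 2 _ that])
      (auto intro!: derivative_eq_intros simp: zero)
  show ?thesis
    by (rule le_if_deriv_le[where b = b and h = "\<lambda>y. f0 0 + f2 0 * y\<^sup>2 / 2 + K * y ^ 3 / 6", OF d0 _ 1 _ x])
      (auto intro!: derivative_eq_intros simp: power2_eq_square)
qed

lemma (in sitnikov_family) Delta_taylor:
  assumes L: "Ksup N p xs H = ereal L" and e: "e \<in> {0..<E}"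
  shows "\<bar>Delta N H e - (2 + Delta2 N p xs H * e\<^sup>2 / 2)\<bar> \<le> L * e ^ 3 / 6"
proof -
  define f where "f k = (deriv_on {0..E} ^^ k) (Delta N H)" for k
  have d: "(f k has_real_derivative f (Suc k) x) (at x within {0..E})" if "x \<in> {0..<E}" "k < 3" for k x
    unfolding f_def by (rule deriv_on_iterates[OF cdiff_Delta that(2,1)])
  have bound: "\<bar>f 3 x\<bar> \<le> L" if "x \<in> {0..<E}" for x
  proof -
    have "ereal \<bar>f 3 x\<bar> \<le> Ksup N p xs H"
      unfolding Ksup_def f_def using that by (intro SUP_upper) auto
    then show ?thesis by (simp add: L)
  qed
  have f1: "f (Suc 0) 0 = 0"
  proof -
    define c where "c = E / 2"
    have c: "0 < c" "c < E" using E by (auto simp: c_def)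
    have "at 0 within {0..c} = at 0 within {0..E}"
      by (rule at_within_nhd[of 0 "{..<c}"]) (use c in auto)
    then have "(Delta N H has_vector_derivative 0) (at 0 within {0..E})"
      using Delta_deriv_0[OF c] by (simp add: has_real_derivative_iff_has_vector_derivative)
    moreover have "at 0 within {0..E} \<noteq> bot"
      using E by (simp add: at_within_Icc_at_right)
    ultimately show ?thesis
      by (simp add: f_def deriv_on_def vector_derivative_within)
  qed
  have f0: "f 0 = Delta N H" and f2: "f 2 0 = Delta2 N p xs H"
    by (simp_all add: f_def Delta2_def)
  have d0: "(f 0 has_real_derivative f (Suc 0) x) (at x within {0..E})"
    and d1: "(f (Suc 0) has_real_derivative f 2 x) (at x within {0..E})"
    and d2: "(f 2 has_real_derivative f 3 x) (at x within {0..E})" if "x \<in> {0..<E}" for x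
    using d[OF that, of 0] d[OF that, of 1] d[OF that, of 2] by (simp_all add: numeral_2_eq_2 numeral_3_eq_3)
  have "f 0 e \<le> f 0 0 + f 2 0 * e\<^sup>2 / 2 + L * e ^ 3 / 6"
    by (rule taylor_upper_bound[OF d0 d1 d2 f1 _ e]) (use bound in \<open>auto simp: abs_le_iff\<close>)
  moreover have "- f 0 e \<le> - f 0 0 + - f 2 0 * e\<^sup>2 / 2 + L * e ^ 3 / 6"
    by (rule taylor_upper_bound[where ?f0.0 = "\<lambda>x. - f 0 x" and ?f1.0 = "\<lambda>x. - f (Suc 0) x"
          and ?f2.0 = "\<lambda>x. - f 2 x" and ?f3.0 = "\<lambda>x. - f 3 x",
          OF DERIV_minus[OF d0] DERIV_minus[OF d1] DERIV_minus[OF d2] _ _ e])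
      (use f1 bound in \<open>auto simp: abs_le_iff\<close>)
  ultimately show ?thesis
    unfolding f0 f2 Delta_0 abs_le_iff by (intro conjI) linarith+
qed

theorem theorem2:
  fixes N p :: nat and xs :: real and H :: "real \<Rightarrow> real"
  assumes "odd N"
    and "p \<in> {1..nu N}"
    and "apriori_bound N xs"
    and "periodic_family N p xs H"
  shows
    "(Delta2 N p xs H > 0 \<longrightarrow>
        (\<forall>e. 0 < e \<and> ereal e < min (mu N p xs H) (ereal (e_star N p xs)) \<longrightarrow>
           hyperbolic N (Zfam H e) e)) \<and>
     (Delta2 N p xs H < 0 \<and> P N p xs H (e_star N p xs) > 0 \<longrightarrow>
        (\<forall>e. 0 < e \<and> ereal e < min (mu N p xs H)
                                   (min (ereal (mu0 N p xs H)) (ereal (e_star N p xs))) \<longrightarrow>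
           elliptic N (Zfam H e) e)) \<and>
     (Delta2 N p xs H < 0 \<and> P N p xs H (e_star N p xs) \<le> 0 \<longrightarrow>
        (\<forall>e. 0 < e \<and> ereal e < min (mu N p xs H) (ereal (e_star N p xs)) \<longrightarrow>
           elliptic N (Zfam H e) e))"
proof -
  define D where "D = Delta2 N p xs H"
  have "ereal 0 \<le> Ksup N p xs H" if "0 < e_star N p xs"
    unfolding Ksup_def by (rule SUP_upper2[of 0]) (use that in auto)
  \<comment> \<open>An infinite \<open>Ksup\<close> makes \<open>mu\<close> equal to 0, which leaves
    no admissible \<open>e\<close>; hence \<open>K\<close> is real.\<close>
  then have bounds: "\<exists>K\<ge>0. Ksup N p xs H = ereal K \<and> K * e < 3 * \<bar>D\<bar> \<and>
      \<bar>Delta N H e - (2 + D * e\<^sup>2 / 2)\<bar> \<le> K * e ^ 3 / 6"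
    if "D \<noteq> 0" "0 < e" "ereal e < mu N p xs H" "e < e_star N p xs" for e
  proof (cases "Ksup N p xs H")
    case (real K)
    interpret sitnikov_family N p xs H
      using assms that by unfold_locales (auto simp: apriori_bound_def)
    have "0 \<le> K" using \<open>_ \<Longrightarrow> ereal 0 \<le> _\<close> E real by simp
    \<comment> \<open>For \<open>K = 0\<close> the value of \<open>mu\<close> is infinite and the
      inequality reduces to \<open>D \<noteq> 0\<close>.\<close>
    moreover have "K * e < 3 * \<bar>D\<bar>"
      using that \<open>0 \<le> K\<close> by (cases "K = 0") (auto simp: mu_def real D_def[symmetric] pos_less_divide_eq mult.commute)
    ultimately show ?thesis
      using Delta_taylor[OF real, of e] that real by (auto simp: D_def)
  qed (use that in \<open>auto simp: mu_def\<close>)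
  have hyp: "hyperbolic N (Zfam H e) e"
    if "D > 0" "0 < e" "ereal e < mu N p xs H" "e < e_star N p xs" for e
  proof -
    have "D \<noteq> 0" using that by simp
    from bounds[OF this that(2-4)]
    obtain K where K: "K * e < 3 * \<bar>D\<bar>" "\<bar>Delta N H e - (2 + D * e\<^sup>2 / 2)\<bar> \<le> K * e ^ 3 / 6"
      by blast
    \<comment> \<open>Multiplied by the square of \<open>e\<close>, the condition
      \<open>e < mu\<close> says that the Taylor remainder is smaller than the quadratic term, so
      the sign of \<open>D\<close> decides.\<close>
    have "K * e * e\<^sup>2 < 3 * D * e\<^sup>2"
      using K(1) that by (intro mult_strict_right_mono) auto
    then have "K * e ^ 3 < 3 * (D * e\<^sup>2)"
      by (simp add: power2_eq_square power3_eq_cube mult.assoc)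
    then have "2 < Delta N H e"
      using K(2) by linarith
    then show ?thesis by (simp add: hyperbolic_def Delta_def)
  qed
  have ell: "elliptic N (Zfam H e) e"
    if "D < 0" "0 < e" "ereal e < mu N p xs H" "e < e_star N p xs" "P N p xs H e < 0" for e
  proof -
    have "D \<noteq> 0" using that by simp
    from bounds[OF this that(2-4)]
    obtain K where K: "Ksup N p xs H = ereal K" "K * e < 3 * \<bar>D\<bar>"
      "\<bar>Delta N H e - (2 + D * e\<^sup>2 / 2)\<bar> \<le> K * e ^ 3 / 6"
      by blast
    have "K * e * e\<^sup>2 < - (3 * D) * e\<^sup>2"
      using K(2) that by (intro mult_strict_right_mono) auto
    then have "K * e ^ 3 < - (3 * (D * e\<^sup>2))"
      by (simp add: power2_eq_square power3_eq_cube mult.assoc)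
    then have "Delta N H e < 2"
      using K(3) by linarith
    \<comment> \<open>\<open>P e < 0\<close> is six times the inequality saying that Taylor's lower
      bound exceeds - 2; this is the origin of the coefficients 3 and 24.\<close>
    moreover have "K * e ^ 3 - 3 * D * e\<^sup>2 - 24 < 0"
      using that(5) by (simp add: P_def K(1) D_def[symmetric] numeral_eq_ereal)
    then have "- 2 < Delta N H e"
      using K(3) by linarith
    ultimately show ?thesis by (simp add: elliptic_def Delta_def)
  qed
  \<comment> \<open>Monotonicity reduces the negativity of \<open>P\<close> at \<open>e\<close> to
    its sign at a point to the right: the root \<open>mu0\<close> in one case, the endpoint
    \<open>e_star\<close> in the other.\<close>
  have P_less: "P N p xs H x < P N p xs H y"
    if "D < 0" "0 \<le> K" "Ksup N p xs H = ereal K" "0 < x" "x < y" for K x y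
  proof -
    have "K * x ^ 3 \<le> K * y ^ 3" using that by (intro mult_left_mono power_mono) auto
    moreover have "- D * x\<^sup>2 < - D * y\<^sup>2"
      using that by (intro mult_strict_left_mono power_strict_mono) auto
    ultimately show ?thesis
      by (simp add: P_def that(3) D_def[symmetric] numeral_eq_ereal)
  qed
  have ell_mu0: "elliptic N (Zfam H e) e"
    if e: "D < 0" "0 < e" "ereal e < mu N p xs H" "e < e_star N p xs" "e < mu0 N p xs H" for e
  proof -
    have "D \<noteq> 0" using e by simp
    from bounds[OF this e(2-4)] obtain K where K: "0 \<le> K" "Ksup N p xs H = ereal K" by blast
    have "P N p xs H (mu0 N p xs H) = 0"
      using theI'[OF mu0_unique[OF K(2,1)]] e(1) by (simp add: mu0_def D_def)
    then have "P N p xs H e < 0" using P_less[OF e(1) K e(2,5)] by simp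
    then show ?thesis using ell e by blast
  qed
  have ell_end: "elliptic N (Zfam H e) e"
    if e: "D < 0" "P N p xs H (e_star N p xs) \<le> 0" "0 < e" "ereal e < mu N p xs H" "e < e_star N p xs" for e
  proof -
    have "D \<noteq> 0" using e by simp
    from bounds[OF this e(3-5)] obtain K where K: "0 \<le> K" "Ksup N p xs H = ereal K" by blast
    have "P N p xs H e < 0" using P_less[OF e(1) K e(3,5)] e(2) by simp
    then show ?thesis using ell e by blast
  qed
  show ?thesis
    using hyp ell_mu0 ell_end by (auto simp: D_def)
qed

end
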